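(* Let $(M,g)$ be a pointwise Osserman lightlike hypersurface of a semi-Riemannian manifold $(\overline{M}(c),\overline{g})$ of constant sectional curvature $c$, such that $A_{N}\xi$ is a non-null vector field. Then for an admissible screen distribution $S(TM)$, the lightlike hypersurface $(M,g,S(TM))$ is locally symmetric if and only if it is semi-symmetric.
   Context: $(\overline{M},\overline{g})$ is a semi-Riemannian manifold of constant index $\ge1$ with Levi-Civita connection $\overline{\nabla}$; constant curvature $c$ means $\overline{R}(X,Y)Z=c\{\overline{g}(Y,Z)X-\overline{g}(X,Z)Y\}$. A hypersurface $M$ with $g=\overline{g}|_{TM}$ is lightlike if $\mathrm{Rad}\,TM=TM\cap TM^{\perp}=TM^{\perp}$ is a smooth distribution of rank 1. A screen distribution $S(TM)$ is a semi-Riemannian (non-degenerate) complement of $\mathrm{Rad}\,TM$ in $TM$. For a local nowhere-zero section $\xi$ of $\mathrm{Rad}\,TM$ there is a unique local section $N$ of $S(TM)^{\perp}$ with $\overline{g}(\xi,N)=1$, $\overline{g}(N,N)=0$; $\{\xi,N\}$ is a normalizing pair and $tr(TM)=\mathrm{Span}\{N\}$. For $X,Y\in\Gamma(TM)$: $\overline{\nabla}_XY=\nabla_XY+B(X,Y)N$ and $\overline{\nabla}_XN=-A_NX+\tau(X)N$, with $\nabla_XY,A_NX\in\Gamma(TM)$. "$A_N\xi$ is non-null" means $g(A_N\xi,A_N\xi)\neq0$ (everywhere), where $N$ and $A_N$ are those associated with the screen distribution under consideration. Induced curvature: $R(X,Y)Z=\nabla_X\nabla_YZ-\nabla_Y\nabla_XZ-\nabla_{[X,Y]}Z$,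 $R(X,Y,Z,U)=g(R(X,Y)Z,U)$. $R$ is an algebraic curvature tensor if at each point $R(x,y,z,w)=-R(y,x,z,w)=R(z,w,x,y)$ and $R(x,y,z,w)+R(y,z,x,w)+R(z,x,y,w)=0$. $S(TM)$ is admissible if its associated $R$ is an algebraic curvature tensor. With $\eta=\overline{g}(N,\cdot)$, $\tilde g=g+\eta\otimes\eta$ is a non-degenerate metric on $M$. Let $S_u^{\pm}(M)=\{x\in T_uM:g(x,x)=\pm1\}$. For algebraic $R$ and $x\in S_u^{\pm}(M)$ the pseudo-Jacobi operator $J_R(x)$ on $T_uM$ is given by $\tilde g(J_R(x)y,w)=R(y,x,x,w)$. $M$ is timelike (resp. spacelike) Osserman at $u$ if for each admissible screen distribution with associated $R$ the characteristic polynomial of $J_R(x)$ is independent of $x\in S_u^{-}(M)$ (resp. $S_u^{+}(M)$). The two conditions are treated as equivalent; Osserman at $u$ means that both hold, and pointwise Osserman means Osserman at every $u\in M$. $(M,g,S(TM))$ is locally symmetric if $(\nabla_WR)(X,Y)Z=0$ for all $W,X,Y,Z\in\Gamma(TM)$. It is semi-symmetric if for all $V_1,V_2,X,Y,Z,T\in\Gamma(TM)$, $(R(V_1,V_2)\cdot R)(X,Y,Z,T)=-R(R(V_1,V_2)X,Y,Z,T)-R(X,R(V_1,V_2)Y,Z,T)-R(X,Y,R(V_1,V_2)Z,T)-R(X,Y,Z,R(V_1,V_2)T)=0$. *)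

theory Defs
  imports "HOL-Analysis.Analysis" "HOL-Computational_Algebra.Polynomial"
begin

section \<open>Smooth manifolds\<close>

text \<open>The next two notions are meant for open domains of definition \<open>S\<close> only.\<close>

primrec Ck_on :: "nat \<Rightarrow> 'a::euclidean_space set \<Rightarrow> ('a \<Rightarrow> 'b::real_normed_vector) \<Rightarrow> bool" where
  "Ck_on 0 S f \<longleftrightarrow> continuous_on S f"
| "Ck_on (Suc k) S f \<longleftrightarrow>
     f differentiable_on S \<and> (\<forall>v. Ck_on k S (\<lambda>x. frechet_derivative f (at x) v))"

definition smooth_on :: "'a::euclidean_space set \<Rightarrow> ('a \<Rightarrow> 'b::real_normed_vector) \<Rightarrow> bool" where
  "smooth_on S f \<longleftrightarrow> (\<forall>k. Ck_on k S f)"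

text \<open>A chart is a pair of its domain and its coordinate map; the coordinate map is meaningful
  only on the domain.  A manifold is a type \<open>'p\<close> (later required to be Hausdorff and second
  countable) with a smooth atlas.\<close>

type_synonym ('p, 'a) chart = "'p set \<times> ('p \<Rightarrow> 'a)"

definition smooth_atlas :: "('p::topological_space, 'a::euclidean_space) chart set \<Rightarrow> bool" where
  "smooth_atlas A \<longleftrightarrow>
     (\<Union>(U, \<phi>)\<in>A. U) = UNIV \<and>
     (\<forall>(U, \<phi>)\<in>A. open U \<and> open (\<phi> ` U) \<and> homeomorphism U (\<phi> ` U) \<phi> (inv_into U \<phi>)) \<and>
     (\<forall>(U, \<phi>)\<in>A. \<forall>(V, \<psi>)\<in>A. smooth_on (\<phi> ` (U \<inter> V)) (\<psi> \<circ> inv_into U \<phi>))"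

definition smooth_fun ::
  "('p::topological_space, 'a::euclidean_space) chart set \<Rightarrow> 'p set \<Rightarrow> ('p \<Rightarrow> real) \<Rightarrow> bool" where
  "smooth_fun A W f \<longleftrightarrow> (\<forall>(U, \<phi>)\<in>A. smooth_on (\<phi> ` (U \<inter> W)) (f \<circ> inv_into U \<phi>))"

definition smooth_map :: "('p::topological_space, 'a::euclidean_space) chart set \<Rightarrow>
    ('q::topological_space, 'b::euclidean_space) chart set \<Rightarrow> ('p \<Rightarrow> 'q) \<Rightarrow> bool" where
  "smooth_map A B F \<longleftrightarrow> continuous_on UNIV F \<and>
     (\<forall>(U, \<phi>)\<in>A. \<forall>(V, \<psi>)\<in>B. smooth_on (\<phi> ` (U \<inter> F -` V)) (\<psi> \<circ> F \<circ> inv_into U \<phi>))"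

text \<open>The tangent space at \<open>p\<close> is represented by the model space \<open>'a\<close>: a tangent vector is
  identified with its coordinate vector in one chart around \<open>p\<close>, selected once and for all.
  The selected chart may jump from point to point, so smoothness of vector fields is never
  expressed by smoothness of these coordinate vectors, but by the action on functions.\<close>

definition chart_at :: "('p, 'a) chart set \<Rightarrow> 'p \<Rightarrow> ('p, 'a) chart" where
  "chart_at A p = (SOME c. c \<in> A \<and> p \<in> fst c)"

definition coord :: "('p, 'a) chart set \<Rightarrow> 'p \<Rightarrow> 'p \<Rightarrow> 'a" where
  "coord A p = snd (chart_at A p)"

definition param :: "('p, 'a) chart set \<Rightarrow> 'p \<Rightarrow> 'a \<Rightarrow> 'p" where
  "param A p = inv_into (fst (chart_at A p)) (coord A p)"

definition vapply ::
  "('p, 'a::euclidean_space) chart set \<Rightarrow> 'p \<Rightarrow> 'a \<Rightarrow> ('p \<Rightarrow> real) \<Rightarrow> real" where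
  "vapply A p v f = frechet_derivative (f \<circ> param A p) (at (coord A p p)) v"

definition tangent_map :: "('p, 'a::euclidean_space) chart set \<Rightarrow>
    ('q, 'b::euclidean_space) chart set \<Rightarrow> ('p \<Rightarrow> 'q) \<Rightarrow> 'p \<Rightarrow> 'a \<Rightarrow> 'b" where
  "tangent_map A B F p v =
     frechet_derivative (coord B (F p) \<circ> F \<circ> param A p) (at (coord A p p)) v"

definition immersion :: "('p::topological_space, 'a::euclidean_space) chart set \<Rightarrow>
    ('q::topological_space, 'b::euclidean_space) chart set \<Rightarrow> ('p \<Rightarrow> 'q) \<Rightarrow> bool" where
  "immersion A B F \<longleftrightarrow> smooth_map A B F \<and> (\<forall>p. inj (tangent_map A B F p))"

text \<open>Sections over the open set \<open>U\<close> of the pullback of the tangent bundle along \<open>F\<close>; vector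
  fields are the case of the identity map.  Everything below is formulated with local fields:
  a field on \<open>U\<close> is a total function whose values outside \<open>U\<close> are irrelevant.\<close>

definition field_along :: "('p::topological_space, 'a::euclidean_space) chart set \<Rightarrow>
    ('q::topological_space, 'b::euclidean_space) chart set \<Rightarrow> ('p \<Rightarrow> 'q) \<Rightarrow>
    'p set \<Rightarrow> ('p \<Rightarrow> 'b) \<Rightarrow> bool" where
  "field_along A B F U W \<longleftrightarrow>
     (\<forall>V f. open V \<longrightarrow> smooth_fun B V f \<longrightarrow>
        smooth_fun A (U \<inter> F -` V) (\<lambda>p. vapply B (F p) (W p) f))"

definition vector_field ::
  "('p::topological_space, 'a::euclidean_space) chart set \<Rightarrow> 'p set \<Rightarrow> ('p \<Rightarrow> 'a) \<Rightarrow> bool" where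
  "vector_field A = field_along A A (\<lambda>p. p)"

definition lie_bracket :: "('p::topological_space, 'a::euclidean_space) chart set \<Rightarrow>
    ('p \<Rightarrow> 'a) \<Rightarrow> ('p \<Rightarrow> 'a) \<Rightarrow> 'p \<Rightarrow> 'a" where
  "lie_bracket A X Y p = (THE v. \<forall>V f. open V \<and> p \<in> V \<and> smooth_fun A V f \<longrightarrow>
     vapply A p v f =
       vapply A p (X p) (\<lambda>q. vapply A q (Y q) f) - vapply A p (Y p) (\<lambda>q. vapply A q (X q) f))"

definition smooth_distribution :: "('p::topological_space, 'a::euclidean_space) chart set \<Rightarrow>
    nat \<Rightarrow> ('p \<Rightarrow> 'a set) \<Rightarrow> bool" where
  "smooth_distribution A r S \<longleftrightarrow>
     (\<forall>p. subspace (S p) \<and> dim (S p) = r) \<and>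
     (\<forall>p. \<exists>U E. open U \<and> p \<in> U \<and> (\<forall>i<r. vector_field A U (E i)) \<and>
        (\<forall>q\<in>U. S q = span ((\<lambda>i::nat. E i q) ` {..<r})))"


section \<open>Semi-Riemannian metrics, connections and curvature\<close>

definition form_index :: "('a::euclidean_space \<Rightarrow> 'a \<Rightarrow> real) \<Rightarrow> nat" where
  "form_index b = Max {dim S | S. subspace S \<and> (\<forall>v\<in>S. v \<noteq> 0 \<longrightarrow> b v v < 0)}"

definition semi_riemannian_metric :: "('p::topological_space, 'a::euclidean_space) chart set \<Rightarrow>
    nat \<Rightarrow> ('p \<Rightarrow> 'a \<Rightarrow> 'a \<Rightarrow> real) \<Rightarrow> bool" where
  "semi_riemannian_metric A \<nu> g \<longleftrightarrow>
     (\<forall>p. bilinear (g p) \<and> (\<forall>v w. g p v w = g p w v) \<and>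
          (\<forall>v. (\<forall>w. g p v w = 0) \<longrightarrow> v = 0) \<and> form_index (g p) = \<nu>) \<and>
     (\<forall>U X Y. open U \<longrightarrow> vector_field A U X \<longrightarrow> vector_field A U Y \<longrightarrow>
        smooth_fun A U (\<lambda>p. g p (X p) (Y p)))"

text \<open>Covariant derivative of sections of the pullback bundle along \<open>F\<close>, as an operator on
  local sections.  The second clause says that \<open>D X W\<close> at \<open>p\<close> depends only on \<open>X\<close> and \<open>W\<close>
  near \<open>p\<close>.\<close>

definition covariant_derivative_along ::
  "('p::topological_space, 'a::euclidean_space) chart set \<Rightarrow>
    ('q::topological_space, 'b::euclidean_space) chart set \<Rightarrow> ('p \<Rightarrow> 'q) \<Rightarrow>
    (('p \<Rightarrow> 'a) \<Rightarrow> ('p \<Rightarrow> 'b) \<Rightarrow> 'p \<Rightarrow> 'b) \<Rightarrow> bool" where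
  "covariant_derivative_along A B F D \<longleftrightarrow>
    (\<forall>U X Y V W f. open U \<and> vector_field A U X \<and> vector_field A U Y \<and>
        field_along A B F U V \<and> field_along A B F U W \<and> smooth_fun A U f \<longrightarrow>
      field_along A B F U (D X W) \<and>
      ((\<forall>p\<in>U. X p = Y p \<and> V p = W p) \<longrightarrow> (\<forall>p\<in>U. D X V p = D Y W p)) \<and>
      (\<forall>p\<in>U.
        D (\<lambda>q. X q + Y q) W p = D X W p + D Y W p \<and>
        D (\<lambda>q. f q *\<^sub>R X q) W p = f p *\<^sub>R D X W p \<and>
        D X (\<lambda>q. V q + W q) p = D X V p + D X W p \<and>
        D X (\<lambda>q. f q *\<^sub>R W q) p = vapply A p (X p) f *\<^sub>R W p + f p *\<^sub>R D X W p))"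

definition levi_civita :: "('p::topological_space, 'a::euclidean_space) chart set \<Rightarrow>
    ('p \<Rightarrow> 'a \<Rightarrow> 'a \<Rightarrow> real) \<Rightarrow> (('p \<Rightarrow> 'a) \<Rightarrow> ('p \<Rightarrow> 'a) \<Rightarrow> 'p \<Rightarrow> 'a) \<Rightarrow> bool" where
  "levi_civita A g D \<longleftrightarrow>
    covariant_derivative_along A A (\<lambda>p. p) D \<and>
    (\<forall>U X Y Z. open U \<and> vector_field A U X \<and> vector_field A U Y \<and> vector_field A U Z \<longrightarrow>
      (\<forall>p\<in>U.
        D X Y p - D Y X p = lie_bracket A X Y p \<and>
        vapply A p (X p) (\<lambda>q. g q (Y q) (Z q)) = g p (D X Y p) (Z p) + g p (Y p) (D X Z p)))"

text \<open>\<open>D\<close> is the covariant derivative along \<open>F\<close> induced by the connection \<open>Db\<close> of the target.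
  It is what \<open>\<nabla>\<close> of the ambient manifold means in the Gauss and Weingarten formulas, where it is
  applied to sections defined along the hypersurface only.\<close>

definition induced_covariant_derivative ::
  "('p::topological_space, 'a::euclidean_space) chart set \<Rightarrow>
    ('q::topological_space, 'b::euclidean_space) chart set \<Rightarrow> ('p \<Rightarrow> 'q) \<Rightarrow>
    (('q \<Rightarrow> 'b) \<Rightarrow> ('q \<Rightarrow> 'b) \<Rightarrow> 'q \<Rightarrow> 'b) \<Rightarrow>
    (('p \<Rightarrow> 'a) \<Rightarrow> ('p \<Rightarrow> 'b) \<Rightarrow> 'p \<Rightarrow> 'b) \<Rightarrow> bool" where
  "induced_covariant_derivative A B F Db D \<longleftrightarrow>
    covariant_derivative_along A B F D \<and>
    (\<forall>U V X X' Y p. open U \<and> open V \<and> vector_field A U X \<and> vector_field B V X' \<and>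
        vector_field B V Y \<and> p \<in> U \<and> F p \<in> V \<and> X' (F p) = tangent_map A B F p (X p) \<longrightarrow>
      D X (\<lambda>q. Y (F q)) p = Db X' Y (F p))"

definition curvature :: "('p::topological_space, 'a::euclidean_space) chart set \<Rightarrow>
    (('p \<Rightarrow> 'a) \<Rightarrow> ('p \<Rightarrow> 'a) \<Rightarrow> 'p \<Rightarrow> 'a) \<Rightarrow>
    ('p \<Rightarrow> 'a) \<Rightarrow> ('p \<Rightarrow> 'a) \<Rightarrow> ('p \<Rightarrow> 'a) \<Rightarrow> 'p \<Rightarrow> 'a" where
  "curvature A D X Y Z p = D X (D Y Z) p - D Y (D X Z) p - D (lie_bracket A X Y) Z p"

definition has_constant_curvature :: "('p::topological_space, 'a::euclidean_space) chart set \<Rightarrow>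
    ('p \<Rightarrow> 'a \<Rightarrow> 'a \<Rightarrow> real) \<Rightarrow> (('p \<Rightarrow> 'a) \<Rightarrow> ('p \<Rightarrow> 'a) \<Rightarrow> 'p \<Rightarrow> 'a) \<Rightarrow> real \<Rightarrow> bool" where
  "has_constant_curvature A g D c \<longleftrightarrow>
    (\<forall>U X Y Z. open U \<and> vector_field A U X \<and> vector_field A U Y \<and> vector_field A U Z \<longrightarrow>
      (\<forall>p\<in>U. curvature A D X Y Z p =
         c *\<^sub>R (g p (Y p) (Z p) *\<^sub>R X p - g p (X p) (Z p) *\<^sub>R Y p)))"


section \<open>Lightlike hypersurfaces\<close>

text \<open>Data of a hypersurface \<open>M\<close> (points \<open>'p\<close>) immersed in a semi-Riemannian manifold
  (points \<open>'q\<close>): the two atlases, the immersion, the ambient metric, its Levi-Civita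
  connection, and the covariant derivative induced by the latter along the immersion.  The two
  connections are uniquely determined by the other data; see \<open>semi_riemannian_hypersurface\<close>.\<close>

record ('p, 'n::finite, 'q, 'k::finite) hypersurface =
  atl :: "('p, real^'n) chart set"
  ambient_atl :: "('q, real^'k) chart set"
  imm :: "'p \<Rightarrow> 'q"
  ambient_metric :: "'q \<Rightarrow> real^'k \<Rightarrow> real^'k \<Rightarrow> real"
  ambient_conn :: "('q \<Rightarrow> real^'k) \<Rightarrow> ('q \<Rightarrow> real^'k) \<Rightarrow> 'q \<Rightarrow> real^'k"
  conn_along :: "('p \<Rightarrow> real^'n) \<Rightarrow> ('p \<Rightarrow> real^'k) \<Rightarrow> 'p \<Rightarrow> real^'k"

definition semi_riemannian_hypersurface ::
  "('p::{t2_space,second_countable_topology}, 'n::finite,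
    'q::{t2_space,second_countable_topology}, 'k::finite) hypersurface \<Rightarrow> nat \<Rightarrow> bool" where
  "semi_riemannian_hypersurface H \<nu> \<longleftrightarrow>
     smooth_atlas (atl H) \<and> smooth_atlas (ambient_atl H) \<and>
     CARD('k) = CARD('n) + 1 \<and> immersion (atl H) (ambient_atl H) (imm H) \<and>
     semi_riemannian_metric (ambient_atl H) \<nu> (ambient_metric H) \<and>
     levi_civita (ambient_atl H) (ambient_metric H) (ambient_conn H) \<and>
     induced_covariant_derivative (atl H) (ambient_atl H) (imm H) (ambient_conn H) (conn_along H)"

abbreviation imm_deriv :: "('p, 'n::finite, 'q, 'k::finite) hypersurface \<Rightarrow> 'p \<Rightarrow> real^'n \<Rightarrow> real^'k" where
  "imm_deriv H \<equiv> tangent_map (atl H) (ambient_atl H) (imm H)"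

definition metric_along :: "('p, 'n::finite, 'q, 'k::finite) hypersurface \<Rightarrow> 'p \<Rightarrow> real^'k \<Rightarrow> real^'k \<Rightarrow> real" where
  "metric_along H p v w = ambient_metric H (imm H p) v w"

definition induced_metric ::
  "('p, 'n::finite, 'q, 'k::finite) hypersurface \<Rightarrow> 'p \<Rightarrow> real^'n \<Rightarrow> real^'n \<Rightarrow> real" where
  "induced_metric H p v w = metric_along H p (imm_deriv H p v) (imm_deriv H p w)"

definition normal_space ::
  "('p, 'n::finite, 'q, 'k::finite) hypersurface \<Rightarrow> 'p \<Rightarrow> (real^'k) set" where
  "normal_space H p = {w. \<forall>v. metric_along H p w (imm_deriv H p v) = 0}"

definition radical :: "('p, 'n::finite, 'q, 'k::finite) hypersurface \<Rightarrow> 'p \<Rightarrow> (real^'n) set" where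
  "radical H p = {v. imm_deriv H p v \<in> normal_space H p}"

definition lightlike ::
  "('p::topological_space, 'n::finite, 'q, 'k::finite) hypersurface \<Rightarrow> bool" where
  "lightlike H \<longleftrightarrow> (\<forall>p. imm_deriv H p ` radical H p = normal_space H p) \<and>
     smooth_distribution (atl H) 1 (radical H)"

definition screen_distribution ::
  "('p::topological_space, 'n::finite, 'q, 'k::finite) hypersurface \<Rightarrow> ('p \<Rightarrow> (real^'n) set) \<Rightarrow> bool"
  where
  "screen_distribution H S \<longleftrightarrow> smooth_distribution (atl H) (CARD('n) - 1) S \<and>
     (\<forall>p. S p \<inter> radical H p = {0} \<and> {s + x | s x. s \<in> S p \<and> x \<in> radical H p} = UNIV \<and>
        (\<forall>v\<in>S p. (\<forall>w\<in>S p. induced_metric H p v w = 0) \<longrightarrow> v = 0))"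

definition normalizing_at :: "('p, 'n::finite, 'q, 'k::finite) hypersurface \<Rightarrow>
    ('p \<Rightarrow> (real^'n) set) \<Rightarrow> 'p \<Rightarrow> real^'n \<Rightarrow> real^'k \<Rightarrow> bool" where
  "normalizing_at H S p \<xi> N \<longleftrightarrow> \<xi> \<in> radical H p \<and> (\<forall>s\<in>S p. metric_along H p N (imm_deriv H p s) = 0) \<and>
     metric_along H p (imm_deriv H p \<xi>) N = 1 \<and> metric_along H p N N = 0"

definition normalizing_pair :: "('p::topological_space, 'n::finite, 'q::topological_space,
    'k::finite) hypersurface \<Rightarrow> ('p \<Rightarrow> (real^'n) set) \<Rightarrow> 'p set \<Rightarrow>
    ('p \<Rightarrow> real^'n) \<Rightarrow> ('p \<Rightarrow> real^'k) \<Rightarrow> bool" where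
  "normalizing_pair H S U \<xi> N \<longleftrightarrow> vector_field (atl H) U \<xi> \<and>
     field_along (atl H) (ambient_atl H) (imm H) U N \<and>
     (\<forall>p\<in>U. normalizing_at H S p (\<xi> p) (N p))"

definition transversal :: "('p, 'n::finite, 'q, 'k::finite) hypersurface \<Rightarrow>
    ('p \<Rightarrow> (real^'n) set) \<Rightarrow> 'p \<Rightarrow> (real^'k) set" where
  "transversal H S p = span {N. \<exists>\<xi>. normalizing_at H S p \<xi> N}"

text \<open>Gauss and Weingarten formulas: the tangential parts with respect to the decomposition into
  \<open>TM\<close> and the transversal line.  The transversal parts \<open>B(X,Y)N\<close> and \<open>\<tau>(X)N\<close> are not named.\<close>

definition induced_conn :: "('p, 'n::finite, 'q, 'k::finite) hypersurface \<Rightarrow>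
    ('p \<Rightarrow> (real^'n) set) \<Rightarrow> ('p \<Rightarrow> real^'n) \<Rightarrow> ('p \<Rightarrow> real^'n) \<Rightarrow> 'p \<Rightarrow> real^'n" where
  "induced_conn H S X Y p =
     (THE v. conn_along H X (\<lambda>q. imm_deriv H q (Y q)) p - imm_deriv H p v \<in> transversal H S p)"

definition shape_operator :: "('p, 'n::finite, 'q, 'k::finite) hypersurface \<Rightarrow>
    ('p \<Rightarrow> (real^'n) set) \<Rightarrow> ('p \<Rightarrow> real^'k) \<Rightarrow> ('p \<Rightarrow> real^'n) \<Rightarrow> 'p \<Rightarrow> real^'n" where
  "shape_operator H S N X p = (THE v. conn_along H X N p - (- imm_deriv H p v) \<in> transversal H S p)"

text \<open>\<open>A\<^sub>N \<xi>\<close> does not depend on the pair: for a nowhere zero function \<open>f\<close>, replacing \<open>(\<xi>, N)\<close> by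
  \<open>(f\<xi>, N/f)\<close> gives the same vector.  Hence it suffices to mention one pair around each point.\<close>

definition nonnull_A_N_xi :: "('p::topological_space, 'n::finite, 'q::topological_space,
    'k::finite) hypersurface \<Rightarrow> ('p \<Rightarrow> (real^'n) set) \<Rightarrow> bool" where
  "nonnull_A_N_xi H S \<longleftrightarrow> (\<forall>p. \<exists>U \<xi> N. open U \<and> p \<in> U \<and> normalizing_pair H S U \<xi> N \<and>
     induced_metric H p (shape_operator H S N \<xi> p) (shape_operator H S N \<xi> p) \<noteq> 0)"


section \<open>Curvature conditions on a lightlike hypersurface\<close>

definition Rm :: "('p::topological_space, 'n::finite, 'q, 'k::finite) hypersurface \<Rightarrow>
    ('p \<Rightarrow> (real^'n) set) \<Rightarrow> ('p \<Rightarrow> real^'n) \<Rightarrow> ('p \<Rightarrow> real^'n) \<Rightarrow> ('p \<Rightarrow> real^'n) \<Rightarrow> 'p \<Rightarrow> real^'n"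
  where "Rm H S = curvature (atl H) (induced_conn H S)"

definition Rm4 :: "('p::topological_space, 'n::finite, 'q, 'k::finite) hypersurface \<Rightarrow>
    ('p \<Rightarrow> (real^'n) set) \<Rightarrow> ('p \<Rightarrow> real^'n) \<Rightarrow> ('p \<Rightarrow> real^'n) \<Rightarrow> ('p \<Rightarrow> real^'n) \<Rightarrow>
    ('p \<Rightarrow> real^'n) \<Rightarrow> 'p \<Rightarrow> real"
  where "Rm4 H S X Y Z W p = induced_metric H p (Rm H S X Y Z p) (W p)"

text \<open>The values of \<open>Rm4\<close> at a point depend only on the values of the fields there, so identities
  between tangent vectors at a point are stated for all local fields around it.\<close>

definition admissible_screen :: "('p::topological_space, 'n::finite, 'q, 'k::finite) hypersurface \<Rightarrow>
    ('p \<Rightarrow> (real^'n) set) \<Rightarrow> bool" where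
  "admissible_screen H S \<longleftrightarrow> screen_distribution H S \<and>
     (\<forall>U X Y Z W. open U \<and> vector_field (atl H) U X \<and> vector_field (atl H) U Y \<and>
         vector_field (atl H) U Z \<and> vector_field (atl H) U W \<longrightarrow>
       (\<forall>p\<in>U. Rm4 H S X Y Z W p = - Rm4 H S Y X Z W p \<and>
          Rm4 H S X Y Z W p = Rm4 H S Z W X Y p \<and>
          Rm4 H S X Y Z W p + Rm4 H S Y Z X W p + Rm4 H S Z X Y W p = 0))"

definition g_tilde :: "('p, 'n::finite, 'q, 'k::finite) hypersurface \<Rightarrow> 'p \<Rightarrow> real^'k \<Rightarrow>
    real^'n \<Rightarrow> real^'n \<Rightarrow> real" where
  "g_tilde H p N v w = induced_metric H p v w + metric_along H p N (imm_deriv H p v) * metric_along H p N (imm_deriv H p w)"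

definition pseudo_jacobi :: "('p::topological_space, 'n::finite, 'q, 'k::finite) hypersurface \<Rightarrow>
    ('p \<Rightarrow> (real^'n) set) \<Rightarrow> 'p \<Rightarrow> real^'k \<Rightarrow> real^'n \<Rightarrow> real^'n \<Rightarrow> real^'n" where
  "pseudo_jacobi H S u N x = (THE J. linear J \<and>
     (\<forall>U X Y W. open U \<and> u \<in> U \<and> vector_field (atl H) U X \<and> vector_field (atl H) U Y \<and>
         vector_field (atl H) U W \<and> X u = x \<longrightarrow>
       g_tilde H u N (J (Y u)) (W u) = Rm4 H S Y X X W u))"

definition charpoly :: "(real^'n::finite \<Rightarrow> real^'n) \<Rightarrow> real poly" where
  "charpoly J = det (mat [:0, 1:] - map_matrix (\<lambda>a. [:a:]) (matrix J))"

text \<open>\<open>osserman_sign e\<close> with \<open>e = -1\<close> (resp. \<open>e = 1\<close>) is the timelike (resp. spacelike) condition.\<close>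

definition osserman_sign :: "real \<Rightarrow>
    ('p::topological_space, 'n::finite, 'q, 'k::finite) hypersurface \<Rightarrow> 'p \<Rightarrow> bool" where
  "osserman_sign e H u \<longleftrightarrow>
     (\<forall>S \<xi> N. admissible_screen H S \<and> normalizing_at H S u \<xi> N \<longrightarrow>
       (\<forall>x y. induced_metric H u x x = e \<and> induced_metric H u y y = e \<longrightarrow>
          charpoly (pseudo_jacobi H S u N x) = charpoly (pseudo_jacobi H S u N y)))"

definition pointwise_osserman ::
  "('p::topological_space, 'n::finite, 'q, 'k::finite) hypersurface \<Rightarrow> bool" where
  "pointwise_osserman H \<longleftrightarrow> (\<forall>u. osserman_sign (-1) H u \<and> osserman_sign 1 H u)"

abbreviation global_field :: "('p::topological_space, 'n::finite, 'q, 'k::finite) hypersurface \<Rightarrow>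
    ('p \<Rightarrow> real^'n) \<Rightarrow> bool" where
  "global_field H \<equiv> vector_field (atl H) UNIV"

definition locally_symmetric :: "('p::topological_space, 'n::finite, 'q, 'k::finite) hypersurface \<Rightarrow>
    ('p \<Rightarrow> (real^'n) set) \<Rightarrow> bool" where
  "locally_symmetric H S \<longleftrightarrow>
     (\<forall>W X Y Z. global_field H W \<and> global_field H X \<and> global_field H Y \<and> global_field H Z \<longrightarrow>
       (\<forall>p. induced_conn H S W (Rm H S X Y Z) p
            - Rm H S (induced_conn H S W X) Y Z p
            - Rm H S X (induced_conn H S W Y) Z p
            - Rm H S X Y (induced_conn H S W Z) p = 0))"

definition semi_symmetric :: "('p::topological_space, 'n::finite, 'q, 'k::finite) hypersurface \<Rightarrow>
    ('p \<Rightarrow> (real^'n) set) \<Rightarrow> bool" where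
  "semi_symmetric H S \<longleftrightarrow>
     (\<forall>V\<^sub>1 V\<^sub>2 X Y Z T. global_field H V\<^sub>1 \<and> global_field H V\<^sub>2 \<and>
         global_field H X \<and> global_field H Y \<and> global_field H Z \<and> global_field H T \<longrightarrow>
       (\<forall>p. - Rm4 H S (Rm H S V\<^sub>1 V\<^sub>2 X) Y Z T p
            - Rm4 H S X (Rm H S V\<^sub>1 V\<^sub>2 Y) Z T p
            - Rm4 H S X Y (Rm H S V\<^sub>1 V\<^sub>2 Z) T p
            - Rm4 H S X Y Z (Rm H S V\<^sub>1 V\<^sub>2 T) p = 0))"

end

theory Submission
  imports Defs
begin

text \<open>The equivalence holds because, under these hypotheses, both conditions are satisfied.

  Let \<open>B\<close> be the second fundamental form of the hypersurface with respect to a normalizing pair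
  \<open>(\<xi>, N)\<close>.  In an ambient space of constant curvature \<open>c\<close> the Gauss equation reads
  \<open>R(X,Y)Z = c (g(Y,Z) X - g(X,Z) Y) + B(Y,Z) A\<^sub>N X - B(X,Z) A\<^sub>N Y\<close>.  Since \<open>g(\<xi>,\<cdot>) = 0\<close> and
  \<open>B(\<xi>,\<cdot>) = 0\<close>, this gives \<open>R(\<xi>,Y,Z,W) = B(Y,Z) g(A\<^sub>N \<xi>, W)\<close> but \<open>R(Z,W,\<xi>,Y) = 0\<close>.  Pair symmetry of
  the curvature, which is part of admissibility, forces the former to vanish as well; with
  \<open>W = A\<^sub>N \<xi>\<close> non-null this means \<open>B = 0\<close> (\<open>second_form_vanishes\<close>).

  A hypersurface with \<open>B = 0\<close> has an induced connection that is metric, and its curvature is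
  \<open>R(X,Y)Z = c (g(Y,Z) X - g(X,Z) Y)\<close> (\<open>Rm_totally_geodesic\<close>).  As \<open>R\<close> is built from the parallel tensor
  \<open>g\<close> alone, \<open>\<nabla>R = 0\<close>; and \<open>R(V\<^sub>1,V\<^sub>2)\<close> is skew with respect to \<open>g\<close>, so it annihilates \<open>R\<close> as a
  derivation.

  Most of the text below establishes the differential geometry that the Gauss equation rests on,
  starting from derivatives in charts: existence of the Lie bracket, and the fact that the covariant
  derivative along the immersion inherits from the Levi-Civita connection of the ambient space the
  absence of torsion (\<open>D_torsion_free\<close>), compatibility with the metric (\<open>D_metric\<close>) and the curvature
  (\<open>curvature_along_constant_curvature\<close>).  A field along the immersion is in general not the restriction of an
  explicitly given ambient field, so these three facts are proved in two steps: by the Leibniz rule they reduce to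
  restrictions of the coordinate fields of an ambient chart, and for those the derivative along the
  map is an ambient derivative.\<close>

section \<open>Smooth functions on open sets of Euclidean spaces\<close>

lemma frechet_derivative_eqI:
  "(f has_derivative f') (at x) \<Longrightarrow> frechet_derivative f (at x) = f'"
  using frechet_derivative_at by blast

lemma has_frechet_derivative:
  "f differentiable (at x) \<Longrightarrow> (f has_derivative frechet_derivative f (at x)) (at x)"
  by (simp add: frechet_derivative_works)

lemma frechet_derivative_cong_open:
  assumes "open S" "x \<in> S" "\<And>y. y \<in> S \<Longrightarrow> f y = g y"
  shows "frechet_derivative f (at x) = frechet_derivative g (at x)"
proof -
  have "(f has_derivative f') (at x) \<longleftrightarrow> (g has_derivative f') (at x)" for f'
    using assms has_derivative_transform_within_open by metis
  then show ?thesis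
    by (simp add: frechet_derivative_def)
qed

lemma linear_eq_sum_Basis:
  fixes h :: "'a::euclidean_space \<Rightarrow> 'b::real_vector"
  assumes "linear h"
  shows "h v = (\<Sum>i\<in>Basis. (v \<bullet> i) *\<^sub>R h i)"
proof -
  have "h v = h (\<Sum>i\<in>Basis. (v \<bullet> i) *\<^sub>R i)"
    by (simp add: euclidean_representation)
  also have "\<dots> = (\<Sum>i\<in>Basis. (v \<bullet> i) *\<^sub>R h i)"
    by (simp add: linear_sum[OF assms] linear_cmul[OF assms])
  finally show ?thesis .
qed

lemma Ck_on_SucD: "Ck_on (Suc k) S f \<Longrightarrow> Ck_on k S f"
proof (induction k arbitrary: f)
  case 0
  then show ?case by (simp add: differentiable_imp_continuous_on)
next
  case (Suc k)
  then show ?case by (metis Ck_on.simps(2))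
qed

lemma Ck_on_subset: "Ck_on k S f \<Longrightarrow> T \<subseteq> S \<Longrightarrow> Ck_on k T f"
proof (induction k arbitrary: f)
  case 0
  then show ?case using continuous_on_subset by auto
next
  case (Suc k)
  then show ?case using differentiable_on_subset by auto
qed

lemma Ck_on_cong:
  assumes "open S" "\<And>x. x \<in> S \<Longrightarrow> f x = g x" "Ck_on k S f"
  shows "Ck_on k S g"
  using assms(2,3)
proof (induction k arbitrary: f g)
  case 0
  then show ?case using continuous_on_cong by fastforce
next
  case (Suc k)
  have "g differentiable_on S"
  proof -
    have "g differentiable (at x)" if x: "x \<in> S" for x
    proof -
      have "f differentiable (at x)"
        using Suc.prems(2) x by (simp add: differentiable_on_eq_differentiable_at[OF assms(1)])
      then show ?thesis
        using has_derivative_transform_within_open[where g = g, OF _ assms(1) x] Suc.prems(1) unfolding differentiable_def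
        by blast
    qed
    then show ?thesis by (simp add: differentiable_on_eq_differentiable_at[OF assms(1)])
  qed
  moreover have "Ck_on k S (\<lambda>x. frechet_derivative g (at x) v)" for v
    by (rule Suc.IH[of "\<lambda>x. frechet_derivative f (at x) v"])
      (use Suc.prems frechet_derivative_cong_open[OF assms(1)] in \<open>auto, metis\<close>)
  ultimately show ?case by simp
qed

lemma Ck_on_local:
  assumes "open S" "\<And>x. x \<in> S \<Longrightarrow> \<exists>T. open T \<and> x \<in> T \<and> Ck_on k T f"
  shows "Ck_on k S f"
  using assms(2)
proof (induction k arbitrary: f)
  case 0
  then show ?case
    by (auto simp: continuous_on_eq_continuous_at assms(1)) (metis continuous_on_eq_continuous_at)
next
  case (Suc k)
  have "f differentiable_on S"
    using Suc.prems assms(1)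
    by (auto simp: differentiable_on_eq_differentiable_at) (metis differentiable_on_eq_differentiable_at)
  moreover have "Ck_on k S (\<lambda>x. frechet_derivative f (at x) v)" for v
    using Suc.prems by (intro Suc.IH) auto
  ultimately show ?case by simp
qed

lemma Ck_on_const: "Ck_on k S (\<lambda>x. c)"
  by (induction k arbitrary: c) auto

lemma Ck_on_add:
  assumes "open S" "Ck_on k S f" "Ck_on k S g"
  shows "Ck_on k S (\<lambda>x. f x + g x)"
  using assms(2,3)
proof (induction k arbitrary: f g)
  case 0
  then show ?case by (simp add: continuous_on_add)
next
  case (Suc k)
  have "Ck_on k S (\<lambda>x. frechet_derivative (\<lambda>x. f x + g x) (at x) v)" for v
  proof (rule Ck_on_cong[OF assms(1)])
    show "Ck_on k S (\<lambda>x. frechet_derivative f (at x) v + frechet_derivative g (at x) v)"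
      using Suc by simp
    show "frechet_derivative f (at x) v + frechet_derivative g (at x) v
        = frechet_derivative (\<lambda>x. f x + g x) (at x) v" if "x \<in> S" for x
    proof -
      have "f differentiable (at x)" "g differentiable (at x)"
        using Suc.prems that assms(1) by (auto simp: differentiable_on_eq_differentiable_at)
      then show ?thesis
        by (subst frechet_derivative_eqI[OF has_derivative_add[OF has_frechet_derivative has_frechet_derivative]]) auto
    qed
  qed
  with Suc show ?case by simp
qed

lemma Ck_on_bilinear:
  assumes "bounded_bilinear b" "open S" "Ck_on k S f" "Ck_on k S g"
  shows "Ck_on k S (\<lambda>x. b (f x) (g x))"
  using assms(3,4)
proof (induction k arbitrary: f g)
  case 0
  then show ?case by (simp add: bounded_bilinear.continuous_on[OF assms(1)])
next
  case (Suc k)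
  have df: "f differentiable (at x)" "g differentiable (at x)" if "x \<in> S" for x
    using Suc.prems that assms(2) by (auto simp: differentiable_on_eq_differentiable_at)
  have d: "((\<lambda>x. b (f x) (g x)) has_derivative
      (\<lambda>h. b (f x) (frechet_derivative g (at x) h) + b (frechet_derivative f (at x) h) (g x))) (at x)"
    if "x \<in> S" for x
    using df[OF that] by (intro bounded_bilinear.FDERIV[OF assms(1)] has_frechet_derivative)
  have "Ck_on k S (\<lambda>x. frechet_derivative (\<lambda>x. b (f x) (g x)) (at x) v)" for v
  proof (rule Ck_on_cong[OF assms(2)])
    show "Ck_on k S (\<lambda>x. b (f x) (frechet_derivative g (at x) v) + b (frechet_derivative f (at x) v) (g x))"
      using Suc.prems by (intro Ck_on_add assms Suc.IH) (simp_all add: Ck_on_SucD del: Ck_on.simps, simp_all)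
    show "b (f x) (frechet_derivative g (at x) v) + b (frechet_derivative f (at x) v) (g x)
        = frechet_derivative (\<lambda>x. b (f x) (g x)) (at x) v" if "x \<in> S" for x
      by (subst frechet_derivative_eqI[OF d[OF that]]) auto
  qed
  moreover have "(\<lambda>x. b (f x) (g x)) differentiable_on S"
    using d by (auto simp: differentiable_on_eq_differentiable_at[OF assms(2)] differentiable_def)
  ultimately show ?case by simp
qed

lemma Ck_on_bounded_linear:
  assumes "bounded_linear h" "open S" "Ck_on k S f"
  shows "Ck_on k S (\<lambda>x. h (f x))"
proof -
  \<comment> \<open>A linear map is made bilinear by a second, scalar argument, which is then set to 1.\<close>
  have "bounded_bilinear (\<lambda>x (r::real). r *\<^sub>R h x)"
    using bounded_bilinear.comp[OF bounded_bilinear_scaleR bounded_linear_ident assms(1)]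
    by (simp add: bounded_bilinear.flip)
  from Ck_on_bilinear[OF this assms(2,3) Ck_on_const[where c = 1]] show ?thesis by simp
qed

lemma Ck_on_sum:
  "open S \<Longrightarrow> (\<And>i. i \<in> I \<Longrightarrow> Ck_on k S (f i)) \<Longrightarrow> Ck_on k S (\<lambda>x. \<Sum>i\<in>I. f i x)"
  by (induction I rule: infinite_finite_induct) (auto intro: Ck_on_const Ck_on_add)

lemma Ck_on_inverse:
  fixes f :: "'a::euclidean_space \<Rightarrow> real"
  assumes "open S" "Ck_on k S f" "\<And>x. x \<in> S \<Longrightarrow> f x \<noteq> 0"
  shows "Ck_on k S (\<lambda>x. inverse (f x))"
  using assms(2)
proof (induction k)
  case 0
  then show ?case using assms by (simp add: continuous_on_inverse)
next
  case (Suc k)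
  have df: "f differentiable (at x)" if "x \<in> S" for x
    using Suc.prems that assms(1) by (auto simp: differentiable_on_eq_differentiable_at)
  have d: "((\<lambda>x. inverse (f x)) has_derivative
      (\<lambda>h. - (inverse (f x) * frechet_derivative f (at x) h * inverse (f x)))) (at x)"
    if "x \<in> S" for x
    using df[OF that] assms(3)[OF that] by (intro Deriv.has_derivative_inverse has_frechet_derivative)
  have m: "Ck_on k S (\<lambda>x. g x * h x)" if "Ck_on k S g" "Ck_on k S h" for g h :: "'a \<Rightarrow> real"
    using that by (rule Ck_on_bilinear[OF bounded_bilinear_mult assms(1)])
  have i: "Ck_on k S (\<lambda>x. inverse (f x))"
    by (rule Suc.IH[OF Ck_on_SucD[OF Suc.prems]])
  have "Ck_on k S (\<lambda>x. frechet_derivative (\<lambda>x. inverse (f x)) (at x) v)" for v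
  proof (rule Ck_on_cong[OF assms(1)])
    show "Ck_on k S (\<lambda>x. (- 1) * (inverse (f x) * frechet_derivative f (at x) v * inverse (f x)))"
      using Suc.prems by (intro m[OF Ck_on_const m[OF m[OF i] i]]) simp
    show "(- 1) * (inverse (f x) * frechet_derivative f (at x) v * inverse (f x))
        = frechet_derivative (\<lambda>x. inverse (f x)) (at x) v" if "x \<in> S" for x
      by (subst frechet_derivative_eqI[OF d[OF that]]) auto
  qed
  moreover have "(\<lambda>x. inverse (f x)) differentiable_on S"
    using d by (auto simp: differentiable_on_eq_differentiable_at[OF assms(1)] differentiable_def)
  ultimately show ?case by simp
qed

text \<open>The derivative of \<open>g \<circ> f\<close> is expanded over the standard basis.  This writes it as a sum of products of
  a derivative of \<open>f\<close> with a derivative of \<open>g\<close> composed with \<open>f\<close>, to which the induction hypothesis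
  applies.\<close>

lemma Ck_on_compose:
  fixes f :: "'a::euclidean_space \<Rightarrow> 'b::euclidean_space" and g :: "'b \<Rightarrow> 'c::real_normed_vector"
  assumes "open S" "open T" "f ` S \<subseteq> T" "Ck_on k S f" "Ck_on k T g"
  shows "Ck_on k S (\<lambda>x. g (f x))"
  using assms(4,5)
proof (induction k arbitrary: g)
  case 0
  then show ?case using assms(3) by (auto intro: continuous_on_compose2)
next
  case (Suc k)
  have df: "f differentiable (at x)" if "x \<in> S" for x
    using Suc.prems that assms by (auto simp: differentiable_on_eq_differentiable_at)
  have dg: "g differentiable (at (f x))" if "x \<in> S" for x
    using Suc.prems that assms by (auto simp: differentiable_on_eq_differentiable_at)
  have d: "((\<lambda>x. g (f x)) has_derivative
      (\<lambda>h. frechet_derivative g (at (f x)) (frechet_derivative f (at x) h))) (at x)" if "x \<in> S" for x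
    using df[OF that] dg[OF that]
    by (intro has_derivative_compose[where f = f and g = g]) (auto simp: has_frechet_derivative)
  have "Ck_on k S (\<lambda>x. frechet_derivative (\<lambda>x. g (f x)) (at x) v)" for v
  proof (rule Ck_on_cong[OF assms(1)])
    show "Ck_on k S (\<lambda>x. \<Sum>i\<in>Basis. (frechet_derivative f (at x) v \<bullet> i) *\<^sub>R frechet_derivative g (at (f x)) i)"
    proof (intro Ck_on_sum Ck_on_bilinear[OF bounded_bilinear_scaleR] assms)
      fix i :: 'b assume "i \<in> Basis"
      show "Ck_on k S (\<lambda>x. frechet_derivative f (at x) v \<bullet> i)"
        using Suc.prems by (intro Ck_on_bounded_linear[OF bounded_linear_inner_left assms(1)]) auto
      show "Ck_on k S (\<lambda>x. frechet_derivative g (at (f x)) i)"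
        using Suc.IH[OF Ck_on_SucD[OF Suc.prems(1)], of "\<lambda>y. frechet_derivative g (at y) i"] Suc.prems(2) by simp
    qed
    show "(\<Sum>i\<in>Basis. (frechet_derivative f (at x) v \<bullet> i) *\<^sub>R frechet_derivative g (at (f x)) i)
        = frechet_derivative (\<lambda>x. g (f x)) (at x) v" if "x \<in> S" for x
    proof -
      have "linear (frechet_derivative g (at (f x)))"
        using dg[OF that] by (rule linear_frechet_derivative)
      then show ?thesis
        by (subst frechet_derivative_eqI[OF d[OF that]]) (simp flip: linear_eq_sum_Basis)
    qed
  qed
  moreover have "(\<lambda>x. g (f x)) differentiable_on S"
    using d by (auto simp: differentiable_on_eq_differentiable_at[OF assms(1)] differentiable_def)
  ultimately show ?case by simp
qed

text \<open>Symmetry of second derivatives: by the mean value theorem applied in both directions, the second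
  difference over a parallelogram with sides \<open>t u\<close> and \<open>t v\<close> is \<open>t\<^sup>2\<close> times either mixed derivative at
  some point of the parallelogram.\<close>

lemma second_difference_mvt:
  fixes f :: "'a::euclidean_space \<Rightarrow> real"
  assumes "open S" "Ck_on 2 S f" "0 < t"
    and "\<And>a b. 0 \<le> a \<Longrightarrow> a \<le> t \<Longrightarrow> 0 \<le> b \<Longrightarrow> b \<le> t \<Longrightarrow> x + a *\<^sub>R u + b *\<^sub>R v \<in> S"
  obtains a b where "0 \<le> a" "a \<le> t" "0 \<le> b" "b \<le> t"
    "f (x + t *\<^sub>R u + t *\<^sub>R v) - f (x + t *\<^sub>R u) - f (x + t *\<^sub>R v) + f x =
      t * t * frechet_derivative (\<lambda>y. frechet_derivative f (at y) u) (at (x + a *\<^sub>R u + b *\<^sub>R v)) v"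
proof -
  define Df where "Df = (\<lambda>y. frechet_derivative f (at y))"
  have f: "(f has_derivative Df y) (at y)" if "y \<in> S" for y
    using assms(1,2) that unfolding Df_def
    by (auto simp: numeral_2_eq_2 differentiable_on_eq_differentiable_at intro: has_frechet_derivative)
  have lin: "Df y (c *\<^sub>R w) = c * Df y w" if "y \<in> S" for c y w
    using f[OF that] by (simp add: linear_simps has_derivative_bounded_linear)
  have Du: "((\<lambda>y. Df y u) has_derivative frechet_derivative (\<lambda>y. Df y u) (at y)) (at y)" if "y \<in> S" for y
    using assms(1,2) that unfolding Df_def
    by (auto simp: numeral_2_eq_2 differentiable_on_eq_differentiable_at intro!: has_frechet_derivative)
  have lin2: "frechet_derivative (\<lambda>y. Df y u) (at y) (c *\<^sub>R w) = c * frechet_derivative (\<lambda>y. Df y u) (at y) w"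
    if "y \<in> S" for c y w
    using Du[OF that] by (simp add: linear_simps has_derivative_bounded_linear)
  have in0: "x + a *\<^sub>R u \<in> S" if "0 \<le> a" "a \<le> t" for a
    using assms(4)[of a 0] that assms(3) by simp
  define \<phi> where "\<phi> = (\<lambda>a. f (x + a *\<^sub>R u + t *\<^sub>R v) - f (x + a *\<^sub>R u))"
  have "(\<phi> has_derivative (\<lambda>h. h * (Df (x + a *\<^sub>R u + t *\<^sub>R v) u - Df (x + a *\<^sub>R u) u))) (at a)"
    if "0 \<le> a" "a \<le> t" for a
  proof -
    have "(\<phi> has_derivative (\<lambda>h. Df (x + a *\<^sub>R u + t *\<^sub>R v) (h *\<^sub>R u) - Df (x + a *\<^sub>R u) (h *\<^sub>R u))) (at a)"
      unfolding \<phi>_def using that assms(3,4) in0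
      by (intro has_derivative_diff has_derivative_compose[where g = f, OF _ f])
        (auto intro!: derivative_eq_intros)
    then show ?thesis
      using that assms(3) assms(4)[of a t] in0[of a] by (simp add: lin algebra_simps)
  qed
  then obtain a where a: "0 < a" "a < t"
      "\<phi> t - \<phi> 0 = t * (Df (x + a *\<^sub>R u + t *\<^sub>R v) u - Df (x + a *\<^sub>R u) u)"
    using mvt_simple[OF assms(3), where f = \<phi> and f' = "\<lambda>a h. h * (Df (x + a *\<^sub>R u + t *\<^sub>R v) u - Df (x + a *\<^sub>R u) u)"]
      has_derivative_at_withinI by (metis (no_types, lifting) atLeastAtMost_iff greaterThanLessThan_iff diff_zero)
  define \<psi> where "\<psi> = (\<lambda>b. Df (x + a *\<^sub>R u + b *\<^sub>R v) u)"
  have "(\<psi> has_derivative (\<lambda>h. h * frechet_derivative (\<lambda>y. Df y u) (at (x + a *\<^sub>R u + b *\<^sub>R v)) v)) (at b)"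
    if "0 \<le> b" "b \<le> t" for b
  proof -
    have "(\<psi> has_derivative (\<lambda>h. frechet_derivative (\<lambda>y. Df y u) (at (x + a *\<^sub>R u + b *\<^sub>R v)) (h *\<^sub>R v))) (at b)"
      unfolding \<psi>_def using that a assms(3,4)
      by (intro has_derivative_compose[where g = "\<lambda>y. Df y u", OF _ Du])
        (auto intro!: derivative_eq_intros)
    then show ?thesis
      using that a assms(3) assms(4)[of a b] by (simp add: lin2)
  qed
  then obtain b where b: "0 < b" "b < t"
      "\<psi> t - \<psi> 0 = t * frechet_derivative (\<lambda>y. Df y u) (at (x + a *\<^sub>R u + b *\<^sub>R v)) v"
    using mvt_simple[OF assms(3), where f = \<psi> and f' = "\<lambda>b h. h * frechet_derivative (\<lambda>y. Df y u) (at (x + a *\<^sub>R u + b *\<^sub>R v)) v"]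
      has_derivative_at_withinI by (metis (no_types, lifting) atLeastAtMost_iff greaterThanLessThan_iff diff_zero)
  show thesis
  proof (rule that[of a b])
    have "\<phi> t - \<phi> 0 = t * (\<psi> t - \<psi> 0)"
      using a(3) by (simp add: \<psi>_def)
    then show "f (x + t *\<^sub>R u + t *\<^sub>R v) - f (x + t *\<^sub>R u) - f (x + t *\<^sub>R v) + f x =
      t * t * frechet_derivative (\<lambda>y. frechet_derivative f (at y) u) (at (x + a *\<^sub>R u + b *\<^sub>R v)) v"
      using b(3) by (simp add: \<phi>_def Df_def)
  qed (use a b in auto)
qed

lemma second_derivative_symmetric:
  fixes f :: "'a::euclidean_space \<Rightarrow> real"
  assumes "open S" "Ck_on 2 S f" "x \<in> S"
  shows "frechet_derivative (\<lambda>y. frechet_derivative f (at y) u) (at x) v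
       = frechet_derivative (\<lambda>y. frechet_derivative f (at y) v) (at x) u"
proof (rule ccontr)
  define D where "D = (\<lambda>u v y. frechet_derivative (\<lambda>y. frechet_derivative f (at y) u) (at y) v)"
  have cont: "isCont (D u v) x" for u v
    using assms continuous_on_eq_continuous_at[OF assms(1)] by (auto simp: numeral_2_eq_2 D_def)
  define e where "e = \<bar>D u v x - D v u x\<bar> / 2"
  assume "\<not> ?thesis"
  then have e: "e > 0" by (simp add: e_def D_def)
  have "eventually (\<lambda>y. dist (D u v y) (D u v x) < e \<and> dist (D v u y) (D v u x) < e \<and> y \<in> S) (nhds x)"
    using cont[of u v] cont[of v u] eventually_nhds_in_open[OF assms(1,3)]
    unfolding continuous_at tendsto_at_iff_tendsto_nhds
    by (intro eventually_conj tendstoD[OF _ e])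
  then obtain d where d: "d > 0" "\<And>y. dist y x < d \<Longrightarrow>
      dist (D u v y) (D u v x) < e \<and> dist (D v u y) (D v u x) < e \<and> y \<in> S"
    by (auto simp: eventually_nhds_metric)
  \<comment> \<open>Any step for which the parallelogram with sides \<open>t u\<close> and \<open>t v\<close> stays inside the ball of radius \<open>d\<close>.\<close>
  define t where "t = d / (2 * (norm u + norm v + 1))"
  have pos: "norm u + norm v + 1 > 0" by (simp add: add_nonneg_pos)
  have t: "t > 0" using d(1) pos by (simp add: t_def)
  have near: "dist (x + a *\<^sub>R u + b *\<^sub>R v) x < d" if "0 \<le> a" "a \<le> t" "0 \<le> b" "b \<le> t" for a b
  proof -
    have "dist (x + a *\<^sub>R u + b *\<^sub>R v) x = norm (a *\<^sub>R u + b *\<^sub>R v)"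
      by (simp add: dist_norm)
    also have "\<dots> \<le> a * norm u + b * norm v"
      using norm_triangle_ineq[of "a *\<^sub>R u" "b *\<^sub>R v"] that by simp
    also have "\<dots> \<le> t * norm u + t * norm v"
      using that by (intro add_mono mult_right_mono) auto
    also have "\<dots> \<le> t * (norm u + norm v + 1)"
      using t by (simp add: algebra_simps)
    also have "\<dots> = d / 2" using pos unfolding t_def by (simp only: times_divide_eq_left) (simp add: divide_simps)
    also have "\<dots> < d" using d(1) by simp
    finally show ?thesis .
  qed
  obtain a b where ab: "0 \<le> a" "a \<le> t" "0 \<le> b" "b \<le> t"
    "f (x + t *\<^sub>R u + t *\<^sub>R v) - f (x + t *\<^sub>R u) - f (x + t *\<^sub>R v) + f x = t * t * D u v (x + a *\<^sub>R u + b *\<^sub>R v)"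
    using second_difference_mvt[OF assms(1,2) t, of x u v] d(2) near unfolding D_def by metis
  have near': "x + a *\<^sub>R v + b *\<^sub>R u \<in> S" if "0 \<le> a" "a \<le> t" "0 \<le> b" "b \<le> t" for a b
    using near[of b a] d(2) that by (metis add.commute add.left_commute)
  obtain b' a' where ab': "0 \<le> b'" "b' \<le> t" "0 \<le> a'" "a' \<le> t"
    "f (x + t *\<^sub>R v + t *\<^sub>R u) - f (x + t *\<^sub>R v) - f (x + t *\<^sub>R u) + f x = t * t * D v u (x + b' *\<^sub>R v + a' *\<^sub>R u)"
    using second_difference_mvt[OF assms(1,2) t, of x v u] near' unfolding D_def by metis
  have "t * t * D u v (x + a *\<^sub>R u + b *\<^sub>R v) = t * t * D v u (x + b' *\<^sub>R v + a' *\<^sub>R u)"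
    using ab(5) ab'(5) by (simp add: algebra_simps)
  then have "D u v (x + a *\<^sub>R u + b *\<^sub>R v) = D v u (x + a' *\<^sub>R u + b' *\<^sub>R v)"
    using t by (simp add: algebra_simps)
  with d(2)[OF near[OF ab(1-4)]] d(2)[OF near[OF ab'(3,4,1,2)]] show False
    by (simp add: dist_real_def e_def) (smt (verit) field_sum_of_halves)
qed

lemma smooth_on_subset: "smooth_on S f \<Longrightarrow> T \<subseteq> S \<Longrightarrow> smooth_on T f"
  unfolding smooth_on_def by (metis Ck_on_subset)

lemma smooth_on_cong: "open S \<Longrightarrow> (\<And>x. x \<in> S \<Longrightarrow> f x = g x) \<Longrightarrow> smooth_on S f \<Longrightarrow> smooth_on S g"
  using Ck_on_cong unfolding smooth_on_def by blast

lemma smooth_on_local: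
  assumes "open S" "\<And>x. x \<in> S \<Longrightarrow> \<exists>T. open T \<and> x \<in> T \<and> smooth_on T f"
  shows "smooth_on S f"
  using assms unfolding smooth_on_def by (metis Ck_on_local)

lemma smooth_on_differentiable: "open S \<Longrightarrow> smooth_on S f \<Longrightarrow> x \<in> S \<Longrightarrow> f differentiable (at x)"
  unfolding smooth_on_def by (metis Ck_on.simps(2) differentiable_on_eq_differentiable_at)

lemma smooth_on_frechet_derivative: "smooth_on S f \<Longrightarrow> smooth_on S (\<lambda>x. frechet_derivative f (at x) v)"
  unfolding smooth_on_def by (metis Ck_on.simps(2))

lemma smooth_on_compose:
  fixes f :: "'a::euclidean_space \<Rightarrow> 'b::euclidean_space"
  shows "open S \<Longrightarrow> open T \<Longrightarrow> f ` S \<subseteq> T \<Longrightarrow> smooth_on S f \<Longrightarrow> smooth_on T g \<Longrightarrow> smooth_on S (\<lambda>x. g (f x))"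
  unfolding smooth_on_def using Ck_on_compose by blast

section \<open>Smooth functions, tangent vectors and coordinate fields\<close>

lemma chart_at_in:
  assumes "smooth_atlas A"
  shows "chart_at A p \<in> A" "p \<in> fst (chart_at A p)"
proof -
  have "\<exists>c. c \<in> A \<and> p \<in> fst c"
    using assms unfolding smooth_atlas_def by (metis (mono_tags, lifting) UNIV_I UN_iff case_prod_beta)
  then have "chart_at A p \<in> A \<and> p \<in> fst (chart_at A p)"
    unfolding chart_at_def by (rule someI_ex)
  then show "chart_at A p \<in> A" "p \<in> fst (chart_at A p)" by auto
qed

text \<open>Tangent vectors at a point live in the chart selected at that point, and this selection jumps from
  point to point.  Every statement about fields is therefore transferred to one fixed chart by
  means of directional derivatives, which do not depend on the chart.\<close>

locale manifold =
  fixes A :: "('p::topological_space, 'a::euclidean_space) chart set"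
  assumes atlas: "smooth_atlas A"
begin

lemma
  assumes "(U, \<phi>) \<in> A"
  shows chart_open: "open U"
    and chart_homeomorphism: "homeomorphism U (\<phi> ` U) \<phi> (inv_into U \<phi>)"
    and chart_range_open: "open (\<phi> ` U)"
  using atlas assms unfolding smooth_atlas_def by auto

lemma chart_inv [simp]: "(U, \<phi>) \<in> A \<Longrightarrow> q \<in> U \<Longrightarrow> inv_into U \<phi> (\<phi> q) = q"
  using chart_homeomorphism homeomorphism_apply1 by fastforce

lemma chart_image_open:
  assumes "(U, \<phi>) \<in> A" "open W" "W \<subseteq> U"
  shows "open (\<phi> ` W)"
proof -
  have "openin (top_of_set U) W" using assms by (simp add: open_subset)
  then have "openin (top_of_set (\<phi> ` U)) (\<phi> ` W)"
    using homeomorphism_imp_open_map[OF chart_homeomorphism[OF assms(1)]] by blast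
  then show ?thesis
    using chart_range_open[OF assms(1)] openin_open_trans by blast
qed

lemma chart_Int_image_open: "(U, \<phi>) \<in> A \<Longrightarrow> open W \<Longrightarrow> open (\<phi> ` (U \<inter> W))"
  by (intro chart_image_open) (auto intro: chart_open)

lemma transition_smooth: "(U, \<phi>) \<in> A \<Longrightarrow> (V, \<psi>) \<in> A \<Longrightarrow> smooth_on (\<phi> ` (U \<inter> V)) (\<psi> \<circ> inv_into U \<phi>)"
  using atlas unfolding smooth_atlas_def by fast

lemma chart_exists: obtains U \<phi> where "(U, \<phi>) \<in> A" "p \<in> U"
  using chart_at_in[OF atlas, of p] by (metis prod.collapse)

definition selected_dom :: "'p \<Rightarrow> 'p set" where "selected_dom q = fst (chart_at A q)"

lemma selected_chart: "(selected_dom q, coord A q) \<in> A" and selected_dom: "q \<in> selected_dom q"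
  using chart_at_in[OF atlas, of q] by (auto simp: selected_dom_def coord_def)

lemma param_eq: "param A q = inv_into (selected_dom q) (coord A q)"
  by (simp add: param_def selected_dom_def)

subsection \<open>Smooth functions\<close>

lemma smooth_funD: "smooth_fun A W f \<Longrightarrow> (U, \<phi>) \<in> A \<Longrightarrow> smooth_on (\<phi> ` (U \<inter> W)) (f \<circ> inv_into U \<phi>)"
  unfolding smooth_fun_def by fast

lemma smooth_fun_subset: "smooth_fun A W f \<Longrightarrow> W' \<subseteq> W \<Longrightarrow> smooth_fun A W' f"
  unfolding smooth_fun_def by (fastforce intro: smooth_on_subset)

lemma smooth_fun_cong:
  assumes "open W" "\<And>q. q \<in> W \<Longrightarrow> f q = g q" "smooth_fun A W f"
  shows "smooth_fun A W g"
  unfolding smooth_fun_def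
proof clarify
  fix U \<phi> assume c: "(U, \<phi>) \<in> A"
  show "smooth_on (\<phi> ` (U \<inter> W)) (g \<circ> inv_into U \<phi>)"
  proof (rule smooth_on_cong)
    show "open (\<phi> ` (U \<inter> W))"
      using chart_image_open[OF c, of "U \<inter> W"] chart_open[OF c] assms(1) by auto
    show "smooth_on (\<phi> ` (U \<inter> W)) (f \<circ> inv_into U \<phi>)" by (rule smooth_funD[OF assms(3) c])
    show "(f \<circ> inv_into U \<phi>) x = (g \<circ> inv_into U \<phi>) x" if "x \<in> \<phi> ` (U \<inter> W)" for x
      using that assms(2) c by auto
  qed
qed

text \<open>Smoothness need only be tested in one chart covering the open set: in the others it follows by
  composition with the transition map.\<close>

lemma smooth_funI_chart:
  assumes "(U, \<phi>) \<in> A" "open W" "W \<subseteq> U" "smooth_on (\<phi> ` W) (f \<circ> inv_into U \<phi>)"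
  shows "smooth_fun A W f"
  unfolding smooth_fun_def
proof clarify
  fix V \<psi> assume c: "(V, \<psi>) \<in> A"
  have o: "open (\<psi> ` (V \<inter> W))"
    using chart_image_open[OF c, of "V \<inter> W"] chart_open[OF c] assms(2) by auto
  show "smooth_on (\<psi> ` (V \<inter> W)) (f \<circ> inv_into V \<psi>)"
  proof (rule smooth_on_cong[OF o])
    show "smooth_on (\<psi> ` (V \<inter> W)) (\<lambda>x. (f \<circ> inv_into U \<phi>) ((\<phi> \<circ> inv_into V \<psi>) x))"
    proof (rule smooth_on_compose[where f = "\<phi> \<circ> inv_into V \<psi>" and g = "f \<circ> inv_into U \<phi>", OF o])
      show "open (\<phi> ` W)" by (rule chart_image_open[OF assms(1-3)])
      show "(\<phi> \<circ> inv_into V \<psi>) ` (\<psi> ` (V \<inter> W)) \<subseteq> \<phi> ` W" using c by auto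
      show "smooth_on (\<psi> ` (V \<inter> W)) (\<phi> \<circ> inv_into V \<psi>)"
        by (rule smooth_on_subset[OF transition_smooth[OF c assms(1)]]) (use assms(3) in auto)
    qed (rule assms)
    show "(f \<circ> inv_into U \<phi>) ((\<phi> \<circ> inv_into V \<psi>) x) = (f \<circ> inv_into V \<psi>) x"
      if "x \<in> \<psi> ` (V \<inter> W)" for x
      using that assms(1,3) c by auto
  qed
qed

lemma smooth_fun_local:
  assumes "\<And>q. q \<in> W \<Longrightarrow> \<exists>W'. open W' \<and> q \<in> W' \<and> smooth_fun A W' f" "open W"
  shows "smooth_fun A W f"
  unfolding smooth_fun_def
proof clarify
  fix U \<phi> assume c: "(U, \<phi>) \<in> A"
  show "smooth_on (\<phi> ` (U \<inter> W)) (f \<circ> inv_into U \<phi>)"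
  proof (rule smooth_on_local)
    show "open (\<phi> ` (U \<inter> W))"
      using chart_image_open[OF c, of "U \<inter> W"] chart_open[OF c] assms(2) by auto
    fix x assume "x \<in> \<phi> ` (U \<inter> W)"
    then obtain q where q: "q \<in> U" "q \<in> W" "x = \<phi> q" by auto
    then obtain W' where W': "open W'" "q \<in> W'" "smooth_fun A W' f" using assms(1) by blast
    have "open (\<phi> ` (U \<inter> W'))"
      using chart_image_open[OF c, of "U \<inter> W'"] chart_open[OF c] W' by auto
    with smooth_funD[OF W'(3) c] q W' show "\<exists>T. open T \<and> x \<in> T \<and> smooth_on T (f \<circ> inv_into U \<phi>)" by blast
  qed
qed

lemma smooth_fun_const: "smooth_fun A W (\<lambda>q. c)"
  unfolding smooth_fun_def smooth_on_def by (auto simp: o_def Ck_on_const)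

lemma smooth_fun_add:
  assumes "open W" "smooth_fun A W f" "smooth_fun A W g"
  shows "smooth_fun A W (\<lambda>q. f q + g q)"
  unfolding smooth_fun_def smooth_on_def o_def
proof clarify
  fix U \<phi> k assume c: "(U, \<phi>) \<in> A"
  show "Ck_on k (\<phi> ` (U \<inter> W)) (\<lambda>x. f (inv_into U \<phi> x) + g (inv_into U \<phi> x))"
    using smooth_funD[OF assms(2) c] smooth_funD[OF assms(3) c]
    by (intro Ck_on_add[OF chart_Int_image_open[OF c assms(1)]]) (auto simp: smooth_on_def o_def)
qed

lemma smooth_fun_mult:
  assumes "open W" "smooth_fun A W f" "smooth_fun A W g"
  shows "smooth_fun A W (\<lambda>q. f q * g q)"
  unfolding smooth_fun_def smooth_on_def o_def
proof clarify
  fix U \<phi> k assume c: "(U, \<phi>) \<in> A"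
  show "Ck_on k (\<phi> ` (U \<inter> W)) (\<lambda>x. f (inv_into U \<phi> x) * g (inv_into U \<phi> x))"
    using smooth_funD[OF assms(2) c] smooth_funD[OF assms(3) c]
    by (intro Ck_on_bilinear[OF bounded_bilinear_mult chart_Int_image_open[OF c assms(1)]])
      (auto simp: smooth_on_def o_def)
qed

lemma smooth_fun_diff:
  assumes "open W" "smooth_fun A W f" "smooth_fun A W g"
  shows "smooth_fun A W (\<lambda>q. f q - g q)"
  using smooth_fun_add[OF assms(1,2) smooth_fun_mult[OF assms(1) smooth_fun_const[of W "- 1"] assms(3)]]
  by simp

lemma smooth_fun_sum:
  assumes "open W" "\<And>i. i \<in> I \<Longrightarrow> smooth_fun A W (f i)"
  shows "smooth_fun A W (\<lambda>q. \<Sum>i\<in>I. f i q)"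
  using assms(2) by (induction I rule: infinite_finite_induct) (auto intro: smooth_fun_const smooth_fun_add assms(1))

lemma smooth_fun_prod:
  assumes "open W" "\<And>i. i \<in> I \<Longrightarrow> smooth_fun A W (f i)"
  shows "smooth_fun A W (\<lambda>q. \<Prod>i\<in>I. f i q)"
  using assms(2) by (induction I rule: infinite_finite_induct) (auto intro: smooth_fun_const smooth_fun_mult assms(1))

lemma smooth_fun_inverse:
  assumes "open W" "smooth_fun A W f" "\<And>q. q \<in> W \<Longrightarrow> f q \<noteq> 0"
  shows "smooth_fun A W (\<lambda>q. inverse (f q))"
  unfolding smooth_fun_def smooth_on_def
proof clarify
  fix U \<phi> k assume c: "(U, \<phi>) \<in> A"
  have "open (\<phi> ` (U \<inter> W))"
    using chart_image_open[OF c, of "U \<inter> W"] chart_open[OF c] assms(1) by auto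
  moreover have "Ck_on k (\<phi> ` (U \<inter> W)) (f \<circ> inv_into U \<phi>)"
    using smooth_funD[OF assms(2) c] by (simp add: smooth_on_def)
  moreover have "(f \<circ> inv_into U \<phi>) x \<noteq> 0" if "x \<in> \<phi> ` (U \<inter> W)" for x
    using that c assms(3) by auto
  ultimately show "Ck_on k (\<phi> ` (U \<inter> W)) ((\<lambda>q. inverse (f q)) \<circ> inv_into U \<phi>)"
    using Ck_on_inverse unfolding o_def by blast
qed

lemma smooth_fun_chart:
  assumes "(U, \<phi>) \<in> A" "W \<subseteq> U"
  shows "smooth_fun A W (\<lambda>r. \<phi> r \<bullet> i)"
proof (rule smooth_fun_subset[OF _ assms(2)], unfold smooth_fun_def smooth_on_def, clarify)
  fix V \<psi> k assume c: "(V, \<psi>) \<in> A"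
  have "open (\<psi> ` (V \<inter> U))"
    using chart_image_open[OF c, of "V \<inter> U"] chart_open[OF c] chart_open[OF assms(1)] by auto
  moreover have "Ck_on k (\<psi> ` (V \<inter> U)) (\<phi> \<circ> inv_into V \<psi>)"
    using transition_smooth[OF c assms(1)] by (simp add: smooth_on_def)
  ultimately show "Ck_on k (\<psi> ` (V \<inter> U)) ((\<lambda>r. \<phi> r \<bullet> i) \<circ> inv_into V \<psi>)"
    using Ck_on_bounded_linear[OF bounded_linear_inner_left] unfolding o_def by blast
qed

lemma smooth_fun_differentiable:
  assumes "smooth_fun A W f" "open W" "q \<in> W" "(U, \<phi>) \<in> A" "q \<in> U"
  shows "(f \<circ> inv_into U \<phi>) differentiable (at (\<phi> q))"
proof (rule smooth_on_differentiable)
  show "open (\<phi> ` (U \<inter> W))"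
    using chart_image_open[OF assms(4), of "U \<inter> W"] chart_open[OF assms(4)] assms(2) by auto
qed (use assms smooth_funD in auto)

subsection \<open>Tangent vectors as derivations\<close>

lemma vapply_has_derivative:
  assumes "smooth_fun A W f" "open W" "q \<in> W"
  shows "((f \<circ> param A q) has_derivative (\<lambda>v. vapply A q v f)) (at (coord A q q))"
  unfolding vapply_def param_eq
  using smooth_fun_differentiable[OF assms selected_chart selected_dom] by (rule has_frechet_derivative)

lemma vapply_eqI: "((f \<circ> param A q) has_derivative f') (at (coord A q q)) \<Longrightarrow> vapply A q v f = f' v"
  unfolding vapply_def by (simp add: frechet_derivative_eqI)

lemma vapply_cong:
  assumes "open W" "q \<in> W" "\<And>r. r \<in> W \<Longrightarrow> f r = g r"
  shows "vapply A q v f = vapply A q v g"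
proof -
  have "frechet_derivative (f \<circ> param A q) (at (coord A q q)) = frechet_derivative (g \<circ> param A q) (at (coord A q q))"
  proof (rule frechet_derivative_cong_open)
    show "open (coord A q ` (selected_dom q \<inter> W))"
      using chart_image_open[OF selected_chart] chart_open[OF selected_chart] assms(1) by blast
    show "coord A q q \<in> coord A q ` (selected_dom q \<inter> W)" using selected_dom assms(2) by auto
    show "(f \<circ> param A q) y = (g \<circ> param A q) y" if "y \<in> coord A q ` (selected_dom q \<inter> W)" for y
      using that assms(3) selected_chart by (auto simp: param_eq)
  qed
  then show ?thesis by (simp add: vapply_def)
qed

lemma vapply_linear: "smooth_fun A W f \<Longrightarrow> open W \<Longrightarrow> q \<in> W \<Longrightarrow> linear (\<lambda>v. vapply A q v f)"
  using vapply_has_derivative has_derivative_bounded_linear bounded_linear.linear by blast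

lemma vapply_const: "vapply A q v (\<lambda>r. c) = 0"
  by (simp add: vapply_def o_def)

lemma vapply_add:
  assumes "smooth_fun A W f" "smooth_fun A W g" "open W" "q \<in> W"
  shows "vapply A q v (\<lambda>r. f r + g r) = vapply A q v f + vapply A q v g"
  using has_derivative_add[OF vapply_has_derivative[OF assms(1,3,4)] vapply_has_derivative[OF assms(2,3,4)]]
  by (intro vapply_eqI) (simp add: o_def)

lemma vapply_mult:
  assumes "smooth_fun A W f" "smooth_fun A W g" "open W" "q \<in> W"
  shows "vapply A q v (\<lambda>r. f r * g r) = f q * vapply A q v g + vapply A q v f * g q"
  using has_derivative_mult[OF vapply_has_derivative[OF assms(1,3,4)] vapply_has_derivative[OF assms(2,3,4)]]
    chart_inv[OF selected_chart selected_dom]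
  by (intro vapply_eqI) (simp add: o_def param_eq)

lemma vapply_sum:
  assumes "\<And>i. i \<in> I \<Longrightarrow> smooth_fun A W (f i)" "open W" "q \<in> W"
  shows "vapply A q v (\<lambda>r. \<Sum>i\<in>I. f i r) = (\<Sum>i\<in>I. vapply A q v (f i))"
  using assms(1)
proof (induction I rule: infinite_finite_induct)
  case (insert i I)
  then show ?case
    using vapply_add[where f = "f i" and g = "\<lambda>r. \<Sum>i\<in>I. f i r", OF _ smooth_fun_sum assms(2,3)] assms(2)
    by simp
qed (simp_all add: vapply_const)

lemma vector_fieldD:
  assumes "vector_field A U X" "open V" "smooth_fun A V f"
  shows "smooth_fun A (U \<inter> V) (\<lambda>q. vapply A q (X q) f)"
proof -
  have "smooth_fun A (U \<inter> (\<lambda>p. p) -` V) (\<lambda>q. vapply A q (X q) f)"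
    using assms unfolding vector_field_def field_along_def by blast
  then show ?thesis by simp
qed

text \<open>The coordinate vector field of the chart \<open>c\<close> with constant coordinate vector \<open>w\<close>.  Its values are transported
  to the selected charts by the derivative of the transition map.\<close>

definition coord_field :: "('p, 'a) chart \<Rightarrow> 'a \<Rightarrow> 'p \<Rightarrow> 'a" where
  "coord_field c w q = frechet_derivative (coord A q \<circ> inv_into (fst c) (snd c)) (at (snd c q)) w"

lemma transition_has_derivative:
  assumes "(U, \<phi>) \<in> A" "(V, \<psi>) \<in> A" "q \<in> U" "q \<in> V"
  shows "((\<psi> \<circ> inv_into U \<phi>) has_derivative frechet_derivative (\<psi> \<circ> inv_into U \<phi>) (at (\<phi> q))) (at (\<phi> q))"
proof (intro has_frechet_derivative smooth_on_differentiable[OF _ transition_smooth])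
  show "open (\<phi> ` (U \<inter> V))"
    using chart_image_open[OF assms(1), of "U \<inter> V"] chart_open assms by auto
qed (use assms in auto)

lemma vapply_coord_field:
  assumes "(U, \<phi>) \<in> A" "q \<in> U" "smooth_fun A W f" "open W" "q \<in> W"
  shows "vapply A q (coord_field (U, \<phi>) w q) f = frechet_derivative (f \<circ> inv_into U \<phi>) (at (\<phi> q)) w"
proof -
  have "((\<lambda>x. (f \<circ> param A q) ((coord A q \<circ> inv_into U \<phi>) x)) has_derivative
      (\<lambda>w. vapply A q (coord_field (U, \<phi>) w q) f)) (at (\<phi> q))"
    unfolding coord_field_def fst_conv snd_conv
    by (rule has_derivative_compose[OF transition_has_derivative[OF assms(1) selected_chart assms(2) selected_dom]])
      (use vapply_has_derivative[OF assms(3-5)] assms in \<open>simp add: o_def\<close>)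
  moreover have "open (\<phi> ` (U \<inter> selected_dom q))" "\<phi> q \<in> \<phi> ` (U \<inter> selected_dom q)"
    using chart_image_open[OF assms(1), of "U \<inter> selected_dom q"] chart_open[OF assms(1)] chart_open[OF selected_chart] assms(2) selected_dom
    by auto
  moreover have "(f \<circ> param A q) ((coord A q \<circ> inv_into U \<phi>) x) = (f \<circ> inv_into U \<phi>) x" if "x \<in> \<phi> ` (U \<inter> selected_dom q)" for x
    using that assms(1) chart_inv[OF selected_chart] by (auto simp: param_eq)
  ultimately have "((f \<circ> inv_into U \<phi>) has_derivative
      (\<lambda>w. vapply A q (coord_field (U, \<phi>) w q) f)) (at (\<phi> q))"
    by (rule has_derivative_transform_within_open)
  then show ?thesis by (simp add: frechet_derivative_eqI)
qed

text \<open>The two transition maps between the chart and the selected one are mutually inverse, hence so are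
  their derivatives.  The coefficients are written as directional derivatives of the coordinate
  functions, so that for a smooth field they are visibly smooth.\<close>

lemma coord_expansion:
  assumes "(U, \<phi>) \<in> A" "q \<in> U"
  shows "v = (\<Sum>i\<in>Basis. vapply A q v (\<lambda>r. \<phi> r \<bullet> i) *\<^sub>R coord_field (U, \<phi>) i q)"
proof -
  let ?T = "coord A q \<circ> inv_into U \<phi>" and ?S = "\<phi> \<circ> inv_into (selected_dom q) (coord A q)"
  let ?DT = "frechet_derivative ?T (at (\<phi> q))" and ?DS = "frechet_derivative ?S (at (coord A q q))"
  have T: "(?T has_derivative ?DT) (at (\<phi> q))"
    by (rule transition_has_derivative[OF assms(1) selected_chart assms(2) selected_dom])
  have S: "(?S has_derivative ?DS) (at (coord A q q))"
    by (rule transition_has_derivative[OF selected_chart assms(1) selected_dom assms(2)])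
  have "((\<lambda>x. ?T (?S x)) has_derivative (\<lambda>v. ?DT (?DS v))) (at (coord A q q))"
    using has_derivative_compose[OF S, of ?T ?DT] T selected_dom selected_chart by simp
  moreover have "open (coord A q ` (U \<inter> selected_dom q))" "coord A q q \<in> coord A q ` (U \<inter> selected_dom q)"
    using chart_image_open[OF selected_chart, of "U \<inter> selected_dom q"] chart_open[OF assms(1)] chart_open[OF selected_chart] assms(2) selected_dom
    by auto
  moreover have "?T (?S x) = x" if "x \<in> coord A q ` (U \<inter> selected_dom q)" for x
    using that assms(1) chart_inv[OF selected_chart] by auto
  ultimately have "((\<lambda>x. x) has_derivative (\<lambda>v. ?DT (?DS v))) (at (coord A q q))"
    by (rule has_derivative_transform_within_open)
  then have "v = ?DT (?DS v)"
    by (metis frechet_derivative_eqI frechet_derivative_ident)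
  also have "\<dots> = (\<Sum>i\<in>Basis. (?DS v \<bullet> i) *\<^sub>R ?DT i)"
    using T by (intro linear_eq_sum_Basis) (simp add: has_derivative_linear)
  also have "\<dots> = (\<Sum>i\<in>Basis. vapply A q v (\<lambda>r. \<phi> r \<bullet> i) *\<^sub>R coord_field (U, \<phi>) i q)"
  proof (rule sum.cong[OF refl])
    fix i
    have "(((\<lambda>r. \<phi> r \<bullet> i) \<circ> param A q) has_derivative (\<lambda>v. ?DS v \<bullet> i)) (at (coord A q q))"
      using has_derivative_inner_left[OF S, of i] by (simp add: o_def param_eq)
    then show "(?DS v \<bullet> i) *\<^sub>R ?DT i = vapply A q v (\<lambda>r. \<phi> r \<bullet> i) *\<^sub>R coord_field (U, \<phi>) i q"
      by (simp add: vapply_eqI coord_field_def)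
  qed
  finally show ?thesis .
qed

lemma tangent_eqI:
  assumes "(U, \<phi>) \<in> A" "q \<in> U" "\<And>i. i \<in> Basis \<Longrightarrow> vapply A q v (\<lambda>r. \<phi> r \<bullet> i) = vapply A q w (\<lambda>r. \<phi> r \<bullet> i)"
  shows "v = w"
  using coord_expansion[OF assms(1,2), of v] coord_expansion[OF assms(1,2), of w] assms(3) by simp

lemma vapply_coord_expansion:
  assumes "(U, \<phi>) \<in> A" "q \<in> U" "smooth_fun A W f" "open W" "q \<in> W"
  shows "vapply A q v f = (\<Sum>i\<in>Basis. vapply A q v (\<lambda>r. \<phi> r \<bullet> i) * vapply A q (coord_field (U, \<phi>) i q) f)"
proof -
  note lin = vapply_linear[OF assms(3-5)]
  have "vapply A q v f = vapply A q (\<Sum>i\<in>Basis. vapply A q v (\<lambda>r. \<phi> r \<bullet> i) *\<^sub>R coord_field (U, \<phi>) i q) f"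
    using coord_expansion[OF assms(1,2), of v] by simp
  also have "\<dots> = (\<Sum>i\<in>Basis. vapply A q v (\<lambda>r. \<phi> r \<bullet> i) * vapply A q (coord_field (U, \<phi>) i q) f)"
    by (simp add: linear_sum[OF lin] linear_cmul[OF lin])
  finally show ?thesis .
qed

lemma smooth_vapply_coord_field:
  assumes c: "(U, \<phi>) \<in> A" and "smooth_fun A W f" "open W"
  shows "smooth_fun A (U \<inter> W) (\<lambda>q. vapply A q (coord_field (U, \<phi>) w q) f)"
proof (rule smooth_funI_chart[OF c])
  show "open (U \<inter> W)" using chart_open[OF c] assms by auto
  then have "open (\<phi> ` (U \<inter> W))" by (intro chart_image_open[OF c]) auto
  then show "smooth_on (\<phi> ` (U \<inter> W)) ((\<lambda>q. vapply A q (coord_field (U, \<phi>) w q) f) \<circ> inv_into U \<phi>)"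
    by (rule smooth_on_cong[OF _ _ smooth_on_frechet_derivative[OF smooth_funD[OF assms(2) c]]])
      (use assms vapply_coord_field c in auto)
qed auto

text \<open>In coordinates both sides are second partial derivatives of the same function.\<close>

lemma coord_field_commute:
  assumes c: "(U, \<phi>) \<in> A" and "q \<in> U" "smooth_fun A W f" "open W" "q \<in> W"
  shows "vapply A q (coord_field (U, \<phi>) v q) (\<lambda>r. vapply A r (coord_field (U, \<phi>) w r) f)
       = vapply A q (coord_field (U, \<phi>) w q) (\<lambda>r. vapply A r (coord_field (U, \<phi>) v r) f)"
proof -
  let ?f = "f \<circ> inv_into U \<phi>" and ?S = "\<phi> ` (U \<inter> W)"
  have o: "open (U \<inter> W)" using chart_open[OF c] assms by auto
  have S: "open ?S" "\<phi> q \<in> ?S" using o assms by (auto intro: chart_image_open[OF c])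
  have "vapply A q (coord_field (U, \<phi>) v q) (\<lambda>r. vapply A r (coord_field (U, \<phi>) w r) f)
      = frechet_derivative (\<lambda>x. frechet_derivative ?f (at x) w) (at (\<phi> q)) v" for v w
  proof -
    have "vapply A q (coord_field (U, \<phi>) v q) (\<lambda>r. vapply A r (coord_field (U, \<phi>) w r) f)
       = frechet_derivative ((\<lambda>r. vapply A r (coord_field (U, \<phi>) w r) f) \<circ> inv_into U \<phi>) (at (\<phi> q)) v"
      using assms by (intro vapply_coord_field[OF c _ smooth_vapply_coord_field[OF c] o]) auto
    also have "\<dots> = frechet_derivative (\<lambda>x. frechet_derivative ?f (at x) w) (at (\<phi> q)) v"
      by (rule fun_cong[OF frechet_derivative_cong_open[OF S]]) (use assms vapply_coord_field in auto)
    finally show ?thesis .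
  qed
  then show ?thesis
    using second_derivative_symmetric[OF S(1) _ S(2), of ?f w v] smooth_funD[OF assms(3) c]
    by (simp add: smooth_on_def)
qed

end

subsection \<open>Vector fields along smooth maps\<close>

locale manifold_map = M: manifold A + N: manifold B
  for A :: "('p::topological_space, 'a::euclidean_space) chart set"
    and B :: "('q::topological_space, 'b::euclidean_space) chart set" +
  fixes F :: "'p \<Rightarrow> 'q"
  assumes smooth: "smooth_map A B F"
begin

lemma continuous: "continuous_on UNIV F"
  using smooth by (simp add: smooth_map_def)

lemma vimage_open: "open V \<Longrightarrow> open (F -` V)"
  using continuous by (simp add: continuous_on_open_vimage)

lemma local_rep_smooth:
  "(U, \<phi>) \<in> A \<Longrightarrow> (V, \<psi>) \<in> B \<Longrightarrow> smooth_on (\<phi> ` (U \<inter> F -` V)) (\<psi> \<circ> F \<circ> inv_into U \<phi>)"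
  using smooth unfolding smooth_map_def by fast

lemma smooth_fun_pullback:
  assumes "open U" "open V" "smooth_fun B V f"
  shows "smooth_fun A (U \<inter> F -` V) (\<lambda>q. f (F q))"
proof (rule M.smooth_fun_local)
  fix q assume q: "q \<in> U \<inter> F -` V"
  obtain P \<phi> where P: "(P, \<phi>) \<in> A" "q \<in> P" by (rule M.chart_exists)
  obtain Q \<psi> where Q: "(Q, \<psi>) \<in> B" "F q \<in> Q" by (rule N.chart_exists)
  let ?W = "P \<inter> F -` (Q \<inter> V)"
  have o: "open ?W" "open (Q \<inter> V)"
    using M.chart_open[OF P(1)] N.chart_open[OF Q(1)] assms by (auto intro!: vimage_open)
  have o2: "open (\<phi> ` ?W)" "open (\<psi> ` (Q \<inter> V))"
    using M.chart_image_open[OF P(1) o(1)] N.chart_image_open[OF Q(1) o(2)] by auto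
  have "smooth_on (\<phi> ` ?W) ((\<lambda>q. f (F q)) \<circ> inv_into P \<phi>)"
  proof (rule smooth_on_cong[OF o2(1)])
    show "smooth_on (\<phi> ` ?W) (\<lambda>x. (f \<circ> inv_into Q \<psi>) ((\<psi> \<circ> F \<circ> inv_into P \<phi>) x))"
    proof (rule smooth_on_compose[OF o2])
      show "(\<psi> \<circ> F \<circ> inv_into P \<phi>) ` \<phi> ` ?W \<subseteq> \<psi> ` (Q \<inter> V)" using P by auto
      show "smooth_on (\<phi> ` ?W) (\<psi> \<circ> F \<circ> inv_into P \<phi>)"
        by (rule smooth_on_subset[OF local_rep_smooth[OF P(1) Q(1)]]) auto
      show "smooth_on (\<psi> ` (Q \<inter> V)) (f \<circ> inv_into Q \<psi>)" by (rule N.smooth_funD[OF assms(3) Q(1)])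
    qed
    show "(f \<circ> inv_into Q \<psi>) ((\<psi> \<circ> F \<circ> inv_into P \<phi>) x) = ((\<lambda>q. f (F q)) \<circ> inv_into P \<phi>) x"
      if "x \<in> \<phi> ` ?W" for x
      using that P Q by auto
  qed
  then have "smooth_fun A ?W (\<lambda>q. f (F q))"
    using M.smooth_funI_chart[OF P(1) o(1)] by auto
  then show "\<exists>W'. open W' \<and> q \<in> W' \<and> smooth_fun A W' (\<lambda>q. f (F q))"
    using o q P Q by (intro exI[of _ ?W]) auto
qed (use assms vimage_open in auto)

lemma tangent_map_has_derivative:
  "((coord B (F q) \<circ> F \<circ> param A q) has_derivative tangent_map A B F q) (at (coord A q q))"
proof -
  let ?W = "M.selected_dom q \<inter> F -` N.selected_dom (F q)"
  have "open ?W" using M.chart_open[OF M.selected_chart] N.chart_open[OF N.selected_chart] vimage_open by auto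
  then have "open (coord A q ` ?W)" by (intro M.chart_image_open[OF M.selected_chart]) auto
  then have "(coord B (F q) \<circ> F \<circ> param A q) differentiable (at (coord A q q))"
    unfolding M.param_eq
    by (rule smooth_on_differentiable[OF _ local_rep_smooth[OF M.selected_chart N.selected_chart]])
      (use M.selected_dom N.selected_dom in auto)
  then show ?thesis
    using has_frechet_derivative unfolding tangent_map_def by blast
qed

lemma tangent_map_linear: "linear (tangent_map A B F q)"
  using tangent_map_has_derivative has_derivative_linear by blast

text \<open>Chain rule: the differential pushes derivations forward.  It characterizes the differential without
  reference to the selected charts.\<close>

lemma vapply_tangent_map:
  assumes "open V" "smooth_fun B V f" "F q \<in> V"
  shows "vapply B (F q) (tangent_map A B F q v) f = vapply A q v (\<lambda>r. f (F r))"
proof -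
  let ?G = "coord B (F q) \<circ> F \<circ> param A q"
  have q: "?G (coord A q q) = coord B (F q) (F q)"
    using M.chart_inv[OF M.selected_chart M.selected_dom] by (simp add: M.param_eq)
  have "((\<lambda>x. (f \<circ> param B (F q)) (?G x)) has_derivative
      (\<lambda>v. vapply B (F q) (tangent_map A B F q v) f)) (at (coord A q q))"
    by (rule has_derivative_compose[OF tangent_map_has_derivative])
      (use N.vapply_has_derivative[OF assms(2,1,3)] q in \<open>simp add: o_def\<close>)
  moreover have "open (coord A q ` (M.selected_dom q \<inter> F -` N.selected_dom (F q)))"
    using M.chart_open[OF M.selected_chart] N.chart_open[OF N.selected_chart] vimage_open
    by (intro M.chart_image_open[OF M.selected_chart]) auto
  moreover have "coord A q q \<in> coord A q ` (M.selected_dom q \<inter> F -` N.selected_dom (F q))"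
    using M.selected_dom N.selected_dom by auto
  moreover have "(f \<circ> param B (F q)) (?G x) = ((\<lambda>r. f (F r)) \<circ> param A q) x"
    if "x \<in> coord A q ` (M.selected_dom q \<inter> F -` N.selected_dom (F q))" for x
    using that M.chart_inv[OF M.selected_chart] N.chart_inv[OF N.selected_chart] by (auto simp: M.param_eq N.param_eq)
  ultimately have "(((\<lambda>r. f (F r)) \<circ> param A q) has_derivative
      (\<lambda>v. vapply B (F q) (tangent_map A B F q v) f)) (at (coord A q q))"
    by (rule has_derivative_transform_within_open)
  then show ?thesis by (simp add: M.vapply_eqI)
qed

lemma field_alongD:
  "field_along A B F U W \<Longrightarrow> open V \<Longrightarrow> smooth_fun B V f \<Longrightarrow>
    smooth_fun A (U \<inter> F -` V) (\<lambda>p. vapply B (F p) (W p) f)"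
  unfolding field_along_def by blast

lemma field_along_subset: "field_along A B F U W \<Longrightarrow> U' \<subseteq> U \<Longrightarrow> field_along A B F U' W"
  unfolding field_along_def by (meson Int_mono M.smooth_fun_subset order_refl)

lemma field_along_cong:
  assumes "open U" "\<And>q. q \<in> U \<Longrightarrow> W q = W' q" "field_along A B F U W"
  shows "field_along A B F U W'"
  unfolding field_along_def
proof (intro allI impI)
  fix V f assume V: "open V" "smooth_fun B V f"
  show "smooth_fun A (U \<inter> F -` V) (\<lambda>p. vapply B (F p) (W' p) f)"
    by (rule M.smooth_fun_cong[OF _ _ field_alongD[OF assms(3) V]])
      (use assms(1,2) V(1) vimage_open in auto)
qed

lemma field_along_local:
  assumes "open U" "\<And>q. q \<in> U \<Longrightarrow> \<exists>U'. open U' \<and> q \<in> U' \<and> field_along A B F U' W"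
  shows "field_along A B F U W"
  unfolding field_along_def
proof (intro allI impI)
  fix V f assume V: "open V" "smooth_fun B V f"
  show "smooth_fun A (U \<inter> F -` V) (\<lambda>p. vapply B (F p) (W p) f)"
  proof (rule M.smooth_fun_local)
    fix q assume q: "q \<in> U \<inter> F -` V"
    then obtain U' where U': "open U'" "q \<in> U'" "field_along A B F U' W" using assms(2) by blast
    with field_alongD[OF U'(3) V] q vimage_open[OF V(1)]
    show "\<exists>W'. open W' \<and> q \<in> W' \<and> smooth_fun A W' (\<lambda>p. vapply B (F p) (W p) f)"
      by (intro exI[of _ "U' \<inter> F -` V"]) auto
  qed (use assms(1) V(1) vimage_open in auto)
qed

lemma field_along_zero: "field_along A B F U (\<lambda>q. 0)"
  unfolding field_along_def
proof (intro allI impI)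
  fix V f assume V: "open V" "smooth_fun B V f"
  have "0 = vapply B (F q) 0 f" if "F q \<in> V" for q
    using linear_0[OF N.vapply_linear[OF V(2,1) that]] by simp
  then show "smooth_fun A (U \<inter> F -` V) (\<lambda>p. vapply B (F p) 0 f)"
    using M.smooth_fun_subset[OF M.smooth_fun_cong[OF vimage_open[OF V(1)] _ M.smooth_fun_const[of _ 0],
        of "\<lambda>p. vapply B (F p) 0 f"], of "U \<inter> F -` V"] by auto
qed

lemma field_along_add:
  assumes "open U" "field_along A B F U W" "field_along A B F U W'"
  shows "field_along A B F U (\<lambda>q. W q + W' q)"
  unfolding field_along_def
proof (intro allI impI)
  fix V f assume V: "open V" "smooth_fun B V f"
  have o: "open (U \<inter> F -` V)" using assms(1) vimage_open[OF V(1)] by auto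
  show "smooth_fun A (U \<inter> F -` V) (\<lambda>p. vapply B (F p) (W p + W' p) f)"
  proof (rule M.smooth_fun_cong[OF o _ M.smooth_fun_add[OF o field_alongD[OF assms(2) V] field_alongD[OF assms(3) V]]])
    show "vapply B (F p) (W p) f + vapply B (F p) (W' p) f = vapply B (F p) (W p + W' p) f"
      if "p \<in> U \<inter> F -` V" for p
      using linear_add[OF N.vapply_linear[OF V(2,1), of "F p"], of "W p" "W' p"] that by simp
  qed
qed

lemma field_along_scale:
  assumes "open U" "field_along A B F U W" "smooth_fun A U w"
  shows "field_along A B F U (\<lambda>q. w q *\<^sub>R W q)"
  unfolding field_along_def
proof (intro allI impI)
  fix V f assume V: "open V" "smooth_fun B V f"
  have o: "open (U \<inter> F -` V)" using assms(1) vimage_open[OF V(1)] by auto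
  have w: "smooth_fun A (U \<inter> F -` V) w" by (rule M.smooth_fun_subset[OF assms(3)]) auto
  show "smooth_fun A (U \<inter> F -` V) (\<lambda>p. vapply B (F p) (w p *\<^sub>R W p) f)"
  proof (rule M.smooth_fun_cong[OF o _ M.smooth_fun_mult[OF o w field_alongD[OF assms(2) V]]])
    show "w p * vapply B (F p) (W p) f = vapply B (F p) (w p *\<^sub>R W p) f" if "p \<in> U \<inter> F -` V" for p
      using linear_cmul[OF N.vapply_linear[OF V(2,1), of "F p"], of "w p" "W p"] that by simp
  qed
qed

lemma field_along_diff:
  assumes "open U" "field_along A B F U W" "field_along A B F U W'"
  shows "field_along A B F U (\<lambda>q. W q - W' q)"
  using field_along_add[OF assms(1,2) field_along_scale[OF assms(1,3) M.smooth_fun_const[of _ "- 1"]]] by simp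

lemma field_along_sum:
  assumes "open U" "\<And>i. i \<in> I \<Longrightarrow> field_along A B F U (W i)" "\<And>i. i \<in> I \<Longrightarrow> smooth_fun A U (w i)"
  shows "field_along A B F U (\<lambda>q. \<Sum>i\<in>I. w i q *\<^sub>R W i q)"
  using assms(2,3)
  by (induction I rule: infinite_finite_induct)
    (auto intro!: field_along_zero field_along_add field_along_scale assms(1))

lemma field_along_restrict:
  assumes "open V" "vector_field B V Y"
  shows "field_along A B F (F -` V) (\<lambda>q. Y (F q))"
  unfolding field_along_def
proof (intro allI impI)
  fix V' f assume V': "open V'" "smooth_fun B V' f"
  have "smooth_fun B (V \<inter> V') (\<lambda>r. vapply B r (Y r) f)"
    using N.vector_fieldD[OF assms(2) V'] .
  from smooth_fun_pullback[OF open_UNIV _ this] assms(1) V'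
  show "smooth_fun A (F -` V \<inter> F -` V') (\<lambda>p. vapply B (F p) (Y (F p)) f)"
    by (simp add: vimage_Int open_Int)
qed

lemma field_along_tangent_map:
  assumes "open U" "vector_field A U X"
  shows "field_along A B F U (\<lambda>q. tangent_map A B F q (X q))"
  unfolding field_along_def
proof (intro allI impI)
  fix V f assume V: "open V" "smooth_fun B V f"
  have "smooth_fun A (F -` V) (\<lambda>q. f (F q))" using smooth_fun_pullback[OF open_UNIV V] by simp
  then have s: "smooth_fun A (U \<inter> F -` V) (\<lambda>q. vapply A q (X q) (\<lambda>r. f (F r)))"
    by (rule M.vector_fieldD[OF assms(2) vimage_open[OF V(1)]])
  show "smooth_fun A (U \<inter> F -` V) (\<lambda>p. vapply B (F p) (tangent_map A B F p (X p)) f)"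
    by (rule M.smooth_fun_cong[OF _ _ s]) (use vapply_tangent_map[OF V] assms(1) vimage_open[OF V(1)] in auto)
qed

end

text \<open>Vector fields are fields along the identity, so all results on fields along maps apply to them.\<close>

sublocale manifold \<subseteq> self: manifold_map A A "\<lambda>p. p"
proof
  show "smooth_map A A (\<lambda>p. p)"
    unfolding smooth_map_def using transition_smooth by (auto simp: o_def)
qed

context manifold
begin

lemma vector_fieldI:
  assumes "\<And>V f. open V \<Longrightarrow> smooth_fun A V f \<Longrightarrow> smooth_fun A (U \<inter> V) (\<lambda>q. vapply A q (X q) f)"
  shows "vector_field A U X"
proof -
  have "(\<lambda>p. p) -` V = V" for V :: "'p set" by auto
  then show ?thesis using assms by (simp add: vector_field_def field_along_def)
qed

lemma coord_field_vector_field: "(U, \<phi>) \<in> A \<Longrightarrow> vector_field A U (coord_field (U, \<phi>) w)"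
  by (intro vector_fieldI smooth_vapply_coord_field)

text \<open>Pointwise identities are stated for local fields; this lemma makes them available for vectors.\<close>

lemma tangent_vector_extends: "\<exists>P X. open P \<and> p \<in> P \<and> vector_field A P X \<and> X p = v"
proof -
  obtain P \<phi> where c: "(P, \<phi>) \<in> A" "p \<in> P" by (rule chart_exists)
  define x where "x = (\<lambda>i. vapply A p v (\<lambda>r. \<phi> r \<bullet> i))"
  let ?X = "\<lambda>q. \<Sum>i\<in>Basis. x i *\<^sub>R coord_field (P, \<phi>) i q"
  have o: "open P" by (rule chart_open[OF c(1)])
  have "vector_field A P ?X"
    unfolding vector_field_def
    by (rule self.field_along_sum[OF o coord_field_vector_field[OF c(1), unfolded vector_field_def] smooth_fun_const])
  moreover have "?X p = v" unfolding x_def by (rule coord_expansion[OF c, symmetric])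
  ultimately show ?thesis using o c(2) by blast
qed

lemma vector_field_subset: "vector_field A U X \<Longrightarrow> U' \<subseteq> U \<Longrightarrow> vector_field A U' X"
  using self.field_along_subset by (simp add: vector_field_def)

end

subsection \<open>Coordinate expansion of fields along a map\<close>

context manifold_map
begin

text \<open>The coefficients of a field along \<open>F\<close> with respect to the coordinate frame of the ambient chart with
  coordinate map \<open>\<psi>\<close>.\<close>

definition component :: "('q \<Rightarrow> 'b) \<Rightarrow> ('p \<Rightarrow> 'b) \<Rightarrow> 'b \<Rightarrow> 'p \<Rightarrow> real" where
  "component \<psi> W j q = vapply B (F q) (W q) (\<lambda>r. \<psi> r \<bullet> j)"

lemma component_smooth:
  assumes "field_along A B F U W" "(V, \<psi>) \<in> B" "U \<subseteq> F -` V"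
  shows "smooth_fun A U (component \<psi> W j)"
proof -
  have "U \<inter> F -` V = U" using assms(3) by auto
  then show ?thesis
    using field_alongD[OF assms(1) N.chart_open[OF assms(2)] N.smooth_fun_chart[OF assms(2) order_refl]]
    unfolding component_def by metis
qed

lemma component_expansion:
  assumes "(V, \<psi>) \<in> B" "F q \<in> V"
  shows "W q = (\<Sum>j\<in>Basis. component \<psi> W j q *\<^sub>R N.coord_field (V, \<psi>) j (F q))"
  unfolding component_def by (rule N.coord_expansion[OF assms])

lemma coord_field_along:
  assumes "(V, \<psi>) \<in> B" "U \<subseteq> F -` V"
  shows "field_along A B F U (\<lambda>q. N.coord_field (V, \<psi>) j (F q))"
  using field_along_subset[OF field_along_restrict[OF N.chart_open[OF assms(1)] N.coord_field_vector_field[OF assms(1)]] assms(2)] .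

lemma field_alongI_component:
  assumes "open U" "(V, \<psi>) \<in> B" "U \<subseteq> F -` V" "\<And>j. j \<in> Basis \<Longrightarrow> smooth_fun A U (component \<psi> W j)"
  shows "field_along A B F U W"
  by (rule field_along_cong[OF assms(1) _ field_along_sum[OF assms(1) coord_field_along[OF assms(2,3)] assms(4)]])
    (use component_expansion[OF assms(2), of _ W] assms(3) in auto)

lemma component_tangent_map:
  assumes "(V, \<psi>) \<in> B" "F q \<in> V"
  shows "component \<psi> (\<lambda>q. tangent_map A B F q (X q)) j q = vapply A q (X q) (\<lambda>r. \<psi> (F r) \<bullet> j)"
  unfolding component_def
  by (rule vapply_tangent_map[OF N.chart_open[OF assms(1)] N.smooth_fun_chart[OF assms(1) order_refl] assms(2)])

end

subsection \<open>The Lie bracket\<close>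

context manifold
begin

text \<open>The second sum is the second order part of the operator \<open>X Y\<close>.  Exchanging \<open>X\<close> and \<open>Y\<close> transposes its
  coefficients, and coordinate fields commute, so it drops out of the commutator.\<close>

lemma vapply_twice:
  assumes X: "vector_field A U X" and Y: "vector_field A U Y" and U: "open U" "p \<in> U"
    and c: "(P, \<phi>) \<in> A" "p \<in> P" and f: "smooth_fun A W f" "open W" "p \<in> W"
  defines "E \<equiv> \<lambda>i q. coord_field (P, \<phi>) i q"
  shows "vapply A p (X p) (\<lambda>q. vapply A q (Y q) f) =
    (\<Sum>j\<in>Basis. vapply A p (X p) (\<lambda>q. vapply A q (Y q) (\<lambda>r. \<phi> r \<bullet> j)) * vapply A p (E j p) f) +
    (\<Sum>j\<in>Basis. \<Sum>i\<in>Basis. vapply A p (Y p) (\<lambda>r. \<phi> r \<bullet> j) * vapply A p (X p) (\<lambda>r. \<phi> r \<bullet> i) *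
        vapply A p (E i p) (\<lambda>q. vapply A q (E j q) f))"
proof -
  let ?O = "U \<inter> P \<inter> W"
  have P: "open P" by (rule chart_open[OF c(1)])
  have O: "open ?O" "p \<in> ?O" using U P f c by auto
  have y: "smooth_fun A ?O (\<lambda>q. vapply A q (Y q) (\<lambda>r. \<phi> r \<bullet> j))" for j
    by (rule smooth_fun_subset[OF vector_fieldD[OF Y P smooth_fun_chart[OF c(1) order_refl]]]) auto
  have e: "smooth_fun A ?O (\<lambda>q. vapply A q (E j q) f)" for j
    unfolding E_def by (rule smooth_fun_subset[OF smooth_vapply_coord_field[OF c(1) f(1,2)]]) auto
  have *: "vapply A p (X p) (\<lambda>q. vapply A q (Y q) f) =
      vapply A p (X p) (\<lambda>q. \<Sum>j\<in>Basis. vapply A q (Y q) (\<lambda>r. \<phi> r \<bullet> j) * vapply A q (E j q) f)"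
    unfolding E_def by (rule vapply_cong[OF O]) (use vapply_coord_expansion[OF c(1) _ f(1,2)] in auto)
  have h: "vapply A p (X p) (\<lambda>q. vapply A q (E j q) f) =
      (\<Sum>i\<in>Basis. vapply A p (X p) (\<lambda>r. \<phi> r \<bullet> i) * vapply A p (E i p) (\<lambda>q. vapply A q (E j q) f))" for j
    unfolding E_def by (rule vapply_coord_expansion[OF c e[unfolded E_def] O])
  show ?thesis
    unfolding * by (simp add: vapply_sum[OF smooth_fun_mult[OF O(1) y e] O] vapply_mult[OF y e O] h
        sum.distrib sum_distrib_left mult.assoc)
qed

text \<open>By the preceding expansion the commutator of \<open>X\<close> and \<open>Y\<close> is a first order operator, and its
  coefficients define the bracket.\<close>

lemma lie_bracket_exists:
  assumes "vector_field A U X" "vector_field A U Y" "open U" "p \<in> U"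
  shows "\<exists>v. \<forall>V f. open V \<and> p \<in> V \<and> smooth_fun A V f \<longrightarrow>
     vapply A p v f = vapply A p (X p) (\<lambda>q. vapply A q (Y q) f) - vapply A p (Y p) (\<lambda>q. vapply A q (X q) f)"
proof -
  obtain P \<phi> where c: "(P, \<phi>) \<in> A" "p \<in> P" by (rule chart_exists)
  define E where "E = (\<lambda>i q. coord_field (P, \<phi>) i q)"
  define d where "d = (\<lambda>j. vapply A p (X p) (\<lambda>q. vapply A q (Y q) (\<lambda>r. \<phi> r \<bullet> j)) -
      vapply A p (Y p) (\<lambda>q. vapply A q (X q) (\<lambda>r. \<phi> r \<bullet> j)))"
  show ?thesis
  proof (intro exI[of _ "\<Sum>j\<in>Basis. d j *\<^sub>R E j p"] allI impI, elim conjE)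
    fix V f assume V: "open V" "p \<in> V" "smooth_fun A V f"
    note lin = vapply_linear[OF V(3,1,2)]
    let ?x = "\<lambda>i. vapply A p (X p) (\<lambda>r. \<phi> r \<bullet> i)" and ?y = "\<lambda>i. vapply A p (Y p) (\<lambda>r. \<phi> r \<bullet> i)"
      and ?h = "\<lambda>i j. vapply A p (E i p) (\<lambda>q. vapply A q (E j q) f)"
    have "?h i j = ?h j i" for i j
      unfolding E_def by (rule coord_field_commute[OF c V(3,1,2)])
    then have "(\<Sum>j\<in>Basis. \<Sum>i\<in>Basis. ?y j * ?x i * ?h i j) = (\<Sum>j\<in>Basis. \<Sum>i\<in>Basis. ?x j * ?y i * ?h i j)"
      by (subst sum.swap) (simp add: mult_ac)
    moreover have "vapply A p (\<Sum>j\<in>Basis. d j *\<^sub>R E j p) f = (\<Sum>j\<in>Basis. d j * vapply A p (E j p) f)"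
      by (simp add: linear_sum[OF lin] linear_cmul[OF lin])
    ultimately show "vapply A p (\<Sum>j\<in>Basis. d j *\<^sub>R E j p) f =
        vapply A p (X p) (\<lambda>q. vapply A q (Y q) f) - vapply A p (Y p) (\<lambda>q. vapply A q (X q) f)"
      using vapply_twice[OF assms c V(3,1,2)] vapply_twice[OF assms(2,1,3,4) c V(3,1,2)]
      by (simp add: d_def E_def left_diff_distrib sum_subtractf)
  qed
qed

text \<open>Testing on the coordinate functions of a chart shows that at most one vector has the
  defining property of the bracket.\<close>

lemma lie_bracket_eqI:
  assumes "\<And>V f. open V \<Longrightarrow> p \<in> V \<Longrightarrow> smooth_fun A V f \<Longrightarrow>
     vapply A p v f = vapply A p (X p) (\<lambda>q. vapply A q (Y q) f) - vapply A p (Y p) (\<lambda>q. vapply A q (X q) f)"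
  shows "lie_bracket A X Y p = v"
  unfolding lie_bracket_def
proof (rule the_equality)
  obtain P \<phi> where c: "(P, \<phi>) \<in> A" "p \<in> P" by (rule chart_exists)
  fix w assume w: "\<forall>V f. open V \<and> p \<in> V \<and> smooth_fun A V f \<longrightarrow>
     vapply A p w f = vapply A p (X p) (\<lambda>q. vapply A q (Y q) f) - vapply A p (Y p) (\<lambda>q. vapply A q (X q) f)"
  show "w = v"
  proof (rule tangent_eqI[OF c])
    fix i
    show "vapply A p w (\<lambda>r. \<phi> r \<bullet> i) = vapply A p v (\<lambda>r. \<phi> r \<bullet> i)"
      using w[rule_format, OF conjI[OF chart_open[OF c(1)] conjI[OF c(2) smooth_fun_chart[OF c(1) order_refl]]]]
        assms[OF chart_open[OF c(1)] c(2) smooth_fun_chart[OF c(1) order_refl]] by metis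
  qed
qed (use assms in blast)

lemma vapply_lie_bracket:
  assumes "vector_field A U X" "vector_field A U Y" "open U" "p \<in> U" "smooth_fun A V f" "open V" "p \<in> V"
  shows "vapply A p (lie_bracket A X Y p) f =
     vapply A p (X p) (\<lambda>q. vapply A q (Y q) f) - vapply A p (Y p) (\<lambda>q. vapply A q (X q) f)"
proof -
  obtain v where v: "\<And>V f. open V \<Longrightarrow> p \<in> V \<Longrightarrow> smooth_fun A V f \<Longrightarrow>
     vapply A p v f = vapply A p (X p) (\<lambda>q. vapply A q (Y q) f) - vapply A p (Y p) (\<lambda>q. vapply A q (X q) f)"
    using lie_bracket_exists[OF assms(1-4)] by blast
  then have "lie_bracket A X Y p = v" by (intro lie_bracket_eqI)
  with v assms(5-7) show ?thesis by simp
qed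

lemma lie_bracket_vector_field:
  assumes X: "vector_field A U X" and Y: "vector_field A U Y" and U: "open U"
  shows "vector_field A U (lie_bracket A X Y)"
proof (rule vector_fieldI)
  fix V f assume V: "open V" "smooth_fun A V f"
  have o: "open (U \<inter> V)" using U V by auto
  have XY: "smooth_fun A (U \<inter> V) (\<lambda>q. vapply A q (X q) (\<lambda>r. vapply A r (Y r) f))"
    using vector_fieldD[OF X o vector_fieldD[OF Y V]] by (simp add: Int_absorb1)
  have YX: "smooth_fun A (U \<inter> V) (\<lambda>q. vapply A q (Y q) (\<lambda>r. vapply A r (X r) f))"
    using vector_fieldD[OF Y o vector_fieldD[OF X V]] by (simp add: Int_absorb1)
  show "smooth_fun A (U \<inter> V) (\<lambda>q. vapply A q (lie_bracket A X Y q) f)"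
    by (rule smooth_fun_cong[OF o _ smooth_fun_diff[OF o XY YX]]) (use vapply_lie_bracket[OF X Y U] V in auto)
qed

lemma lie_bracket_coord_field:
  assumes "(U, \<phi>) \<in> A" "q \<in> U"
  shows "lie_bracket A (coord_field (U, \<phi>) v) (coord_field (U, \<phi>) w) q = 0"
proof (rule lie_bracket_eqI)
  fix V f assume V: "open V" "q \<in> V" "smooth_fun A V f"
  show "vapply A q 0 f = vapply A q (coord_field (U, \<phi>) v q) (\<lambda>q. vapply A q (coord_field (U, \<phi>) w q) f)
      - vapply A q (coord_field (U, \<phi>) w q) (\<lambda>q. vapply A q (coord_field (U, \<phi>) v q) f)"
    using coord_field_commute[OF assms V(3,1,2), of v w] linear_0[OF vapply_linear[OF V(3,1,2)]] by simp
qed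

end

section \<open>Covariant derivatives along a map\<close>

locale covariant_derivative = manifold_map A B F
  for A :: "('p::topological_space, 'a::euclidean_space) chart set"
    and B :: "('q::topological_space, 'b::euclidean_space) chart set"
    and F +
  fixes D :: "('p \<Rightarrow> 'a) \<Rightarrow> ('p \<Rightarrow> 'b) \<Rightarrow> 'p \<Rightarrow> 'b"
  assumes D: "covariant_derivative_along A B F D"
begin

context
  fixes U X
  assumes U: "open U" and X: "vector_field A U X"
begin

lemma D_field: "field_along A B F U W \<Longrightarrow> field_along A B F U (D X W)"
  using D U X M.smooth_fun_const[of U 0] unfolding covariant_derivative_along_def by blast

lemma D_local:
  assumes "field_along A B F U V" "field_along A B F U W" "vector_field A U Y"
    "\<And>q. q \<in> U \<Longrightarrow> X q = Y q" "\<And>q. q \<in> U \<Longrightarrow> V q = W q" "p \<in> U"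
  shows "D X V p = D Y W p"
  using D U X M.smooth_fun_const[of U 0] assms unfolding covariant_derivative_along_def by blast

lemma D_add_left:
  assumes "vector_field A U Y" "field_along A B F U W" "p \<in> U"
  shows "D (\<lambda>q. X q + Y q) W p = D X W p + D Y W p"
  using D U X M.smooth_fun_const[of U 0] assms unfolding covariant_derivative_along_def by blast

lemma D_scale_left:
  assumes "smooth_fun A U f" "field_along A B F U W" "p \<in> U"
  shows "D (\<lambda>q. f q *\<^sub>R X q) W p = f p *\<^sub>R D X W p"
  using D U X assms unfolding covariant_derivative_along_def by blast

lemma D_add:
  assumes "field_along A B F U V" "field_along A B F U W" "p \<in> U"
  shows "D X (\<lambda>q. V q + W q) p = D X V p + D X W p"
  using D U X M.smooth_fun_const[of U 0] assms unfolding covariant_derivative_along_def by blast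

lemma D_scale:
  assumes "smooth_fun A U f" "field_along A B F U W" "p \<in> U"
  shows "D X (\<lambda>q. f q *\<^sub>R W q) p = vapply A p (X p) f *\<^sub>R W p + f p *\<^sub>R D X W p"
  using D U X assms unfolding covariant_derivative_along_def by blast

lemma D_zero: "p \<in> U \<Longrightarrow> D X (\<lambda>q. 0) p = 0"
  using D_scale[OF M.smooth_fun_const[of U 0] field_along_zero, of p] by (simp add: M.vapply_const)

lemma D_zero_left: "p \<in> U \<Longrightarrow> field_along A B F U W \<Longrightarrow> D (\<lambda>q. 0) W p = 0"
  using D_scale_left[OF M.smooth_fun_const[of U 0], of W p] by simp

lemma D_diff:
  assumes "field_along A B F U V" "field_along A B F U W" "p \<in> U"
  shows "D X (\<lambda>q. V q - W q) p = D X V p - D X W p"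
  using D_add[OF assms(1) field_along_scale[OF U assms(2) M.smooth_fun_const[of _ "- 1"]] assms(3)]
    D_scale[OF M.smooth_fun_const[of U "- 1"] assms(2,3)] by (simp add: M.vapply_const)

lemma D_sum:
  assumes "\<And>i. i \<in> I \<Longrightarrow> smooth_fun A U (w i)" "\<And>i. i \<in> I \<Longrightarrow> field_along A B F U (W i)" "p \<in> U"
  shows "D X (\<lambda>q. \<Sum>i\<in>I. w i q *\<^sub>R W i q) p =
    (\<Sum>i\<in>I. vapply A p (X p) (w i) *\<^sub>R W i p + w i p *\<^sub>R D X (W i) p)"
  using assms(1,2)
proof (induction I rule: infinite_finite_induct)
  case (insert i I)
  then have "field_along A B F U (\<lambda>q. \<Sum>i\<in>I. w i q *\<^sub>R W i q)"
    by (intro field_along_sum[OF U]) auto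
  with insert show ?case
    using D_add[of "\<lambda>q. w i q *\<^sub>R W i q" "\<lambda>q. \<Sum>i\<in>I. w i q *\<^sub>R W i q" p]
      field_along_scale[OF U, of "W i" "w i"] assms(3) D_scale[of "w i" "W i" p] by simp
qed (simp_all add: D_zero assms(3))

end

lemma D_sum_left:
  assumes U: "open U" and "\<And>i. i \<in> I \<Longrightarrow> vector_field A U (X i)" "field_along A B F U W" "p \<in> U"
  shows "D (\<lambda>q. \<Sum>i\<in>I. x i *\<^sub>R X i q) W p = (\<Sum>i\<in>I. x i *\<^sub>R D (X i) W p)"
  using assms(2)
proof (induction I rule: infinite_finite_induct)
  case (insert i I)
  have v: "vector_field A U (\<lambda>q. \<Sum>i\<in>I. x i *\<^sub>R X i q)"
    using M.self.field_along_sum[OF U, of I X "\<lambda>i q. x i"] insert.prems M.smooth_fun_const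
    by (simp add: vector_field_def)
  have vi: "vector_field A U (X i)" using insert.prems by simp
  have xi: "vector_field A U (\<lambda>q. x i *\<^sub>R X i q)"
    using M.self.field_along_scale[OF U, of "X i" "\<lambda>q. x i"] vi M.smooth_fun_const
    by (simp add: vector_field_def)
  from insert show ?case
    using D_add_left[OF U xi v assms(3,4)] D_scale_left[OF U vi M.smooth_fun_const assms(3,4), of "x i"] by simp
qed (simp_all add: D_zero_left[OF U M.self.field_along_zero[folded vector_field_def] assms(4,3)])

definition curvature_along :: "('p \<Rightarrow> 'a) \<Rightarrow> ('p \<Rightarrow> 'a) \<Rightarrow> ('p \<Rightarrow> 'b) \<Rightarrow> 'p \<Rightarrow> 'b" where
  "curvature_along X Y W p = D X (D Y W) p - D Y (D X W) p - D (lie_bracket A X Y) W p"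

context
  fixes U X Y
  assumes U: "open U" and X: "vector_field A U X" and Y: "vector_field A U Y"
begin

lemma curvature_along_cong:
  assumes "field_along A B F U V" "\<And>q. q \<in> U \<Longrightarrow> V q = W q" "p \<in> U"
  shows "curvature_along X Y V p = curvature_along X Y W p"
proof -
  have W: "field_along A B F U W" by (rule field_along_cong[OF U assms(2,1)])
  note Z = M.lie_bracket_vector_field[OF X Y U]
  have "D Z V q = D Z W q" if "vector_field A U Z" "q \<in> U" for Z q
    using D_local[OF U that(1) assms(1) W that(1)] assms(2) that by blast
  then show ?thesis
    unfolding curvature_along_def
    using D_local[OF U X D_field[OF U Y assms(1)] D_field[OF U Y W] X]
      D_local[OF U Y D_field[OF U X assms(1)] D_field[OF U X W] Y] X Y Z assms(3) by simp
qed

lemma curvature_along_add: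
  assumes V: "field_along A B F U V" and W: "field_along A B F U W" and p: "p \<in> U"
  shows "curvature_along X Y (\<lambda>q. V q + W q) p = curvature_along X Y V p + curvature_along X Y W p"
proof -
  have "D X (D Y (\<lambda>q. V q + W q)) p = D X (D Y V) p + D X (D Y W) p"
    if X: "vector_field A U X" and Y: "vector_field A U Y" for X Y
  proof -
    have "D X (D Y (\<lambda>q. V q + W q)) p = D X (\<lambda>q. D Y V q + D Y W q) p"
      using D_add[OF U Y V W]
      by (intro D_local[OF U X D_field[OF U Y] _ X]) (auto intro!: field_along_add U V W D_field[OF U Y] p)
    then show ?thesis
      using D_add[OF U X D_field[OF U Y V] D_field[OF U Y W] p] by simp
  qed
  then show ?thesis
    unfolding curvature_along_def using X Y D_add[OF U M.lie_bracket_vector_field[OF X Y U] V W p] by simp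
qed

text \<open>Tensoriality in the third argument: the first derivatives of \<open>w\<close> cancel by antisymmetry and the second
  derivatives cancel against the bracket term.\<close>

lemma curvature_along_scale:
  assumes w: "smooth_fun A U w" and W: "field_along A B F U W" and p: "p \<in> U"
  shows "curvature_along X Y (\<lambda>q. w q *\<^sub>R W q) p = w p *\<^sub>R curvature_along X Y W p"
proof -
  have *: "D X (D Y (\<lambda>q. w q *\<^sub>R W q)) p =
     vapply A p (X p) (\<lambda>q. vapply A q (Y q) w) *\<^sub>R W p + vapply A p (Y p) w *\<^sub>R D X W p
     + vapply A p (X p) w *\<^sub>R D Y W p + w p *\<^sub>R D X (D Y W) p"
    if X: "vector_field A U X" and Y: "vector_field A U Y" for X Y
  proof -
    have yw: "smooth_fun A U (\<lambda>q. vapply A q (Y q) w)"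
      using M.vector_fieldD[OF Y U w] by simp
    note f = field_along_scale[OF U W yw] field_along_scale[OF U D_field[OF U Y W] w]
    have "D X (D Y (\<lambda>q. w q *\<^sub>R W q)) p = D X (\<lambda>q. vapply A q (Y q) w *\<^sub>R W q + w q *\<^sub>R D Y W q) p"
      using D_scale[OF U Y w W]
      by (intro D_local[OF U X D_field[OF U Y field_along_scale[OF U W w]] field_along_add[OF U f] X]) (auto simp: p)
    then show ?thesis
      using D_add[OF U X f p] D_scale[OF U X yw W p] D_scale[OF U X w D_field[OF U Y W] p] by simp
  qed
  have lb: "vapply A p (lie_bracket A X Y p) w =
     vapply A p (X p) (\<lambda>q. vapply A q (Y q) w) - vapply A p (Y p) (\<lambda>q. vapply A q (X q) w)"
    by (rule M.vapply_lie_bracket[OF X Y U p w U p])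
  show ?thesis
    unfolding curvature_along_def *[OF X Y] *[OF Y X] D_scale[OF U M.lie_bracket_vector_field[OF X Y U] w W p] lb
    by (simp add: algebra_simps)
qed

lemma curvature_along_sum:
  assumes "\<And>i. i \<in> I \<Longrightarrow> smooth_fun A U (w i)" "\<And>i. i \<in> I \<Longrightarrow> field_along A B F U (W i)" and p: "p \<in> U"
  shows "curvature_along X Y (\<lambda>q. \<Sum>i\<in>I. w i q *\<^sub>R W i q) p = (\<Sum>i\<in>I. w i p *\<^sub>R curvature_along X Y (W i) p)"
  using assms(1,2)
proof (induction I rule: infinite_finite_induct)
  case (insert i I)
  then have "field_along A B F U (\<lambda>q. \<Sum>i\<in>I. w i q *\<^sub>R W i q)"
    by (intro field_along_sum[OF U]) auto
  with insert show ?case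
    using curvature_along_add[of "\<lambda>q. w i q *\<^sub>R W i q" "\<lambda>q. \<Sum>i\<in>I. w i q *\<^sub>R W i q" p]
      field_along_scale[OF U, of "W i" "w i"] p curvature_along_scale[of "w i" "W i" p] by simp
qed (use curvature_along_scale[OF M.smooth_fun_const[of U 0] field_along_zero p] in simp_all)

end

end

section \<open>The connection induced along a map by a Levi-Civita connection\<close>

locale pullback_connection = manifold_map A B F
  for A :: "('p::topological_space, 'a::euclidean_space) chart set"
    and B :: "('q::topological_space, 'b::euclidean_space) chart set"
    and F +
  fixes \<nu> :: nat and g :: "'q \<Rightarrow> 'b \<Rightarrow> 'b \<Rightarrow> real"
    and Db :: "('q \<Rightarrow> 'b) \<Rightarrow> ('q \<Rightarrow> 'b) \<Rightarrow> 'q \<Rightarrow> 'b"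
    and D :: "('p \<Rightarrow> 'a) \<Rightarrow> ('p \<Rightarrow> 'b) \<Rightarrow> 'p \<Rightarrow> 'b"
  assumes metric: "semi_riemannian_metric B \<nu> g"
    and levi_civita: "levi_civita B g Db"
    and induced: "induced_covariant_derivative A B F Db D"

sublocale pullback_connection \<subseteq> covariant_derivative A B F D
  using induced by unfold_locales (simp add: induced_covariant_derivative_def)

sublocale pullback_connection \<subseteq> Db: covariant_derivative B B "\<lambda>p. p" Db
  using levi_civita by unfold_locales (simp add: levi_civita_def)

context pullback_connection
begin

abbreviation dF :: "'p \<Rightarrow> 'a \<Rightarrow> 'b" where "dF \<equiv> tangent_map A B F"

lemma g_linear_left: "linear (\<lambda>v. g r v w)" and g_linear_right: "linear (g r v)"
  using metric by (auto simp: semi_riemannian_metric_def bilinear_def)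

lemma g_sym: "g r v w = g r w v"
  using metric by (auto simp: semi_riemannian_metric_def)

lemma g_nondegenerate: "(\<And>w. g r v w = 0) \<Longrightarrow> v = 0"
  using metric unfolding semi_riemannian_metric_def by blast

lemmas g_simps =
  linear_add[OF g_linear_left] linear_add[OF g_linear_right]
  linear_diff[OF g_linear_left] linear_diff[OF g_linear_right]
  linear_cmul[OF g_linear_left] linear_cmul[OF g_linear_right]
  linear_0[OF g_linear_left] linear_0[OF g_linear_right]
  linear_sum[OF g_linear_left] linear_sum[OF g_linear_right]

lemma g_smooth: "open V \<Longrightarrow> vector_field B V X \<Longrightarrow> vector_field B V Y \<Longrightarrow> smooth_fun B V (\<lambda>r. g r (X r) (Y r))"
  using metric unfolding semi_riemannian_metric_def by blast

lemma Db_metric: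
  assumes "open V" "vector_field B V X" "vector_field B V Y" "vector_field B V Z" "r \<in> V"
  shows "vapply B r (X r) (\<lambda>r. g r (Y r) (Z r)) = g r (Db X Y r) (Z r) + g r (Y r) (Db X Z r)"
  using levi_civita assms unfolding levi_civita_def by blast

lemma Db_torsion_free:
  assumes "open V" "vector_field B V X" "vector_field B V Y" "r \<in> V"
  shows "Db X Y r - Db Y X r = lie_bracket B X Y r"
  using levi_civita assms unfolding levi_civita_def by blast

lemma D_restrict:
  assumes "open U" "open V" "vector_field A U X" "vector_field B V X'" "vector_field B V Y" "p \<in> U" "F p \<in> V"
    "X' (F p) = dF p (X p)"
  shows "D X (\<lambda>q. Y (F q)) p = Db X' Y (F p)"
  using induced assms unfolding induced_covariant_derivative_def by blast

context
  fixes V \<psi> assumes c: "(V, \<psi>) \<in> B"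
begin

abbreviation (input) frame :: "'b \<Rightarrow> 'q \<Rightarrow> 'b" where "frame \<equiv> N.coord_field (V, \<psi>)"

abbreviation (input) cmp :: "('p \<Rightarrow> 'a) \<Rightarrow> 'b \<Rightarrow> 'p \<Rightarrow> real" where
  "cmp X \<equiv> component \<psi> (\<lambda>q. dF q (X q))"

lemma dom_open: "open V" by (rule N.chart_open[OF c])

lemma frame_field: "vector_field B V (frame i)" by (rule N.coord_field_vector_field[OF c])

text \<open>The derivative of a restricted field only sees the value of the direction at the point, so the
  direction may be replaced by a combination of coordinate fields with constant coefficients.\<close>

lemma D_restrict_frame:
  assumes "open U" "vector_field A U X" "vector_field B V Y" "p \<in> U" "F p \<in> V"
  shows "D X (\<lambda>q. Y (F q)) p = (\<Sum>j\<in>Basis. cmp X j p *\<^sub>R Db (frame j) Y (F p))"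
proof -
  let ?X' = "\<lambda>r. \<Sum>j\<in>Basis. cmp X j p *\<^sub>R frame j r"
  have "vector_field B V ?X'"
    using N.self.field_along_sum[OF dom_open, of Basis frame "\<lambda>j r. cmp X j p"] frame_field N.smooth_fun_const
    by (simp add: vector_field_def)
  moreover have "?X' (F p) = dF p (X p)"
    using component_expansion[OF c assms(5), of "\<lambda>q. dF q (X q)"] by simp
  ultimately have "D X (\<lambda>q. Y (F q)) p = Db ?X' Y (F p)"
    using assms dom_open by (intro D_restrict[of U V]) auto
  also have "\<dots> = (\<Sum>j\<in>Basis. cmp X j p *\<^sub>R Db (frame j) Y (F p))"
    by (rule Db.D_sum_left[folded vector_field_def, OF dom_open frame_field assms(3,5)])
  finally show ?thesis .
qed

lemma D_expansion:
  assumes U: "open U" "U \<subseteq> F -` V" and X: "vector_field A U X" and W: "field_along A B F U W" and p: "p \<in> U"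
  shows "D X W p = (\<Sum>a\<in>Basis. vapply A p (X p) (component \<psi> W a) *\<^sub>R frame a (F p)) +
    (\<Sum>a\<in>Basis. \<Sum>b\<in>Basis. (component \<psi> W a p * cmp X b p) *\<^sub>R Db (frame b) (frame a) (F p))"
proof -
  have w: "smooth_fun A U (component \<psi> W a)" for a by (rule component_smooth[OF W c U(2)])
  have e: "field_along A B F U (\<lambda>q. frame a (F q))" for a by (rule coord_field_along[OF c U(2)])
  have "D X W p = D X (\<lambda>q. \<Sum>a\<in>Basis. component \<psi> W a q *\<^sub>R frame a (F q)) p"
    using component_expansion[OF c, of _ W] U(2)
    by (intro D_local[OF U(1) X W field_along_sum[OF U(1) e w] X _ _ p]) auto
  also have "\<dots> = (\<Sum>a\<in>Basis. vapply A p (X p) (component \<psi> W a) *\<^sub>R frame a (F p)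
      + component \<psi> W a p *\<^sub>R D X (\<lambda>q. frame a (F q)) p)"
    by (rule D_sum[OF U(1) X w e p])
  finally have *: "D X W p = (\<Sum>a\<in>Basis. vapply A p (X p) (component \<psi> W a) *\<^sub>R frame a (F p)
      + component \<psi> W a p *\<^sub>R D X (\<lambda>q. frame a (F q)) p)" .
  have "D X (\<lambda>q. frame a (F q)) p = (\<Sum>b\<in>Basis. cmp X b p *\<^sub>R Db (frame b) (frame a) (F p))" for a
    by (rule D_restrict_frame[OF U(1) X frame_field p]) (use U(2) p in auto)
  then show ?thesis
    unfolding * by (simp add: sum.distrib scaleR_sum_right)
qed

lemma Db_frame_commute: "r \<in> V \<Longrightarrow> Db (frame b) (frame a) r = Db (frame a) (frame b) r"
  using Db_torsion_free[OF dom_open frame_field frame_field, of r b a] N.lie_bracket_coord_field[OF c, of r b a] by simp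

text \<open>The components of \<open>dF X\<close> are the derivatives along \<open>X\<close> of the ambient coordinate functions composed with
  \<open>F\<close>, so the components of \<open>dF [X,Y]\<close> come from the definition of the bracket on functions.\<close>

lemma cmp_lie_bracket:
  assumes U: "open U" "U \<subseteq> F -` V" and X: "vector_field A U X" and Y: "vector_field A U Y" and p: "p \<in> U"
  shows "cmp (lie_bracket A X Y) a p = vapply A p (X p) (cmp Y a) - vapply A p (Y p) (cmp X a)"
proof -
  have s: "smooth_fun A U (\<lambda>r. \<psi> (F r) \<bullet> a)"
    by (rule M.smooth_fun_subset[OF smooth_fun_pullback[OF open_UNIV dom_open N.smooth_fun_chart[OF c order_refl]]])
      (use U(2) in auto)
  have e: "vapply A p (Z p) (cmp Z' a) = vapply A p (Z p) (\<lambda>q. vapply A q (Z' q) (\<lambda>r. \<psi> (F r) \<bullet> a))" for Z Z'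
    using U(2) by (intro M.vapply_cong[OF U(1) p] component_tangent_map[OF c]) auto
  have "cmp (lie_bracket A X Y) a p = vapply A p (lie_bracket A X Y p) (\<lambda>r. \<psi> (F r) \<bullet> a)"
    using U(2) p by (intro component_tangent_map[OF c]) auto
  then show ?thesis
    using M.vapply_lie_bracket[OF X Y U(1) p s U(1) p] e by simp
qed

end

text \<open>Both derivatives are expanded in a coordinate frame.  The terms with Christoffel symbols are symmetric
  because coordinate fields commute and the ambient connection is torsion free; what remains is the
  expansion of the bracket.\<close>

lemma D_torsion_free:
  assumes U: "open U" and X: "vector_field A U X" and Y: "vector_field A U Y" and p: "p \<in> U"
  shows "D X (\<lambda>q. dF q (Y q)) p - D Y (\<lambda>q. dF q (X q)) p = dF p (lie_bracket A X Y p)"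
proof -
  obtain V \<psi> where c: "(V, \<psi>) \<in> B" "F p \<in> V" by (rule N.chart_exists)
  let ?U = "U \<inter> F -` V"
  have U': "open ?U" "?U \<subseteq> F -` V" "p \<in> ?U"
    using U vimage_open[OF dom_open[OF c(1)]] p c by auto
  have XY: "vector_field A ?U X" "vector_field A ?U Y"
    using X Y M.vector_field_subset by blast+
  define E where "E = N.coord_field (V, \<psi>)"
  define x where "x = component \<psi> (\<lambda>q. dF q (X q))"
  define y where "y = component \<psi> (\<lambda>q. dF q (Y q))"
  have "(\<Sum>a\<in>Basis. \<Sum>b\<in>Basis. (y a p * x b p) *\<^sub>R Db (E b) (E a) (F p)) =
      (\<Sum>a\<in>Basis. \<Sum>b\<in>Basis. (x a p * y b p) *\<^sub>R Db (E b) (E a) (F p))"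
    by (subst sum.swap) (simp add: E_def Db_frame_commute[OF c] mult.commute)
  moreover have "dF p (lie_bracket A X Y p) =
      (\<Sum>a\<in>Basis. (vapply A p (X p) (y a) - vapply A p (Y p) (x a)) *\<^sub>R E a (F p))"
    using component_expansion[OF c, of "\<lambda>q. dF q (lie_bracket A X Y q)"]
      cmp_lie_bracket[OF c(1) U'(1,2) XY U'(3)] by (simp add: x_def y_def E_def)
  ultimately show ?thesis
    using D_expansion[OF c(1) U'(1,2) XY(1) field_along_tangent_map[OF U'(1) XY(2)] U'(3)]
      D_expansion[OF c(1) U'(1,2) XY(2) field_along_tangent_map[OF U'(1) XY(1)] U'(3)]
    by (simp add: x_def y_def E_def scaleR_left_diff_distrib sum_subtractf)
qed

lemma g_frame_smooth:
  assumes "(V, \<psi>) \<in> B" "U \<subseteq> F -` V"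
  shows "smooth_fun A U (\<lambda>q. g (F q) (N.coord_field (V, \<psi>) i (F q)) (N.coord_field (V, \<psi>) j (F q)))"
  using smooth_fun_pullback[OF open_UNIV dom_open[OF assms(1)] g_smooth[OF dom_open frame_field frame_field, OF assms(1) assms(1) assms(1), of i j]]
  by (rule M.smooth_fun_subset) (use assms(2) in auto)

lemma g_along_smooth:
  assumes U: "open U" and W: "field_along A B F U W" and Z: "field_along A B F U Z"
  shows "smooth_fun A U (\<lambda>q. g (F q) (W q) (Z q))"
proof (rule M.smooth_fun_local[OF _ U])
  fix p assume p: "p \<in> U"
  obtain V \<psi> where c: "(V, \<psi>) \<in> B" "F p \<in> V" by (rule N.chart_exists)
  let ?U = "U \<inter> F -` V"
  have U': "open ?U" "?U \<subseteq> F -` V" "p \<in> ?U"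
    using U vimage_open[OF dom_open[OF c(1)]] p c by auto
  define E where "E = N.coord_field (V, \<psi>)"
  have w: "smooth_fun A ?U (component \<psi> Y a)" if "field_along A B F U Y" for Y a
    by (rule component_smooth[OF field_along_subset[OF that] c(1) U'(2)]) auto
  have sm: "smooth_fun A ?U (\<lambda>q. \<Sum>a\<in>Basis. \<Sum>b\<in>Basis.
      component \<psi> W a q * (component \<psi> Z b q * g (F q) (E a (F q)) (E b (F q))))"
    unfolding E_def
    by (intro M.smooth_fun_sum[OF U'(1)] M.smooth_fun_mult[OF U'(1)] w W Z g_frame_smooth[OF c(1) U'(2)])
  have eq: "(\<Sum>a\<in>Basis. \<Sum>b\<in>Basis.
      component \<psi> W a q * (component \<psi> Z b q * g (F q) (E a (F q)) (E b (F q)))) = g (F q) (W q) (Z q)"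
    if "q \<in> ?U" for q
    using component_expansion[OF c(1), of q W] component_expansion[OF c(1), of q Z] that
    by (simp add: E_def g_simps sum_distrib_left mult_ac) (rule sum.swap)
  show "\<exists>W'. open W' \<and> p \<in> W' \<and> smooth_fun A W' (\<lambda>q. g (F q) (W q) (Z q))"
    using U'(1,3) M.smooth_fun_cong[OF U'(1) eq sm] by blast
qed

text \<open>Used in each argument of the metric to pass from a frame to arbitrary fields.\<close>

lemma D_metric_sum:
  assumes U: "open U" and X: "vector_field A U X" and p: "p \<in> U"
    and W: "\<And>i. i \<in> I \<Longrightarrow> field_along A B F U (W i)" and w: "\<And>i. i \<in> I \<Longrightarrow> smooth_fun A U (w i)"
    and Z: "field_along A B F U Z"
    and m: "\<And>i. i \<in> I \<Longrightarrow> vapply A p (X p) (\<lambda>q. g (F q) (W i q) (Z q)) =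
      g (F p) (D X (W i) p) (Z p) + g (F p) (W i p) (D X Z p)"
  shows "vapply A p (X p) (\<lambda>q. g (F q) (\<Sum>i\<in>I. w i q *\<^sub>R W i q) (Z q)) =
      g (F p) (D X (\<lambda>q. \<Sum>i\<in>I. w i q *\<^sub>R W i q) p) (Z p) + g (F p) (\<Sum>i\<in>I. w i p *\<^sub>R W i p) (D X Z p)"
proof -
  have "vapply A p (X p) (\<lambda>q. g (F q) (\<Sum>i\<in>I. w i q *\<^sub>R W i q) (Z q)) =
      vapply A p (X p) (\<lambda>q. \<Sum>i\<in>I. w i q * g (F q) (W i q) (Z q))"
    by (simp add: g_simps)
  also have "\<dots> = (\<Sum>i\<in>I. vapply A p (X p) (\<lambda>q. w i q * g (F q) (W i q) (Z q)))"
    by (intro M.vapply_sum[OF _ U p] M.smooth_fun_mult[OF U] w g_along_smooth U W Z)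
  also have "\<dots> = (\<Sum>i\<in>I. w i p * (g (F p) (D X (W i) p) (Z p) + g (F p) (W i p) (D X Z p))
      + vapply A p (X p) (w i) * g (F p) (W i p) (Z p))"
    by (intro sum.cong refl) (simp add: M.vapply_mult[OF w g_along_smooth[OF U W Z] U p] m)
  finally show ?thesis
    by (simp add: D_sum[OF U X w W p] g_simps sum.distrib algebra_simps)
qed

text \<open>For two restricted coordinate fields this is the ambient product rule.  Expanding first one and then the
  other argument in the coordinate frame gives the general case.\<close>

lemma D_metric:
  assumes U: "open U" and X: "vector_field A U X" and p: "p \<in> U"
    and W: "field_along A B F U W" and Z: "field_along A B F U Z"
  shows "vapply A p (X p) (\<lambda>q. g (F q) (W q) (Z q)) = g (F p) (D X W p) (Z p) + g (F p) (W p) (D X Z p)"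
proof -
  obtain V \<psi> where c: "(V, \<psi>) \<in> B" "F p \<in> V" by (rule N.chart_exists)
  let ?U = "U \<inter> F -` V"
  have U': "open ?U" "?U \<subseteq> F -` V" "p \<in> ?U"
    using U vimage_open[OF dom_open[OF c(1)]] p c by auto
  have X': "vector_field A ?U X" using X M.vector_field_subset by blast
  define E where "E = N.coord_field (V, \<psi>)"
  define x where "x = component \<psi> (\<lambda>q. dF q (X q))"
  have w: "smooth_fun A ?U (component \<psi> Y a)" if "field_along A B F ?U Y" for Y a
    by (rule component_smooth[OF that c(1) U'(2)])
  have e: "field_along A B F ?U (\<lambda>q. E a (F q))" for a
    unfolding E_def by (rule coord_field_along[OF c(1) U'(2)])
  have exp: "(\<Sum>a\<in>Basis. component \<psi> Y a q *\<^sub>R E a (F q)) = Y q" if "q \<in> ?U" for Y q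
    using component_expansion[OF c(1), of q Y] that by (simp add: E_def)
  define comp where "comp W Z \<longleftrightarrow> vapply A p (X p) (\<lambda>q. g (F q) (W q) (Z q)) =
      g (F p) (D X W p) (Z p) + g (F p) (W p) (D X Z p)" for W Z
  have comp_sym: "comp Z W" if "comp W Z" for W Z
    using that unfolding comp_def by (simp add: g_sym add.commute)
  have frame: "comp (\<lambda>q. E a (F q)) (\<lambda>q. E b (F q))" for a b
  proof -
    have gs: "smooth_fun B V (\<lambda>r. g r (E a r) (E b r))"
      unfolding E_def by (rule g_smooth[OF dom_open frame_field frame_field]) (rule c)+
    have dx: "dF p (X p) = (\<Sum>j\<in>Basis. x j p *\<^sub>R E j (F p))"
      using exp[OF U'(3), of "\<lambda>q. dF q (X q)"] by (simp add: x_def)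
    note lin = N.vapply_linear[OF gs dom_open[OF c(1)] c(2)]
    have "vapply A p (X p) (\<lambda>q. g (F q) (E a (F q)) (E b (F q))) =
        vapply B (F p) (dF p (X p)) (\<lambda>r. g r (E a r) (E b r))"
      by (rule vapply_tangent_map[OF dom_open[OF c(1)] gs c(2), symmetric])
    also have "\<dots> = (\<Sum>j\<in>Basis. x j p * vapply B (F p) (E j (F p)) (\<lambda>r. g r (E a r) (E b r)))"
      unfolding dx by (simp add: linear_sum[OF lin] linear_cmul[OF lin])
    also have "\<dots> = (\<Sum>j\<in>Basis. x j p * (g (F p) (Db (E j) (E a) (F p)) (E b (F p))
        + g (F p) (E a (F p)) (Db (E j) (E b) (F p))))"
      unfolding E_def using Db_metric[OF dom_open frame_field frame_field frame_field, OF c(1) c(1) c(1) c(1) c(2)] by simp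
    finally show ?thesis
      using D_restrict_frame[OF c(1) U'(1) X' frame_field[OF c(1)] U'(3) c(2)]
      by (simp add: comp_def E_def x_def g_simps sum.distrib distrib_left)
  qed
  have expand: "comp W Z"
    if W: "field_along A B F ?U W" and Z: "field_along A B F ?U Z" and m: "\<And>a. comp (\<lambda>q. E a (F q)) Z" for W Z
  proof -
    have "D X (\<lambda>q. \<Sum>a\<in>Basis. component \<psi> W a q *\<^sub>R E a (F q)) p = D X W p"
      by (rule D_local[OF U'(1) X' field_along_sum[OF U'(1) e w[OF W]] W X' _ exp U'(3)]) simp
    moreover have "vapply A p (X p) (\<lambda>q. g (F q) (\<Sum>a\<in>Basis. component \<psi> W a q *\<^sub>R E a (F q)) (Z q)) =
        vapply A p (X p) (\<lambda>q. g (F q) (W q) (Z q))"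
      by (rule M.vapply_cong[OF U'(1,3)]) (simp add: exp)
    ultimately show ?thesis
      using D_metric_sum[where I = Basis and W = "\<lambda>a q. E a (F q)", OF U'(1) X' U'(3) e w[OF W] Z] m
        exp[OF U'(3), of W] by (simp add: comp_def)
  qed
  have WZ: "field_along A B F ?U W" "field_along A B F ?U Z"
    using W Z field_along_subset by blast+
  have "comp W Z"
    by (rule expand[OF WZ comp_sym[OF expand[OF WZ(2) e frame]]])
  then show ?thesis by (simp add: comp_def)
qed

text \<open>The curvature on a restricted coordinate field is computed from the expansion of the derivatives.
  The derivatives of the components of \<open>dF X\<close> and \<open>dF Y\<close> cancel against the bracket term, leaving
  the ambient curvature of coordinate fields, whose own bracket term is zero.\<close>

lemma curvature_along_frame:
  assumes c: "(V, \<psi>) \<in> B" and U: "open U" "U \<subseteq> F -` V"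
    and X: "vector_field A U X" and Y: "vector_field A U Y" and p: "p \<in> U"
  defines "E \<equiv> N.coord_field (V, \<psi>)"
  defines "x \<equiv> component \<psi> (\<lambda>q. dF q (X q))" and "y \<equiv> component \<psi> (\<lambda>q. dF q (Y q))"
  shows "curvature_along X Y (\<lambda>q. E a (F q)) p =
    (\<Sum>b\<in>Basis. \<Sum>d\<in>Basis. (y b p * x d p) *\<^sub>R
      (Db (E d) (Db (E b) (E a)) (F p) - Db (E b) (Db (E d) (E a)) (F p)))"
proof -
  have V: "open V" by (rule dom_open[OF c])
  have E: "vector_field B V (E i)" for i unfolding E_def by (rule frame_field[OF c])
  have e: "field_along A B F U (\<lambda>q. E a (F q))"
    unfolding E_def by (rule coord_field_along[OF c U(2)])
  have DE: "vector_field B V (Db (E b) (E a))" for b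
    using Db.D_field[folded vector_field_def, OF V E E] .
  have de: "field_along A B F U (\<lambda>q. Db (E b) (E a) (F q))" for b
    by (rule field_along_subset[OF field_along_restrict[OF V DE] U(2)])
  have first: "D Z (\<lambda>q. E a (F q)) q = (\<Sum>b\<in>Basis. component \<psi> (\<lambda>q. dF q (Z q)) b q *\<^sub>R Db (E b) (E a) (F q))"
    if "vector_field A U Z" "q \<in> U" for Z q
    using D_restrict_frame[OF c U(1) that(1) E that(2)] U(2) that(2) unfolding E_def by auto
  have second: "D X (D Y (\<lambda>q. E a (F q))) p =
      (\<Sum>b\<in>Basis. vapply A p (X p) (component \<psi> (\<lambda>q. dF q (Y q)) b) *\<^sub>R Db (E b) (E a) (F p)) +
      (\<Sum>b\<in>Basis. \<Sum>d\<in>Basis. (component \<psi> (\<lambda>q. dF q (Y q)) b p * component \<psi> (\<lambda>q. dF q (X q)) d p) *\<^sub>R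
        Db (E d) (Db (E b) (E a)) (F p))"
    if X: "vector_field A U X" and Y: "vector_field A U Y" for X Y
  proof -
    let ?y = "component \<psi> (\<lambda>q. dF q (Y q))"
    have y: "smooth_fun A U (?y b)" for b
      by (rule component_smooth[OF field_along_tangent_map[OF U(1) Y] c U(2)])
    have "D X (D Y (\<lambda>q. E a (F q))) p = D X (\<lambda>q. \<Sum>b\<in>Basis. ?y b q *\<^sub>R Db (E b) (E a) (F q)) p"
      by (rule D_local[OF U(1) X D_field[OF U(1) Y e] field_along_sum[OF U(1) de y] X _ first[OF Y] p]) simp
    also have "\<dots> = (\<Sum>b\<in>Basis. vapply A p (X p) (?y b) *\<^sub>R Db (E b) (E a) (F p)
        + ?y b p *\<^sub>R D X (\<lambda>q. Db (E b) (E a) (F q)) p)"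
      by (rule D_sum[OF U(1) X y de p])
    finally show ?thesis
      using D_restrict_frame[OF c U(1) X DE p] U(2) p
      by (simp add: sum.distrib scaleR_sum_right E_def subset_iff)
  qed
  have "(\<Sum>b\<in>Basis. \<Sum>d\<in>Basis. (x b p * y d p) *\<^sub>R Db (E d) (Db (E b) (E a)) (F p)) =
      (\<Sum>b\<in>Basis. \<Sum>d\<in>Basis. (y b p * x d p) *\<^sub>R Db (E b) (Db (E d) (E a)) (F p))"
    by (subst sum.swap) (simp add: mult.commute)
  moreover have "component \<psi> (\<lambda>q. dF q (lie_bracket A X Y q)) b p = vapply A p (X p) (y b) - vapply A p (Y p) (x b)" for b
    unfolding x_def y_def by (rule cmp_lie_bracket[OF c U X Y p])
  ultimately show ?thesis
    unfolding curvature_along_def second[OF X Y] second[OF Y X] first[OF M.lie_bracket_vector_field[OF X Y U(1)] p]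
    by (simp add: x_def y_def scaleR_left_diff_distrib scaleR_right_diff_distrib sum_subtractf)
qed

lemma curvature_along_constant_curvature:
  assumes cc: "has_constant_curvature B g Db k"
    and U: "open U" and X: "vector_field A U X" and Y: "vector_field A U Y"
    and W: "field_along A B F U W" and p: "p \<in> U"
  shows "curvature_along X Y W p = k *\<^sub>R (g (F p) (dF p (Y p)) (W p) *\<^sub>R dF p (X p) - g (F p) (dF p (X p)) (W p) *\<^sub>R dF p (Y p))"
proof -
  obtain V \<psi> where c: "(V, \<psi>) \<in> B" "F p \<in> V" by (rule N.chart_exists)
  let ?U = "U \<inter> F -` V"
  have V: "open V" by (rule dom_open[OF c(1)])
  have U': "open ?U" "?U \<subseteq> F -` V" "p \<in> ?U" using U vimage_open[OF V] p c by auto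
  have XY: "vector_field A ?U X" "vector_field A ?U Y"
    using X Y M.vector_field_subset by blast+
  have W': "field_along A B F ?U W" using W field_along_subset by blast
  define E where "E = N.coord_field (V, \<psi>)"
  have E: "vector_field B V (E i)" for i unfolding E_def by (rule frame_field[OF c(1)])
  define x where "x = component \<psi> (\<lambda>q. dF q (X q))"
  define y where "y = component \<psi> (\<lambda>q. dF q (Y q))"
  define w where "w = component \<psi> W"
  let ?R = "\<lambda>v. k *\<^sub>R (g (F p) (dF p (Y p)) v *\<^sub>R dF p (X p) - g (F p) (dF p (X p)) v *\<^sub>R dF p (Y p))"
  have exp: "(\<Sum>a\<in>Basis. component \<psi> Z a q *\<^sub>R E a (F q)) = Z q" if "q \<in> ?U" for Z q
    using component_expansion[OF c(1), of q Z] that by (simp add: E_def)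
  have dX: "dF p (X p) = (\<Sum>d\<in>Basis. x d p *\<^sub>R E d (F p))" and dY: "dF p (Y p) = (\<Sum>b\<in>Basis. y b p *\<^sub>R E b (F p))"
    unfolding x_def y_def by (rule exp[OF U'(3), symmetric])+
  have curvature_frame: "curvature_along X Y (\<lambda>q. E a (F q)) p = ?R (E a (F p))" for a
  proof -
    have "Db (E d) (Db (E b) (E a)) (F p) - Db (E b) (Db (E d) (E a)) (F p) =
        k *\<^sub>R (g (F p) (E b (F p)) (E a (F p)) *\<^sub>R E d (F p) - g (F p) (E d (F p)) (E a (F p)) *\<^sub>R E b (F p))" for b d
    proof -
      have "Db (lie_bracket B (E d) (E b)) (E a) (F p) = Db (\<lambda>r. 0) (E a) (F p)"
        using N.lie_bracket_coord_field[OF c(1)] N.lie_bracket_vector_field[OF E E V]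
          N.self.field_along_zero[of V]
        by (intro Db.D_local[folded vector_field_def, OF V _ E E _ _ _ c(2)]) (auto simp: E_def vector_field_def)
      also have "\<dots> = 0"
        using Db.D_zero_left[folded vector_field_def, OF V _ c(2) E] E by blast
      finally show ?thesis
        using cc[unfolded has_constant_curvature_def, rule_format, of V "E d" "E b" "E a" "F p"] V E c(2)
        by (simp add: curvature_def)
    qed
    then have "curvature_along X Y (\<lambda>q. E a (F q)) p = (\<Sum>b\<in>Basis. \<Sum>d\<in>Basis. (y b p * x d p) *\<^sub>R (
        k *\<^sub>R (g (F p) (E b (F p)) (E a (F p)) *\<^sub>R E d (F p) - g (F p) (E d (F p)) (E a (F p)) *\<^sub>R E b (F p))))"
      using curvature_along_frame[OF c(1) U'(1,2) XY U'(3), of a] by (simp add: E_def x_def y_def)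
    also have "\<dots> = k *\<^sub>R ((\<Sum>b\<in>Basis. \<Sum>d\<in>Basis. (y b p * g (F p) (E b (F p)) (E a (F p)) * x d p) *\<^sub>R E d (F p))
        - (\<Sum>b\<in>Basis. \<Sum>d\<in>Basis. (x d p * g (F p) (E d (F p)) (E a (F p)) * y b p) *\<^sub>R E b (F p)))"
      by (simp add: scaleR_sum_right sum_subtractf scaleR_right_diff_distrib mult_ac)
    also have "(\<Sum>b\<in>Basis. \<Sum>d\<in>Basis. (x d p * g (F p) (E d (F p)) (E a (F p)) * y b p) *\<^sub>R E b (F p)) =
        g (F p) (dF p (X p)) (E a (F p)) *\<^sub>R dF p (Y p)"
      unfolding dX dY by (simp add: g_simps scaleR_sum_left scaleR_sum_right sum_distrib_right)
    also have "(\<Sum>b\<in>Basis. \<Sum>d\<in>Basis. (y b p * g (F p) (E b (F p)) (E a (F p)) * x d p) *\<^sub>R E d (F p)) =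
        g (F p) (dF p (Y p)) (E a (F p)) *\<^sub>R dF p (X p)"
      unfolding dX dY by (simp add: g_simps scaleR_sum_left scaleR_sum_right sum_distrib_right) (rule sum.swap)
    finally show ?thesis .
  qed
  have w: "smooth_fun A ?U (w a)" for a
    unfolding w_def by (rule component_smooth[OF W' c(1) U'(2)])
  have e: "field_along A B F ?U (\<lambda>q. E a (F q))" for a
    unfolding E_def by (rule coord_field_along[OF c(1) U'(2)])
  have "curvature_along X Y W p = curvature_along X Y (\<lambda>q. \<Sum>a\<in>Basis. w a q *\<^sub>R E a (F q)) p"
    by (rule curvature_along_cong[OF U'(1) XY W' _ U'(3)]) (simp add: exp w_def)
  also have "\<dots> = (\<Sum>a\<in>Basis. w a p *\<^sub>R ?R (E a (F p)))"
    using curvature_along_sum[OF U'(1) XY w e U'(3)] by (simp add: curvature_frame)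
  also have "\<dots> = ?R (\<Sum>a\<in>Basis. w a p *\<^sub>R E a (F p))"
    by (simp add: g_simps scaleR_sum_left scaleR_sum_right sum_subtractf scaleR_right_diff_distrib mult_ac)
  also have "(\<Sum>a\<in>Basis. w a p *\<^sub>R E a (F p)) = W p"
    unfolding w_def by (rule exp[OF U'(3)])
  finally show ?thesis .
qed

end

section \<open>Immersions reflect smoothness of vector fields\<close>

lemma sum_Basis_vec:
  fixes f :: "real^'n::finite \<Rightarrow> 'b::comm_monoid_add"
  shows "(\<Sum>b\<in>Basis. f b) = (\<Sum>i\<in>UNIV. f (axis i 1))"
proof -
  have *: "(Basis :: (real^'n) set) = range (\<lambda>i. axis i 1)" by (auto simp: Basis_vec_def)
  have "inj (\<lambda>i. axis i 1 :: real^'n)" by (auto simp: inj_on_def axis_eq_axis)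
  then show ?thesis unfolding * by (simp add: sum.reindex)
qed

text \<open>Cramer's rule expresses the solution of a linear system by determinants, which are polynomials in the
  coefficients.\<close>

lemma (in manifold) matrix_solution_smooth:
  fixes G :: "'p \<Rightarrow> real^'n::finite^'n" and z :: "'p \<Rightarrow> real^'n"
  assumes "open U"
    and G: "\<And>i j. smooth_fun A U (\<lambda>q. G q $ i $ j)" "\<And>q. q \<in> U \<Longrightarrow> det (G q) \<noteq> 0"
    and t: "\<And>i. smooth_fun A U (\<lambda>q. (G q *v z q) $ i)"
  shows "smooth_fun A U (\<lambda>q. z q $ k)"
proof -
  have det: "smooth_fun A U (\<lambda>q. det (K q))" if "\<And>i j. smooth_fun A U (\<lambda>q. K q $ i $ j)"
    for K :: "'p \<Rightarrow> real^'n^'n"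
    unfolding det_def
    by (intro smooth_fun_sum smooth_fun_mult smooth_fun_const smooth_fun_prod that assms(1))
  let ?K = "\<lambda>q. (\<chi> i j. if j = k then (G q *v z q) $ i else G q $ i $ j) :: real^'n^'n"
  have "smooth_fun A U (\<lambda>q. ?K q $ i $ j)" for i j
    using G(1) t by (cases "j = k") auto
  then have "smooth_fun A U (\<lambda>q. det (?K q) * inverse (det (G q)))"
    by (intro smooth_fun_mult[OF assms(1)] smooth_fun_inverse[OF assms(1)] det G)
  then show ?thesis
    by (rule smooth_fun_cong[OF assms(1), rotated]) (simp add: cramer_lemma G(2))
qed

locale immersion_map = manifold_map A B F
  for A :: "('p::topological_space, real^'n::finite) chart set"
    and B :: "('q::topological_space, 'b::euclidean_space) chart set"
    and F +
  assumes inj_tangent_map: "inj (tangent_map A B F q)"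
begin

text \<open>The Jacobi matrix \<open>J\<close> of an immersion need not be square, but \<open>J\<^sup>T J\<close> is invertible:
  \<open>x \<bullet> J\<^sup>T J x\<close> is the sum of the squares of the entries of \<open>J x\<close>, and \<open>J\<close> is injective.\<close>

lemma gram_matrix_nonsingular:
  assumes P: "(P, \<phi>) \<in> A" "q \<in> P" and V: "(V, \<psi>) \<in> B" "F q \<in> V"
  defines "J \<equiv> \<lambda>a i. component \<psi> (\<lambda>q. tangent_map A B F q (M.coord_field (P, \<phi>) (axis i 1) q)) a q"
  shows "det (\<chi> i j. \<Sum>a\<in>Basis. J a i * J a j) \<noteq> 0"
proof -
  let ?G = "(\<chi> i j. \<Sum>a\<in>Basis. J a i * J a j) :: real^'n^'n"
  let ?T = "tangent_map A B F q" and ?e = "\<lambda>i. M.coord_field (P, \<phi>) (axis i 1) q"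
  have "x = 0" if x: "?G *v x = 0" for x
  proof -
    define s where "s = (\<lambda>a. \<Sum>j\<in>UNIV. J a j * x $ j)"
    have "(\<Sum>a\<in>Basis. s a * s a) = (\<Sum>i\<in>UNIV. x $ i * (?G *v x) $ i)"
    proof -
      have "(\<Sum>a\<in>Basis. s a * s a) = (\<Sum>a\<in>Basis. \<Sum>i\<in>UNIV. \<Sum>j\<in>UNIV. x $ i * (J a i * J a j * x $ j))"
        unfolding s_def by (simp add: sum_product mult_ac)
      also have "\<dots> = (\<Sum>i\<in>UNIV. \<Sum>a\<in>Basis. \<Sum>j\<in>UNIV. x $ i * (J a i * J a j * x $ j))"
        by (rule sum.swap)
      also have "\<dots> = (\<Sum>i\<in>UNIV. \<Sum>j\<in>UNIV. \<Sum>a\<in>Basis. x $ i * (J a i * J a j * x $ j))"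
        by (intro sum.cong refl sum.swap)
      also have "\<dots> = (\<Sum>i\<in>UNIV. x $ i * (?G *v x) $ i)"
        by (simp add: matrix_vector_mult_def sum_distrib_left sum_distrib_right)
      finally show ?thesis .
    qed
    with x have "(\<Sum>a\<in>Basis. s a * s a) = 0" by simp
    then have s: "s a = 0" if "a \<in> Basis" for a
      using that by (simp add: sum_nonneg_eq_0_iff)
    define v where "v = (\<Sum>j\<in>UNIV. x $ j *\<^sub>R ?e j)"
    have "?T v = (\<Sum>j\<in>UNIV. x $ j *\<^sub>R ?T (?e j))"
      unfolding v_def by (simp add: linear_sum[OF tangent_map_linear] linear_cmul[OF tangent_map_linear])
    also have "\<dots> = (\<Sum>j\<in>UNIV. \<Sum>a\<in>Basis. (x $ j * J a j) *\<^sub>R N.coord_field (V, \<psi>) a (F q))"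
      using component_expansion[OF V, of "\<lambda>q. tangent_map A B F q (M.coord_field (P, \<phi>) (axis _ 1) q)"]
      by (simp add: J_def scaleR_sum_right[symmetric] flip: scaleR_scaleR)
    also have "\<dots> = (\<Sum>a\<in>Basis. s a *\<^sub>R N.coord_field (V, \<psi>) a (F q))"
      by (subst sum.swap) (simp add: s_def scaleR_sum_left mult.commute)
    also have "\<dots> = ?T 0"
      by (simp add: s linear_0[OF tangent_map_linear])
    finally have "v = 0"
      using inj_tangent_map by (rule injD[rotated])
    have "x $ i = 0" for i
    proof -
      have sm: "smooth_fun A P (\<lambda>r. \<phi> r \<bullet> axis i 1)" by (rule M.smooth_fun_chart[OF P(1) order_refl])
      note lin = M.vapply_linear[OF sm M.chart_open[OF P(1)] P(2)]
      have e: "vapply A q (?e j) (\<lambda>r. \<phi> r \<bullet> axis i 1) = (if i = j then 1 else 0)" for j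
      proof -
        have "vapply A q (?e j) (\<lambda>r. \<phi> r \<bullet> axis i 1) =
          frechet_derivative ((\<lambda>r. \<phi> r \<bullet> axis i 1) \<circ> inv_into P \<phi>) (at (\<phi> q)) (axis j 1)"
          by (rule M.vapply_coord_field[OF P sm M.chart_open[OF P(1)] P(2)])
        also have "\<dots> = frechet_derivative (\<lambda>y. y \<bullet> axis i 1) (at (\<phi> q)) (axis j 1)"
          by (rule fun_cong[OF frechet_derivative_cong_open[OF M.chart_range_open[OF P(1)]]])
            (use P in \<open>auto simp: P(1)\<close>)
        also have "\<dots> = axis j 1 \<bullet> axis i (1::real)"
          by (subst frechet_derivative_eqI[where f' = "\<lambda>y. y \<bullet> axis i 1"]) (auto intro!: derivative_eq_intros)
        finally show ?thesis by (simp add: inner_axis_axis)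
      qed
      have "0 = vapply A q v (\<lambda>r. \<phi> r \<bullet> axis i 1)"
        by (simp add: \<open>v = 0\<close> linear_0[OF lin])
      also have "\<dots> = x $ i"
        unfolding v_def by (simp add: linear_sum[OF lin] linear_cmul[OF lin] e if_distrib cong: if_cong)
      finally show ?thesis by simp
    qed
    then show "x = 0" by (simp add: vec_eq_iff)
  qed
  then show ?thesis
    using matrix_left_invertible_ker[of ?G] invertible_left_inverse[of ?G] invertible_det_nz[of ?G] by blast
qed

text \<open>The components \<open>z\<close> of \<open>Z\<close> are smooth since they solve the system \<open>J\<^sup>T J z = J\<^sup>T u\<close>, where \<open>J\<close> is the
  Jacobi matrix and \<open>u\<close> are the components of \<open>dF Z\<close>.  This is what makes the induced connection
  map smooth fields to smooth fields.\<close>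

lemma vector_field_reflect:
  assumes U: "open U" and Z: "field_along A B F U (\<lambda>q. tangent_map A B F q (Z q))"
  shows "vector_field A U Z"
  unfolding vector_field_def
proof (rule M.self.field_along_local[OF U])
  fix p assume p: "p \<in> U"
  obtain P \<phi> where P: "(P, \<phi>) \<in> A" "p \<in> P" by (rule M.chart_exists)
  obtain V \<psi> where V: "(V, \<psi>) \<in> B" "F p \<in> V" by (rule N.chart_exists)
  let ?U = "U \<inter> P \<inter> F -` V"
  have o: "open ?U" using U M.chart_open[OF P(1)] vimage_open[OF N.chart_open[OF V(1)]] by auto
  have UV: "?U \<subseteq> F -` V" by auto
  define e where "e = (\<lambda>i. M.coord_field (P, \<phi>) (axis i 1))"
  define J where "J = (\<lambda>a i. component \<psi> (\<lambda>q. tangent_map A B F q (e i q)) a)"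
  define G where "G = (\<lambda>q. (\<chi> i j. \<Sum>a\<in>Basis. J a i q * J a j q) :: real^'n^'n)"
  define z where "z = (\<lambda>q. (\<chi> i. vapply A q (Z q) (\<lambda>r. \<phi> r \<bullet> axis i 1)) :: real^'n)"
  define u where "u = component \<psi> (\<lambda>q. tangent_map A B F q (Z q))"
  have J: "smooth_fun A ?U (J a i)" for a i
    unfolding J_def e_def
    by (intro component_smooth[OF _ V(1) UV] field_along_tangent_map o
        M.vector_field_subset[OF M.coord_field_vector_field[OF P(1)]]) auto
  have u: "smooth_fun A ?U (u a)" for a
    unfolding u_def by (rule component_smooth[OF field_along_subset[OF Z] V(1) UV]) auto
  have "G q *v z q = (\<chi> i. \<Sum>a\<in>Basis. J a i q * u a q)" if q: "q \<in> ?U" for q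
  proof -
    have Zq: "Z q = (\<Sum>j\<in>UNIV. z q $ j *\<^sub>R e j q)"
      using M.coord_expansion[OF P(1), of q "Z q"] q unfolding sum_Basis_vec by (simp add: z_def e_def)
    have "u a q = (\<Sum>j\<in>UNIV. J a j q * z q $ j)" for a
    proof -
      have sm: "smooth_fun B V (\<lambda>r. \<psi> r \<bullet> a)" by (rule N.smooth_fun_chart[OF V(1) order_refl])
      have lin: "linear (\<lambda>v. vapply B (F q) v (\<lambda>r. \<psi> r \<bullet> a))"
        by (rule N.vapply_linear[OF sm N.chart_open[OF V(1)]]) (use q in auto)
      show ?thesis
        unfolding u_def component_def J_def
        by (subst Zq, simp only: linear_sum[OF tangent_map_linear] linear_cmul[OF tangent_map_linear]
            linear_sum[OF lin] linear_cmul[OF lin] real_scaleR_def mult.commute)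
    qed
    then show ?thesis
      by (simp add: vec_eq_iff matrix_vector_mult_def G_def sum_distrib_left sum_distrib_right mult.assoc)
        (auto intro: sum.swap)
  qed
  note Gz = this
  have "smooth_fun A ?U (\<lambda>q. z q $ i)" for i
  proof (rule M.matrix_solution_smooth[OF o, of G])
    show "smooth_fun A ?U (\<lambda>q. G q $ i $ j)" for i j
      unfolding G_def by (simp, intro M.smooth_fun_sum M.smooth_fun_mult o J)
    show "det (G q) \<noteq> 0" if "q \<in> ?U" for q
      unfolding G_def J_def e_def by (rule gram_matrix_nonsingular[OF P(1) _ V(1)]) (use that in auto)
    have "smooth_fun A ?U (\<lambda>q. \<Sum>a\<in>Basis. J a i q * u a q)" for i
      by (intro M.smooth_fun_sum M.smooth_fun_mult o J u)
    then show "smooth_fun A ?U (\<lambda>q. (G q *v z q) $ i)" for i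
      by (rule M.smooth_fun_cong[OF o, rotated]) (simp add: Gz)
  qed
  then have comp: "smooth_fun A ?U (M.self.component \<phi> Z j)" if "j \<in> Basis" for j
    using that by (auto simp: Basis_vec_def z_def M.self.component_def[abs_def])
  have "field_along A A (\<lambda>p. p) ?U Z"
    by (rule M.self.field_alongI_component[OF o P(1) _ comp]) auto
  then show "\<exists>U'. open U' \<and> p \<in> U' \<and> field_along A A (\<lambda>p. p) U' Z"
    using o p P V by (intro exI[of _ ?U]) auto
qed

end

section \<open>Lightlike hypersurfaces\<close>

locale lightlike_hypersurface =
  fixes H :: "('p::{t2_space,second_countable_topology}, 'n::finite,
               'q::{t2_space,second_countable_topology}, 'k::finite) hypersurface"
    and \<nu> :: nat and S :: "'p \<Rightarrow> (real^'n) set"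
  assumes hypersurface: "semi_riemannian_hypersurface H \<nu>"
    and screen: "screen_distribution H S"
    and normalizing_pair_exists: "\<exists>U \<xi> N. open U \<and> p \<in> U \<and> normalizing_pair H S U \<xi> N"

sublocale lightlike_hypersurface \<subseteq>
  pullback_connection "atl H" "ambient_atl H" "imm H" \<nu> "ambient_metric H" "ambient_conn H" "conn_along H"
  using hypersurface by unfold_locales (auto simp: semi_riemannian_hypersurface_def immersion_def)

sublocale lightlike_hypersurface \<subseteq> immersion_map "atl H" "ambient_atl H" "imm H"
  using hypersurface by unfold_locales (auto simp: semi_riemannian_hypersurface_def immersion_def)

context lightlike_hypersurface
begin

abbreviation gbar :: "'p \<Rightarrow> real^'k \<Rightarrow> real^'k \<Rightarrow> real" where "gbar p \<equiv> ambient_metric H (imm H p)"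

abbreviation gM :: "'p \<Rightarrow> real^'n \<Rightarrow> real^'n \<Rightarrow> real" where "gM \<equiv> induced_metric H"

abbreviation nabla where "nabla \<equiv> induced_conn H S"

lemma gM_eq: "gM p v w = gbar p (dF p v) (dF p w)"
  by (simp add: induced_metric_def metric_along_def)

lemmas dF_simps =
  linear_add[OF tangent_map_linear] linear_diff[OF tangent_map_linear]
  linear_cmul[OF tangent_map_linear] linear_0[OF tangent_map_linear]

lemma gM_sym: "gM p v w = gM p w v"
  by (simp add: gM_eq g_sym)

lemma gM_simps:
  "gM p (v + v') w = gM p v w + gM p v' w" "gM p w (v + v') = gM p w v + gM p w v'"
  "gM p (v - v') w = gM p v w - gM p v' w" "gM p w (v - v') = gM p w v - gM p w v'"
  "gM p (r *\<^sub>R v) w = r * gM p v w" "gM p w (r *\<^sub>R v) = r * gM p w v"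
  by (simp_all add: gM_eq dF_simps g_simps)

subsection \<open>The decomposition of the ambient tangent space along the hypersurface\<close>

context
  fixes p \<xi> N assumes n: "normalizing_at H S p \<xi> N"
begin

lemma gbar_xi_tangent: "gbar p (dF p \<xi>) (dF p v) = 0" "gbar p (dF p v) (dF p \<xi>) = 0"
  using n g_sym by (auto simp: normalizing_at_def radical_def normal_space_def metric_along_def)

lemma gbar_xi_N: "gbar p (dF p \<xi>) N = 1" "gbar p N (dF p \<xi>) = 1"
  using n g_sym by (auto simp: normalizing_at_def metric_along_def)

lemma gbar_N_N: "gbar p N N = 0"
  using n by (auto simp: normalizing_at_def metric_along_def)

text \<open>The vector \<open>N\<close> is transversal because \<open>gbar N (dF \<xi>) = 1\<close> whereas \<open>dF \<xi>\<close> is normal to the hypersurface; so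
  \<open>N\<close> and the tangent space span by dimension count, and pairing with \<open>dF \<xi>\<close> reads off the coefficient.\<close>

lemma ambient_decomposition: "\<exists>v. w = dF p v + gbar p w (dF p \<xi>) *\<^sub>R N"
proof -
  have sub: "subspace (range (dF p))" by (rule linear_subspace_image[OF tangent_map_linear subspace_UNIV])
  have "N \<notin> range (dF p)"
    using gbar_xi_N(2) gbar_xi_tangent(2) by auto
  then have "dim (insert N (range (dF p))) = DIM(real^'k)"
    using dim_image_eq[OF tangent_map_linear, of p UNIV] inj_tangent_map[of p] hypersurface sub
    by (simp add: dim_insert span_eq_iff[THEN iffD2] semi_riemannian_hypersurface_def)
  then have "w \<in> span (insert N (range (dF p)))"
    using dim_eq_full by blast
  then obtain b v where w: "w = dF p v + b *\<^sub>R N"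
    using sub by (auto simp: span_breakdown_eq span_eq_iff[THEN iffD2] algebra_simps image_iff)
  have "gbar p w (dF p \<xi>) = b"
    by (simp add: w g_simps gbar_xi_tangent gbar_xi_N)
  with w have "w = dF p v + gbar p w (dF p \<xi>) *\<^sub>R N" by simp
  then show ?thesis by (rule exI)
qed

lemma gbar_eqI:
  assumes "\<And>v. gbar p w (dF p v) = 0" "gbar p w N = 0"
  shows "w = 0"
proof (rule g_nondegenerate)
  fix u
  obtain v where v: "u = dF p v + gbar p u (dF p \<xi>) *\<^sub>R N" using ambient_decomposition by blast
  show "gbar p w u = 0" by (subst v) (simp add: g_simps assms)
qed

text \<open>Decompose \<open>N'\<close> into a screen part, a radical part and a multiple \<open>b N\<close>.  Orthogonality to the screen kills the
  screen part.  The normalization of \<open>N'\<close> gives \<open>b \<noteq> 0\<close>, and then nullity of \<open>N'\<close> makes the radical part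
  orthogonal to \<open>N\<close>; being orthogonal to the tangent space too, it vanishes.\<close>

lemma normalizing_unique:
  assumes n': "normalizing_at H S p \<xi>' N'"
  shows "\<exists>b. N' = b *\<^sub>R N"
proof -
  obtain v where v: "N' = dF p v + gbar p N' (dF p \<xi>) *\<^sub>R N" using ambient_decomposition by blast
  define b where "b = gbar p N' (dF p \<xi>)"
  have "v \<in> {s + x | s x. s \<in> S p \<and> x \<in> radical H p}"
    using screen by (simp add: screen_distribution_def)
  then obtain s x where sx: "s \<in> S p" "x \<in> radical H p" "v = s + x" by auto
  have x: "gbar p (dF p x) (dF p u) = 0" for u
    using sx(2) by (simp add: radical_def normal_space_def metric_along_def)
  have N': "N' = dF p s + dF p x + b *\<^sub>R N"
    using v sx(3) by (simp add: dF_simps b_def)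
  have "gM p s s' = 0" if "s' \<in> S p" for s'
  proof -
    have "gbar p N (dF p s') = 0" "gbar p N' (dF p s') = 0"
      using n n' that by (auto simp: normalizing_at_def metric_along_def)
    then show ?thesis by (simp add: N' g_simps x gM_eq)
  qed
  then have "s = 0"
    using screen sx(1) unfolding screen_distribution_def by blast
  then have N': "N' = dF p x + b *\<^sub>R N"
    using N' by (simp add: dF_simps)
  have x': "gbar p (dF p u) (dF p x) = 0" for u
    using x[of u] by (simp add: g_sym)
  have "gbar p (dF p \<xi>') N' = 1" "gbar p N' N' = 0"
    using n' by (auto simp: normalizing_at_def metric_along_def)
  then have "b \<noteq> 0" "b * gbar p (dF p x) N = 0"
    using g_sym[of _ N "dF p x"] by (auto simp: N' g_simps x x' gbar_N_N)
  then have "dF p x = 0"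
    by (intro gbar_eqI) (auto simp: x)
  then show ?thesis using N' by auto
qed

lemma transversal_eq: "transversal H S p = range (\<lambda>b. b *\<^sub>R N)"
proof -
  have "{N. \<exists>\<xi>. normalizing_at H S p \<xi> N} \<subseteq> range (\<lambda>b. b *\<^sub>R N)"
    using normalizing_unique by blast
  then have "transversal H S p \<subseteq> span {N}"
    unfolding transversal_def span_singleton[symmetric] by (metis span_mono span_span)
  moreover have "span {N} \<subseteq> transversal H S p"
    unfolding transversal_def using n by (intro span_mono) auto
  ultimately show ?thesis by (auto simp: span_singleton)
qed

end

text \<open>The projection to the hypersurface along the transversal line; the induced connection and the shape operator
  are tangential parts of derivatives along the immersion.\<close>

definition tangential :: "'p \<Rightarrow> real^'k \<Rightarrow> real^'n" where
  "tangential p w = (THE v. w - dF p v \<in> transversal H S p)"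

context
  fixes p \<xi> N assumes n: "normalizing_at H S p \<xi> N"
begin

lemma tangential_eq: "tangential p (dF p v + b *\<^sub>R N) = v"
  unfolding tangential_def transversal_eq[OF n]
proof (rule the_equality)
  fix v' assume "dF p v + b *\<^sub>R N - dF p v' \<in> range (\<lambda>b. b *\<^sub>R N)"
  then obtain d where d: "dF p v + b *\<^sub>R N - dF p v' = d *\<^sub>R N" by auto
  then have "gbar p (dF p v + b *\<^sub>R N - dF p v') (dF p \<xi>) = gbar p (d *\<^sub>R N) (dF p \<xi>)" by simp
  then have "b = d" by (simp add: g_simps gbar_xi_tangent[OF n] gbar_xi_N[OF n])
  with d have "dF p v = dF p v'" by simp
  then show "v' = v" using inj_tangent_map[of p] by (simp add: inj_eq)
qed auto

lemma dF_tangential: "dF p (tangential p w) = w - gbar p w (dF p \<xi>) *\<^sub>R N"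
proof -
  obtain v where v: "w = dF p v + gbar p w (dF p \<xi>) *\<^sub>R N" using ambient_decomposition[OF n] by blast
  have "tangential p w = v" by (subst v) (rule tangential_eq)
  with v show ?thesis by (simp add: algebra_simps)
qed

lemma tangential_simps:
  "tangential p (w + w') = tangential p w + tangential p w'" "tangential p (w - w') = tangential p w - tangential p w'"
  "tangential p (r *\<^sub>R w) = r *\<^sub>R tangential p w" "tangential p (dF p v) = v" "tangential p N = 0"
proof -
  show "tangential p (dF p v) = v" for v using tangential_eq[of v 0] by simp
  show "tangential p N = 0" using tangential_eq[of 0 1] by (simp add: dF_simps)
  obtain v b where w: "w = dF p v + b *\<^sub>R N" using ambient_decomposition[OF n, of w] by blast
  obtain v' b' where w': "w' = dF p v' + b' *\<^sub>R N" using ambient_decomposition[OF n, of w'] by blast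
  have pw: "tangential p w = v" "tangential p w' = v'"
    unfolding w w' by (rule tangential_eq)+
  have "w + w' = dF p (v + v') + (b + b') *\<^sub>R N" "w - w' = dF p (v - v') + (b - b') *\<^sub>R N"
    "r *\<^sub>R w = dF p (r *\<^sub>R v) + (r * b) *\<^sub>R N"
    by (simp_all add: w w' dF_simps algebra_simps)
  then show "tangential p (w + w') = tangential p w + tangential p w'" "tangential p (w - w') = tangential p w - tangential p w'"
    "tangential p (r *\<^sub>R w) = r *\<^sub>R tangential p w"
    unfolding pw by (simp_all only: tangential_eq)
qed

end

lemma normalizing_pair_subset:
  assumes "normalizing_pair H S U \<xi> N" "U' \<subseteq> U"
  shows "normalizing_pair H S U' \<xi> N"
  unfolding normalizing_pair_def
proof (intro conjI ballI)
  show "vector_field (atl H) U' \<xi>"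
    by (rule M.vector_field_subset[OF _ assms(2)]) (use assms(1) in \<open>simp add: normalizing_pair_def\<close>)
  show "field_along (atl H) (ambient_atl H) (imm H) U' N"
    by (rule field_along_subset[OF _ assms(2)]) (use assms(1) in \<open>simp add: normalizing_pair_def\<close>)
  show "normalizing_at H S q (\<xi> q) (N q)" if "q \<in> U'" for q
    using assms that by (auto simp: normalizing_pair_def)
qed

lemma normalizing_at_exists: "\<exists>\<xi> N. normalizing_at H S p \<xi> N"
  using normalizing_pair_exists[of p] unfolding normalizing_pair_def by blast

lemma nabla_eq: "nabla X Y p = tangential p (conn_along H X (\<lambda>q. dF q (Y q)) p)"
  by (simp add: induced_conn_def tangential_def)

lemma shape_operator_eq:
  assumes n: "normalizing_at H S p \<xi> (N p)"
  shows "shape_operator H S N X p = - tangential p (conn_along H X N p)"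
proof -
  let ?D = "conn_along H X N p"
  have "(?D - - dF p v \<in> transversal H S p) \<longleftrightarrow> (- ?D - dF p v \<in> transversal H S p)" for v
    unfolding transversal_def
    using span_neg[of "?D + dF p v"] span_neg[of "- ?D - dF p v"] by (auto simp: algebra_simps)
  then have "shape_operator H S N X p = tangential p (- ?D)"
    unfolding shape_operator_def tangential_def by simp
  also have "- ?D = (-1) *\<^sub>R ?D" by simp
  also have "tangential p ((-1) *\<^sub>R ?D) = (-1) *\<^sub>R tangential p ?D" by (rule tangential_simps(3)[OF n])
  finally show ?thesis by simp
qed

text \<open>Near each point the tangential part is \<open>W\<close> minus a smooth multiple of the smooth field \<open>N\<close>, and an
  immersion reflects smoothness.\<close>

lemma vector_field_tangential:
  assumes U: "open U" and W: "field_along (atl H) (ambient_atl H) (imm H) U W"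
  shows "vector_field (atl H) U (\<lambda>q. tangential q (W q))"
proof (rule vector_field_reflect[OF U], rule field_along_local[OF U])
  fix p assume p: "p \<in> U"
  obtain U' \<xi> N where U': "open U'" "p \<in> U'" "normalizing_pair H S U' \<xi> N"
    using normalizing_pair_exists by blast
  let ?U = "U \<inter> U'"
  have o: "open ?U" using U U' by auto
  have \<xi>: "vector_field (atl H) ?U \<xi>" and N: "field_along (atl H) (ambient_atl H) (imm H) ?U N"
    using U'(3) field_along_subset M.vector_field_subset unfolding normalizing_pair_def by blast+
  have W': "field_along (atl H) (ambient_atl H) (imm H) ?U W"
    using W field_along_subset by blast
  have "field_along (atl H) (ambient_atl H) (imm H) ?U (\<lambda>q. W q - gbar q (W q) (dF q (\<xi> q)) *\<^sub>R N q)"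
    by (intro field_along_diff field_along_scale g_along_smooth field_along_tangent_map o W' N \<xi>)
  then have "field_along (atl H) (ambient_atl H) (imm H) ?U (\<lambda>q. dF q (tangential q (W q)))"
    by (rule field_along_cong[OF o, rotated]) (use U'(3) dF_tangential in \<open>auto simp: normalizing_pair_def\<close>)
  then show "\<exists>U'. open U' \<and> p \<in> U' \<and> field_along (atl H) (ambient_atl H) (imm H) U' (\<lambda>q. dF q (tangential q (W q)))"
    using o p U' by blast
qed

lemma nabla_vector_field:
  assumes "open U" "vector_field (atl H) U X" "vector_field (atl H) U Y"
  shows "vector_field (atl H) U (nabla X Y)"
  using vector_field_tangential[OF assms(1) D_field[OF assms(1,2) field_along_tangent_map[OF assms(1,3)]]]
  by (simp add: nabla_eq[abs_def])

subsection \<open>The second fundamental form and the Gauss equation\<close>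

text \<open>The coefficient of \<open>N\<close> in the Gauss formula is obtained by pairing with the radical field \<open>\<xi>\<close>.\<close>

definition second_form :: "('p \<Rightarrow> real^'n) \<Rightarrow> ('p \<Rightarrow> real^'n) \<Rightarrow> ('p \<Rightarrow> real^'n) \<Rightarrow> 'p \<Rightarrow> real" where
  "second_form \<xi> X Y p = gbar p (conn_along H X (\<lambda>q. dF q (Y q)) p) (dF p (\<xi> p))"

context
  fixes U \<xi> N assumes U: "open U" and pair: "normalizing_pair H S U \<xi> N"
begin

lemma xi_field: "vector_field (atl H) U \<xi>"
  using pair by (simp add: normalizing_pair_def)

lemma N_field: "field_along (atl H) (ambient_atl H) (imm H) U N"
  using pair by (simp add: normalizing_pair_def)

lemma normalizing: "q \<in> U \<Longrightarrow> normalizing_at H S q (\<xi> q) (N q)"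
  using pair by (simp add: normalizing_pair_def)

lemma second_form_smooth:
  assumes "vector_field (atl H) U X" "vector_field (atl H) U Y"
  shows "smooth_fun (atl H) U (second_form \<xi> X Y)"
  unfolding second_form_def
  by (intro g_along_smooth[OF U] D_field[OF U assms(1)] field_along_tangent_map[OF U] assms(2) xi_field)

lemma gauss_formula:
  assumes "q \<in> U"
  shows "dF q (nabla X Y q) = conn_along H X (\<lambda>q. dF q (Y q)) q - second_form \<xi> X Y q *\<^sub>R N q"
  unfolding nabla_eq second_form_def by (rule dF_tangential[OF normalizing[OF assms]])

text \<open>The difference of the two sides pairs \<open>\<xi>\<close> with the tangent vector \<open>dF [X,Y]\<close>.\<close>

lemma second_form_sym:
  assumes "vector_field (atl H) U X" "vector_field (atl H) U Y" "q \<in> U"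
  shows "second_form \<xi> X Y q = second_form \<xi> Y X q"
proof -
  have "gbar q (conn_along H X (\<lambda>q. dF q (Y q)) q - conn_along H Y (\<lambda>q. dF q (X q)) q) (dF q (\<xi> q)) = 0"
    unfolding D_torsion_free[OF U assms] by (rule gbar_xi_tangent[OF normalizing[OF assms(3)]])
  then show ?thesis by (simp add: second_form_def g_simps)
qed

text \<open>The function \<open>gbar (dF \<xi>) (dF \<xi>)\<close> is identically zero, and its derivative along \<open>X\<close> is twice the first
  expression.\<close>

lemma second_form_xi:
  assumes "vector_field (atl H) U X" "q \<in> U"
  shows "second_form \<xi> X \<xi> q = 0" "second_form \<xi> \<xi> X q = 0"
proof -
  have "vapply (atl H) q (X q) (\<lambda>r. gbar r (dF r (\<xi> r)) (dF r (\<xi> r))) = vapply (atl H) q (X q) (\<lambda>r. 0)"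
    by (rule M.vapply_cong[OF U assms(2)]) (use gbar_xi_tangent normalizing in blast)
  then show *: "second_form \<xi> X \<xi> q = 0"
    using D_metric[OF U assms field_along_tangent_map[OF U xi_field] field_along_tangent_map[OF U xi_field]]
      g_sym[of "imm H q" "dF q (\<xi> q)" "conn_along H X (\<lambda>r. dF r (\<xi> r)) q"]
    by (simp add: second_form_def M.vapply_const)
  show "second_form \<xi> \<xi> X q = 0"
    using second_form_sym[OF assms(1) xi_field assms(2)] * by simp
qed

text \<open>Differentiating the Gauss formula produces \<open>B(Y,Z) N\<close> differentiated along \<open>X\<close>; the part along \<open>N\<close> is
  projected away and the derivative of \<open>N\<close> contributes the shape operator.\<close>

lemma gauss_equation:
  assumes X: "vector_field (atl H) U X" and Y: "vector_field (atl H) U Y" and Z: "vector_field (atl H) U Z"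
    and p: "p \<in> U"
  shows "Rm H S X Y Z p = tangential p (curvature_along X Y (\<lambda>q. dF q (Z q)) p)
    + second_form \<xi> Y Z p *\<^sub>R shape_operator H S N X p - second_form \<xi> X Z p *\<^sub>R shape_operator H S N Y p"
proof -
  note P = tangential_simps[OF normalizing[OF p]]
  have *: "nabla X (nabla Y Z) p = tangential p (conn_along H X (conn_along H Y (\<lambda>q. dF q (Z q))) p)
      + second_form \<xi> Y Z p *\<^sub>R shape_operator H S N X p"
    if X: "vector_field (atl H) U X" and Y: "vector_field (atl H) U Y" for X Y
  proof -
    let ?W = "conn_along H Y (\<lambda>q. dF q (Z q))" and ?b = "second_form \<xi> Y Z"
    note W = D_field[OF U Y field_along_tangent_map[OF U Z]]
    note bN = field_along_scale[OF U N_field second_form_smooth[OF Y Z]]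
    have "conn_along H X (\<lambda>q. dF q (nabla Y Z q)) p = conn_along H X (\<lambda>q. ?W q - ?b q *\<^sub>R N q) p"
      by (rule D_local[OF U X field_along_tangent_map[OF U nabla_vector_field[OF U Y Z]]
          field_along_diff[OF U W bN] X _ gauss_formula p]) simp
    also have "\<dots> = conn_along H X ?W p - (vapply (atl H) p (X p) ?b *\<^sub>R N p + ?b p *\<^sub>R conn_along H X N p)"
      by (simp add: D_diff[OF U X W bN p] D_scale[OF U X second_form_smooth[OF Y Z] N_field p])
    finally show ?thesis
      by (simp add: nabla_eq[of X] P shape_operator_eq[of p "\<xi> p" N, OF normalizing[OF p]])
  qed
  show ?thesis
    unfolding Rm_def curvature_def *[OF X Y] *[OF Y X] curvature_along_def nabla_eq[of "lie_bracket (atl H) X Y"]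
    by (simp add: P)
qed

end

end

section \<open>Admissible screens in spaces of constant curvature\<close>

locale admissible_constant_curvature = lightlike_hypersurface +
  fixes k :: real
  assumes constant_curvature: "has_constant_curvature (ambient_atl H) (ambient_metric H) (ambient_conn H) k"
    and admissible: "admissible_screen H S"
    and nonnull: "nonnull_A_N_xi H S"
begin

lemma Rm_constant_curvature:
  assumes U: "open U" and pair: "normalizing_pair H S U \<xi> N"
    and X: "vector_field (atl H) U X" and Y: "vector_field (atl H) U Y" and Z: "vector_field (atl H) U Z"
    and p: "p \<in> U"
  shows "Rm H S X Y Z p = k *\<^sub>R (gM p (Y p) (Z p) *\<^sub>R X p - gM p (X p) (Z p) *\<^sub>R Y p)
    + second_form \<xi> Y Z p *\<^sub>R shape_operator H S N X p - second_form \<xi> X Z p *\<^sub>R shape_operator H S N Y p"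
  using gauss_equation[OF U pair X Y Z p] tangential_simps[OF normalizing[OF U pair p]]
    curvature_along_constant_curvature[OF constant_curvature U X Y field_along_tangent_map[OF U Z] p]
  by (simp add: gM_eq)

text \<open>Apply pair symmetry to \<open>R(\<xi>,Y,Z,W)\<close> with \<open>W = A\<^sub>N \<xi>\<close> at the point.  Degeneracy of \<open>g\<close> and \<open>B\<close> along \<open>\<xi>\<close> leaves
  only \<open>B(Y,Z) g(A\<^sub>N \<xi>, A\<^sub>N \<xi>)\<close> on one side and nothing on the other.\<close>

lemma second_form_vanishes:
  assumes U: "open U" and pair: "normalizing_pair H S U \<xi> N" and p: "p \<in> U"
    and nn: "gM p (shape_operator H S N \<xi> p) (shape_operator H S N \<xi> p) \<noteq> 0"
    and Y: "vector_field (atl H) U Y" and Z: "vector_field (atl H) U Z"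
  shows "second_form \<xi> Y Z p = 0"
proof -
  let ?A = "shape_operator H S N \<xi> p"
  obtain P W where W: "open P" "p \<in> P" "vector_field (atl H) P W" "W p = ?A"
    using M.tangent_vector_extends by blast
  let ?V = "U \<inter> P"
  have V: "open ?V" "p \<in> ?V" using U p W by auto
  have pairV: "normalizing_pair H S ?V \<xi> N"
    by (rule normalizing_pair_subset[OF pair]) auto
  have f: "vector_field (atl H) ?V \<xi>" "vector_field (atl H) ?V Y" "vector_field (atl H) ?V Z" "vector_field (atl H) ?V W"
    by (rule M.vector_field_subset[OF xi_field[OF U pair]] M.vector_field_subset[OF Y]
        M.vector_field_subset[OF Z] M.vector_field_subset[OF W(3)], auto)+
  note xi = gbar_xi_tangent[OF normalizing[OF U pair p], folded gM_eq] second_form_xi[OF V(1) pairV _ V(2)]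
  have "Rm4 H S \<xi> Y Z W p = Rm4 H S Z W \<xi> Y p"
    using admissible[unfolded admissible_screen_def, THEN conjunct2, rule_format, of ?V \<xi> Y Z W p] V f by simp
  moreover have "Rm4 H S \<xi> Y Z W p = second_form \<xi> Y Z p * gM p ?A ?A"
    unfolding Rm4_def Rm_constant_curvature[OF V(1) pairV f(1-3) V(2)]
    by (simp add: gM_simps xi f W(4))
  moreover have "Rm4 H S Z W \<xi> Y p = 0"
    unfolding Rm4_def Rm_constant_curvature[OF V(1) pairV f(3,4,1) V(2)]
    by (simp add: xi f) (simp add: gM_eq dF_simps g_simps)
  ultimately show ?thesis using nn by simp
qed

lemma gauss_totally_geodesic:
  assumes U: "open U" and X: "vector_field (atl H) U X" and Y: "vector_field (atl H) U Y" and p: "p \<in> U"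
  shows "conn_along H X (\<lambda>q. dF q (Y q)) p = dF p (nabla X Y p)"
proof -
  obtain U' \<xi> N where U': "open U'" "p \<in> U'" "normalizing_pair H S U' \<xi> N"
    "gM p (shape_operator H S N \<xi> p) (shape_operator H S N \<xi> p) \<noteq> 0"
    using nonnull unfolding nonnull_A_N_xi_def by blast
  let ?V = "U \<inter> U'"
  have V: "open ?V" "p \<in> ?V" using U p U' by auto
  have pairV: "normalizing_pair H S ?V \<xi> N"
    by (rule normalizing_pair_subset[OF U'(3)]) auto
  have f: "vector_field (atl H) ?V X" "vector_field (atl H) ?V Y"
    by (rule M.vector_field_subset[OF X] M.vector_field_subset[OF Y], auto)+
  show ?thesis
    using gauss_formula[OF V(1) pairV V(2), of X Y] second_form_vanishes[OF V(1) pairV V(2) U'(4) f] by simp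
qed

lemma Rm_totally_geodesic:
  assumes U: "open U" and X: "vector_field (atl H) U X" and Y: "vector_field (atl H) U Y"
    and Z: "vector_field (atl H) U Z" and p: "p \<in> U"
  shows "Rm H S X Y Z p = k *\<^sub>R (gM p (Y p) (Z p) *\<^sub>R X p - gM p (X p) (Z p) *\<^sub>R Y p)"
proof -
  obtain U' \<xi> N where U': "open U'" "p \<in> U'" "normalizing_pair H S U' \<xi> N"
    "gM p (shape_operator H S N \<xi> p) (shape_operator H S N \<xi> p) \<noteq> 0"
    using nonnull unfolding nonnull_A_N_xi_def by blast
  let ?V = "U \<inter> U'"
  have V: "open ?V" "p \<in> ?V" using U p U' by auto
  have pairV: "normalizing_pair H S ?V \<xi> N"
    by (rule normalizing_pair_subset[OF U'(3)]) auto
  have f: "vector_field (atl H) ?V X" "vector_field (atl H) ?V Y" "vector_field (atl H) ?V Z"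
    by (rule M.vector_field_subset[OF X] M.vector_field_subset[OF Y] M.vector_field_subset[OF Z], auto)+
  show ?thesis
    using Rm_constant_curvature[OF V(1) pairV f V(2)] second_form_vanishes[OF V(1) pairV V(2) U'(4)] f by simp
qed

lemma gM_smooth:
  assumes "open U" "vector_field (atl H) U X" "vector_field (atl H) U Y"
  shows "smooth_fun (atl H) U (\<lambda>q. gM q (X q) (Y q))"
  unfolding gM_eq by (intro g_along_smooth field_along_tangent_map assms)

text \<open>The defect of the induced connection from being metric is expressed by the second fundamental form,
  which vanishes.\<close>

lemma nabla_metric:
  assumes U: "open U" and X: "vector_field (atl H) U X" and Y: "vector_field (atl H) U Y"
    and Z: "vector_field (atl H) U Z" and p: "p \<in> U"
  shows "vapply (atl H) p (X p) (\<lambda>q. gM q (Y q) (Z q)) = gM p (nabla X Y p) (Z p) + gM p (Y p) (nabla X Z p)"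
  unfolding gM_eq
  using D_metric[OF U X p field_along_tangent_map[OF U Y] field_along_tangent_map[OF U Z]]
  by (simp add: gauss_totally_geodesic[OF U X _ p] Y Z)

lemma nabla_diff_scale:
  assumes U: "open U" and X: "vector_field (atl H) U X" and Y: "vector_field (atl H) U Y"
    and Z: "vector_field (atl H) U Z" and p: "p \<in> U"
    and f: "smooth_fun (atl H) U f" and h: "smooth_fun (atl H) U h"
  shows "nabla X (\<lambda>q. f q *\<^sub>R Y q - h q *\<^sub>R Z q) p =
    vapply (atl H) p (X p) f *\<^sub>R Y p + f p *\<^sub>R nabla X Y p - (vapply (atl H) p (X p) h *\<^sub>R Z p + h p *\<^sub>R nabla X Z p)"
proof -
  obtain \<xi> N where n: "normalizing_at H S p \<xi> N" using normalizing_at_exists by blast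
  note F = field_along_tangent_map[OF U Y] field_along_tangent_map[OF U Z]
  show ?thesis
    unfolding nabla_eq dF_simps
    by (simp add: D_diff[OF U X field_along_scale[OF U F(1) f] field_along_scale[OF U F(2) h] p]
        D_scale[OF U X f F(1) p] D_scale[OF U X h F(2) p] tangential_simps[OF n])
qed

text \<open>The curvature field is a combination of \<open>X\<close> and \<open>Y\<close> with coefficients \<open>g(Y,Z)\<close> and \<open>g(X,Z)\<close>; its derivative
  is given by the Leibniz rule, since the connection is metric.\<close>

lemma locally_symmetric: "locally_symmetric H S"
  unfolding locally_symmetric_def
proof (intro allI impI, elim conjE)
  fix W X Y Z p
  assume f: "global_field H W" "global_field H X" "global_field H Y" "global_field H Z"
  note R = Rm_totally_geodesic[OF open_UNIV _ _ _ UNIV_I]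
  note n = nabla_vector_field[OF open_UNIV f(1)]
  have sm: "smooth_fun (atl H) UNIV (\<lambda>q. k * gM q (V q) (Z q))" if "global_field H V" for V
    by (intro M.smooth_fun_mult M.smooth_fun_const gM_smooth that f open_UNIV)
  have d: "vapply (atl H) p (W p) (\<lambda>q. k * gM q (V q) (Z q)) =
      k * (gM p (nabla W V p) (Z p) + gM p (V p) (nabla W Z p))" if "global_field H V" for V
    using M.vapply_mult[OF M.smooth_fun_const gM_smooth[OF open_UNIV that f(4)] open_UNIV UNIV_I]
      nabla_metric[OF open_UNIV f(1) that f(4) UNIV_I] by (simp add: M.vapply_const)
  have "Rm H S X Y Z = (\<lambda>q. (k * gM q (Y q) (Z q)) *\<^sub>R X q - (k * gM q (X q) (Z q)) *\<^sub>R Y q)"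
    using R[OF f(2-4)] by (auto simp: algebra_simps)
  then have e: "nabla W (Rm H S X Y Z) p =
      (k * (gM p (nabla W Y p) (Z p) + gM p (Y p) (nabla W Z p))) *\<^sub>R X p + (k * gM p (Y p) (Z p)) *\<^sub>R nabla W X p
      - ((k * (gM p (nabla W X p) (Z p) + gM p (X p) (nabla W Z p))) *\<^sub>R Y p + (k * gM p (X p) (Z p)) *\<^sub>R nabla W Y p)"
    using nabla_diff_scale[OF open_UNIV f(1-3) UNIV_I sm[OF f(3)] sm[OF f(2)]] by (simp add: d f)
  show "nabla W (Rm H S X Y Z) p - Rm H S (nabla W X) Y Z p - Rm H S X (nabla W Y) Z p
      - Rm H S X Y (nabla W Z) p = 0"
    unfolding e R[OF n[OF f(2)] f(3,4)] R[OF f(2) n[OF f(3)] f(4)] R[OF f(2,3) n[OF f(4)]]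
    by (simp add: algebra_simps)
qed

text \<open>The operator \<open>R(V\<^sub>1,V\<^sub>2)\<close> sends \<open>X\<close> to \<open>k (g(V\<^sub>2,X) V\<^sub>1 - g(V\<^sub>1,X) V\<^sub>2)\<close>; inserting this into the formula for
  \<open>R\<close>, all terms cancel in pairs.\<close>

lemma semi_symmetric: "semi_symmetric H S"
  unfolding semi_symmetric_def
proof (intro allI impI, elim conjE)
  fix V1 V2 X Y Z T p
  assume f: "global_field H V1" "global_field H V2" "global_field H X" "global_field H Y" "global_field H Z" "global_field H T"
  note R = Rm_totally_geodesic[OF open_UNIV _ _ _ UNIV_I]
  have RF: "global_field H (Rm H S V1 V2 V)" if V: "global_field H V" for V
  proof -
    have "Rm H S V1 V2 V = (\<lambda>q. (k * gM q (V2 q) (V q)) *\<^sub>R V1 q - (k * gM q (V1 q) (V q)) *\<^sub>R V2 q)"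
      using R[OF f(1,2) V] by (auto simp: algebra_simps)
    moreover have "vector_field (atl H) UNIV (\<lambda>q. (k * gM q (V2 q) (V q)) *\<^sub>R V1 q - (k * gM q (V1 q) (V q)) *\<^sub>R V2 q)"
      using f V unfolding vector_field_def
      by (intro M.self.field_along_diff M.self.field_along_scale open_UNIV M.smooth_fun_mult M.smooth_fun_const
          gM_smooth[unfolded vector_field_def])
    ultimately show ?thesis by simp
  qed
  show "- Rm4 H S (Rm H S V1 V2 X) Y Z T p - Rm4 H S X (Rm H S V1 V2 Y) Z T p
      - Rm4 H S X Y (Rm H S V1 V2 Z) T p - Rm4 H S X Y Z (Rm H S V1 V2 T) p = 0"
    unfolding Rm4_def
    by (simp add: R RF f gM_simps gM_sym[of p "Y p" "X p"] gM_sym[of p "Z p" "X p"] gM_sym[of p "T p" "X p"]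
        gM_sym[of p "Z p" "Y p"] gM_sym[of p "T p" "Y p"] gM_sym[of p "T p" "Z p"]
        gM_sym[of p "X p" "V1 p"] gM_sym[of p "X p" "V2 p"] gM_sym[of p "Y p" "V1 p"] gM_sym[of p "Y p" "V2 p"] gM_sym[of p "Z p" "V1 p"] gM_sym[of p "Z p" "V2 p"] gM_sym[of p "T p" "V1 p"] gM_sym[of p "T p" "V2 p"] algebra_simps)
qed

end

theorem corollary5p4:
  fixes H :: "('p::{t2_space,second_countable_topology}, 'n::finite,
               'q::{t2_space,second_countable_topology}, 'k::finite) hypersurface"
    and \<nu> :: nat and c :: real and S :: "'p \<Rightarrow> (real^'n) set"
  assumes "semi_riemannian_hypersurface H \<nu>" and "\<nu> \<ge> 1"
    and "has_constant_curvature (ambient_atl H) (ambient_metric H) (ambient_conn H) c"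
    and "lightlike H"
    and "pointwise_osserman H"
    and "admissible_screen H S"
    and "nonnull_A_N_xi H S"
  shows "locally_symmetric H S \<longleftrightarrow> semi_symmetric H S"
proof -
  interpret admissible_constant_curvature H \<nu> S c
  proof
    show "screen_distribution H S" using assms(6) by (simp add: admissible_screen_def)
    show "\<exists>U \<xi> N. open U \<and> p \<in> U \<and> normalizing_pair H S U \<xi> N" for p
      using assms(7) unfolding nonnull_A_N_xi_def by blast
  qed (fact assms)+
  show ?thesis using locally_symmetric semi_symmetric by simp
qed

end
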